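(* Fix $\alpha\in(0,1)$ and an integer $m\ge2$. Let $a(\theta)$ satisfy $\lim_{\theta\to\infty}a(\theta)=\infty$, $\lim_{\theta\to\infty}\frac{a(\theta)}{\sqrt\theta}=0$, and, for some $0<\varepsilon<\frac1{2m-1}$, $$\liminf_{\theta\to\infty}\frac{a(\theta)^{1-\varepsilon}}{\theta^{(m-1)/(2m-1)}}>0.$$ Then, as $\theta\to\infty$, the family of laws of $$a(\theta)\left(\frac{\theta^{m-1}\Gamma(1-\alpha)}{\Gamma(m-\alpha)}H_m(\mathbf P(\alpha,\theta))-1\right)$$ satisfies a large deviation principle on $\mathbb R$ with speed $\frac{a^2(\theta)}{\theta}$ and rate function $z\mapsto\frac{z^2}{2\sigma^2_{\alpha,m}}$, where $$\sigma^2_{\alpha,m}=\frac{\Gamma(2m-\alpha)\Gamma(1-\alpha)}{\Gamma(m-\alpha)^2}+\alpha-m^2.$$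
   Context: For $\alpha\in(0,1)$ and $\theta>0$, let $U_1,U_2,\ldots$ be independent with $U_k\sim \mathrm{Beta}(1-\alpha,\theta+k\alpha)$, and set $X_1^{\alpha,\theta}=U_1$, $X_n^{\alpha,\theta}=(1-U_1)\cdots(1-U_{n-1})U_n$ for $n\ge2$. $\mathbf P(\alpha,\theta)=(P_1(\alpha,\theta),P_2(\alpha,\theta),\ldots)$ denotes the sequence $(X_k^{\alpha,\theta})_k$ rearranged in descending order; its law is the two-parameter Poisson-Dirichlet distribution $\Pi_{\alpha,\theta}$. For $\mathbf p=(p_1,p_2,\ldots)$, the homozygosity of order $m$ is $H_m(\mathbf p)=\sum_{i=1}^\infty p_i^m$. A family of laws $\mu_\theta$ on a topological space $E$ satisfies a large deviation principle as $\theta\to\infty$ with speed $\lambda(\theta)\to0$ and rate function $I:E\to[0,\infty]$ (lower semicontinuous) if $\limsup_{\theta\to\infty}\lambda(\theta)\log\mu_\theta(F)\le-\inf_F I$ for every closed $F$ and $\liminf_{\theta\to\infty}\lambda(\theta)\log\mu_\theta(G)\ge-\inf_G I$ for every open $G$. *)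

theory Defs
  imports "HOL-Probability.Probability"
begin

definition beta_density :: "real \<Rightarrow> real \<Rightarrow> real \<Rightarrow> real" where
  "beta_density a b x =
     (if 0 < x \<and> x < 1 then x powr (a - 1) * (1 - x) powr (b - 1) / Beta a b else 0)"

(* All sequences are indexed from 0: entry n here is entry n + 1 in the usual notation. *)

definition stick_breaking :: "(nat \<Rightarrow> real) \<Rightarrow> nat \<Rightarrow> real" where
  "stick_breaking u n = (\<Prod>k<n. 1 - u k) * u n"

definition descending_rearrangement :: "(nat \<Rightarrow> real) \<Rightarrow> (nat \<Rightarrow> real) \<Rightarrow> bool" where
  "descending_rearrangement x p \<longleftrightarrow> decseq p \<and> (\<exists>\<pi>. bij \<pi> \<and> (\<forall>i. p i = x (\<pi> i)))"

definition homozygosity :: "nat \<Rightarrow> (nat \<Rightarrow> real) \<Rightarrow> real" where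
  "homozygosity m p = (\<Sum>i. p i ^ m)"

(* Needed because ln 0 is an unspecified real, whereas log 0 = -\<infinity> in a large deviation principle. *)
definition log_ereal :: "real \<Rightarrow> ereal" where
  "log_ereal x = (if x = 0 then -\<infinity> else ereal (ln x))"

definition rate_function :: "('e::topological_space \<Rightarrow> ereal) \<Rightarrow> bool" where
  "rate_function I \<longleftrightarrow> (\<forall>x. 0 \<le> I x) \<and> (\<forall>c. closed {x. I x \<le> c})"

(* The speed tends to 0 through positive values.  The infimum over the empty set is \<infinity>. *)
definition LDP ::
  "(real \<Rightarrow> 'e::topological_space measure) \<Rightarrow> (real \<Rightarrow> real) \<Rightarrow> ('e \<Rightarrow> ereal) \<Rightarrow> bool" where
  "LDP \<mu> spd I \<longleftrightarrow>
     (\<forall>\<^sub>F \<theta> in at_top. prob_space (\<mu> \<theta>) \<and> sets (\<mu> \<theta>) = sets borel) \<and>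
     filterlim spd (at_right 0) at_top \<and>
     rate_function I \<and>
     (\<forall>F. closed F \<longrightarrow>
        Limsup at_top (\<lambda>\<theta>. ereal (spd \<theta>) * log_ereal (measure (\<mu> \<theta>) F)) \<le> - (INF x\<in>F. I x)) \<and>
     (\<forall>G. open G \<longrightarrow>
        Liminf at_top (\<lambda>\<theta>. ereal (spd \<theta>) * log_ereal (measure (\<mu> \<theta>) G)) \<ge> - (INF x\<in>G. I x))"

definition sigma_sq :: "real \<Rightarrow> nat \<Rightarrow> real" where
  "sigma_sq \<alpha> m =
     Gamma (2 * real m - \<alpha>) * Gamma (1 - \<alpha>) / (Gamma (real m - \<alpha>))\<^sup>2 + \<alpha> - (real m)\<^sup>2"

end

theory Submission
  imports Defs "HOL-Real_Asymp.Real_Asymp"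
begin

text \<open>
  The homozygosity only depends on the multiset of the stick lengths, so the ranking can be ignored and
  the stick-breaking process \<open>X\<^sub>n = W\<^sub>n U\<^sub>n\<close> can be used directly. After \<open>n\<close> steps, what remains is a copy of the
  process with parameter \<open>\<theta> + n \<alpha>\<close>, scaled by \<open>W\<^sub>n\<close>. The mean \<open>h\<close> and the variance \<open>v\<close> of the homozygosity
  are explicit rational functions of the parameter. Hence, for \<open>s = l \<theta>^m / (a C)\<close>, the exponential of
  \<open>s (X\<^sub>0^m + \<dots> + X\<^sub>n\<^sub>-\<^sub>1^m + W\<^sub>n^m h(\<theta> + n \<alpha>)) + s^2/2 W\<^sub>n^(2m) v(\<theta> + n \<alpha>)\<close>
  is a martingale up to factors \<open>1 + O(a^(-3) (\<theta> / (\<theta> + n \<alpha>))^2)\<close>, once all \<open>U\<^sub>n\<close> are restricted to be at most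
  \<open>a^((1-\<epsilon>)/(m-1)) / \<theta>\<close>. The product of these factors is \<open>exp (O(\<theta> / a^3))\<close>, negligible on the scale
  \<open>\<theta> / a^2\<close>, and by the lower bound on \<open>a\<close> so is the excluded event. This gives a quadratic limit of the
  scaled logarithmic exponential moments, and the large deviation principle follows by exponential tilting.
\<close>

section \<open>Beta laws\<close>

text \<open>Without a restriction the exponential moments are too large: with \<open>s\<close> of
  order \<theta>^m / a, a stick of length \<open>u\<close> contributes about exp (const (\<theta>
  u)^m / a) for a positive tilt, which beats the decay exp (- \<theta> u) of its law once (\<theta>
  u)^(m-1) exceeds \<open>a\<close>. The cutoff keeps (\<theta> u)^(m-1) / a below a^(-\<epsilon>),
  so that the contribution is a vanishing multiple of \<theta> u in the exponent. Its price is about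
  exp (- K / 2), for sticks longer than K / \<theta> with K = a^((1-\<epsilon>)/(m-1)). The
  hypothesis on \<open>a\<close> bounds K from below by a multiple of \<theta>^(1/(2m-1)), which is
  the same as \<theta> / a^2 \<le> const K a^(-2 \<epsilon>). So one \<epsilon> pays twice: for the
  small factor below the cutoff and for the negligible event above it. The quadratic term of the
  exponent replaces a law of large numbers for the conditional variances of the steps. They depend
  on the random W_n, but \<open>v\<close> solves the recursion that cancels them exactly, so W_n
  only has to lie between 0 and 1.\<close>

lemma beta_density_nonneg:
  assumes "a > 0" "b > 0"
  shows "0 \<le> beta_density a b x"
  unfolding beta_density_def Beta_def using assms by auto

lemma beta_density_measurable [measurable]: "beta_density a b \<in> borel_measurable borel"
  unfolding beta_density_def by measurable

definition beta_law :: "real \<Rightarrow> real \<Rightarrow> real measure" where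
  "beta_law a b = density lborel (\<lambda>x. ennreal (beta_density a b x))"

lemma space_beta_law [simp]: "space (beta_law a b) = UNIV"
  and sets_beta_law [simp, measurable_cong]: "sets (beta_law a b) = sets borel"
  by (simp_all add: beta_law_def)

lemma AE_beta_law: "AE x in beta_law a b. 0 < x \<and> x < 1"
  unfolding beta_law_def by (subst AE_density) (auto simp: beta_density_def)

lemma Beta_moment_ratio:
  fixes a b :: real
  assumes "a > 0" "b > 0"
  shows "Beta (a + p) (b + q) / Beta a b
    = pochhammer a p * pochhammer b q / pochhammer (a + b) (p + q)"
proof -
  have "x \<notin> \<int>\<^sub>\<le>\<^sub>0" if "x > 0" for x :: real
    using that by (auto elim!: nonpos_Ints_cases)
  then show ?thesis
    using assms by (simp add: Beta_def pochhammer_Gamma Gamma_eq_zero_iff add_ac field_simps)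
qed

text \<open>Multiplying the density by \<open>x ^ p * (1 - x) ^ q\<close> only shifts both Beta
  parameters, so every mixed moment is a ratio of Beta values, hence of Pochhammer symbols. The case
  \<open>p = q = 0\<close> also yields total mass 1.\<close>

lemma has_bochner_integral_beta_law:
  assumes "a > 0" "b > 0"
  shows "has_bochner_integral (beta_law a b) (\<lambda>x. x ^ p * (1 - x) ^ q)
    (pochhammer a p * pochhammer b q / pochhammer (a + b) (p + q))"
proof -
  let ?f = "\<lambda>x. beta_density a b x * (x ^ p * (1 - x) ^ q)"
  have Beta_pos: "Beta a b > 0" using assms by (simp add: Beta_def)
  have nonneg: "0 \<le> ?f x" for x
  proof (cases "0 < x \<and> x < 1")
    case True
    then show ?thesis by (intro mult_nonneg_nonneg beta_density_nonneg assms) auto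
  qed (auto simp: beta_density_def)
  have "((\<lambda>t. t powr (a + p - 1) * (1 - t) powr (b + q - 1)) has_integral Beta (a + p) (b + q)) {0<..<1}"
    using has_integral_Beta_real[of "a + p" "b + q"] assms
    by (simp add: has_integral_Icc_iff_Ioo)
  then have "((\<lambda>t. t powr (a + p - 1) * (1 - t) powr (b + q - 1) * (1 / Beta a b)) has_integral
      Beta (a + p) (b + q) * (1 / Beta a b)) {0<..<1}"
    by (rule has_integral_mult_left)
  then have "(?f has_integral Beta (a + p) (b + q) * (1 / Beta a b)) {0<..<1}"
  proof (rule has_integral_eq[rotated])
    fix x :: real assume "x \<in> {0<..<1}"
    then have x: "0 < x" "0 < 1 - x" by auto
    have "x powr (a + p - 1) = x powr (a - 1) * x ^ p"
      using x by (subst powr_realpow[symmetric]) (auto simp: powr_add[symmetric] algebra_simps)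
    moreover have "(1 - x) powr (b + q - 1) = (1 - x) powr (b - 1) * (1 - x) ^ q"
      using x(2) by (subst powr_realpow[OF x(2), symmetric]) (auto simp: powr_add[symmetric] algebra_simps)
    ultimately show "x powr (a + p - 1) * (1 - x) powr (b + q - 1) * (1 / Beta a b) = ?f x"
      using x by (simp add: beta_density_def)
  qed
  then have "((\<lambda>x. if x \<in> {0<..<1} then ?f x else 0) has_integral Beta (a + p) (b + q) / Beta a b) UNIV"
    by (subst has_integral_restrict_UNIV) simp
  moreover have "(\<lambda>x. if x \<in> {0<..<1} then ?f x else 0) = ?f"
    by (auto simp: beta_density_def)
  ultimately have "(?f has_integral Beta (a + p) (b + q) / Beta a b) UNIV" by simp
  then have "(\<integral>\<^sup>+x. ?f x \<partial>lborel) = Beta (a + p) (b + q) / Beta a b"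
    by (intro nn_integral_has_integral_lborel) (use nonneg in auto)
  then have "has_bochner_integral lborel ?f (Beta (a + p) (b + q) / Beta a b)"
    using assms nonneg Beta_pos by (intro has_bochner_integral_nn_integral) (auto simp: Beta_def)
  then have "has_bochner_integral (beta_law a b) (\<lambda>x. x ^ p * (1 - x) ^ q) (Beta (a + p) (b + q) / Beta a b)"
    unfolding beta_law_def
    by (intro has_bochner_integral_density) (auto simp: beta_density_nonneg assms)
  then show ?thesis by (simp add: Beta_moment_ratio assms)
qed

lemmas integrable_beta_law = has_bochner_integral_beta_law[THEN integrable.intros]
lemmas integral_beta_law = has_bochner_integral_beta_law[THEN has_bochner_integral_integral_eq]

lemma prob_space_beta_law:
  assumes "a > 0" "b > 0"
  shows "prob_space (beta_law a b)"
proof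
  have "has_bochner_integral (beta_law a b) (\<lambda>x. 1 :: real) 1"
    using has_bochner_integral_beta_law[OF assms, of 0 0] by simp
  then have "(\<integral>\<^sup>+x. ennreal 1 \<partial>beta_law a b) = ennreal 1"
    by (subst nn_integral_eq_integral)
      (auto dest: integrable.intros has_bochner_integral_integral_eq)
  then show "emeasure (beta_law a b) (space (beta_law a b)) = 1" by simp
qed

lemma pochhammer_le_fact:
  fixes a :: real
  assumes "0 \<le> a" "a \<le> 1"
  shows "pochhammer a p \<le> fact p"
proof (induction p)
  case (Suc p)
  have "pochhammer a p * (a + real p) \<le> fact p * (1 + real p)"
    using assms Suc by (intro mult_mono) auto
  then show ?case by (simp add: pochhammer_Suc field_simps)
qed simp

lemma power_le_pochhammer:
  fixes t :: real
  assumes "0 \<le> t"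
  shows "t ^ p \<le> pochhammer (t + 1) p"
proof (induction p)
  case (Suc p)
  have "t ^ p * t \<le> pochhammer (t + 1) p * (t + 1 + real p)"
    using assms Suc by (intro mult_mono pochhammer_nonneg) auto
  then show ?case by (simp add: pochhammer_Suc field_simps)
qed simp

text \<open>Uniformly in \<open>t\<close>, the variable \<open>t U\<close> is no larger than an exponential one, moment by moment.\<close>

lemma beta_law_moment_le:
  fixes \<alpha> t :: real
  assumes "0 < \<alpha>" "\<alpha> < 1" "0 < t"
  shows "(\<integral>u. (t * u) ^ p \<partial>beta_law (1 - \<alpha>) (t + \<alpha>)) \<le> fact p"
proof -
  have "(\<integral>u. (t * u) ^ p \<partial>beta_law (1 - \<alpha>) (t + \<alpha>)) =
      t ^ p * (\<integral>u. u ^ p * (1 - u) ^ 0 \<partial>beta_law (1 - \<alpha>) (t + \<alpha>))"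
    by (simp add: power_mult_distrib)
  also have "\<dots> = t ^ p * (pochhammer (1 - \<alpha>) p / pochhammer (t + 1) p)"
    using assms integral_beta_law[of "1 - \<alpha>" "t + \<alpha>" p 0] by (simp add: add_ac)
  also have "\<dots> \<le> pochhammer (t + 1) p * (fact p / pochhammer (t + 1) p)"
    using assms by (intro mult_mono divide_right_mono pochhammer_le_fact power_le_pochhammer
        divide_nonneg_pos pochhammer_nonneg pochhammer_pos) auto
  also have "\<dots> = fact p"
    using pochhammer_pos[of "t + 1" p] assms by simp
  finally show ?thesis .
qed

text \<open>In the exponential series the factorial of the moment bound cancels and a geometric
  series of ratio 1/2 remains; hence the rate \<open>t / 2\<close>. The bound is uniform in
  \<open>t\<close>, and both the domination arguments and the tail bound for a single stick rest on
  it.\<close>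

lemma nn_integral_exp_beta_law_le:
  fixes \<alpha> t :: real
  assumes "0 < \<alpha>" "\<alpha> < 1" "0 < t"
  shows "(\<integral>\<^sup>+u. exp (t * u / 2) \<partial>beta_law (1 - \<alpha>) (t + \<alpha>)) \<le> 2"
proof -
  let ?B = "beta_law (1 - \<alpha>) (t + \<alpha>)"
  let ?g = "\<lambda>n u. (t * u) ^ n * (1 / (2 ^ n * fact n)) :: real"
  have AE: "AE u in ?B. 0 < u" using AE_beta_law[of "1 - \<alpha>" "t + \<alpha>"] by auto
  have int: "integrable ?B (\<lambda>u. (t * u) ^ n)" for n
    using integrable_beta_law[of "1 - \<alpha>" "t + \<alpha>" n 0] assms by (simp add: power_mult_distrib)
  have "(\<integral>\<^sup>+u. exp (t * u / 2) \<partial>?B) = (\<integral>\<^sup>+u. (\<Sum>n. ennreal (?g n u)) \<partial>?B)"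
  proof (intro nn_integral_cong_AE, use AE in eventually_elim)
    fix u :: real assume "0 < u"
    have "(\<lambda>n. (t * u / 2) ^ n /\<^sub>R fact n) sums exp (t * u / 2)" by (rule exp_converges)
    moreover have "(t * u / 2) ^ n /\<^sub>R fact n = ?g n u" for n
      by (simp add: power_divide divide_simps)
    ultimately have "(\<lambda>n. ?g n u) sums exp (t * u / 2)" by simp
    then show "ennreal (exp (t * u / 2)) = (\<Sum>n. ennreal (?g n u))"
      using \<open>0 < u\<close> \<open>0 < t\<close> by (subst suminf_ennreal_eq) auto
  qed
  also have "\<dots> = (\<Sum>n. \<integral>\<^sup>+u. ?g n u \<partial>?B)"
    by (rule nn_integral_suminf) simp
  also have "\<dots> \<le> (\<Sum>n. ennreal ((1/2) ^ n))"
  proof (intro suminf_le)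
    fix n
    have "(\<integral>\<^sup>+u. ?g n u \<partial>?B) = ennreal (\<integral>u. ?g n u \<partial>?B)"
      using int AE assms by (intro nn_integral_eq_integral integrable_mult_left) (auto elim!: eventually_mono)
    also have "(\<integral>u. ?g n u \<partial>?B) = (\<integral>u. (t * u) ^ n \<partial>?B) * (1 / (2 ^ n * fact n))"
      by simp
    also have "\<dots> \<le> fact n * (1 / (2 ^ n * fact n))"
      by (intro mult_right_mono beta_law_moment_le) (use assms in auto)
    also have "\<dots> = (1/2) ^ n" by (simp add: power_divide)
    finally show "(\<integral>\<^sup>+u. ?g n u \<partial>?B) \<le> ennreal ((1/2) ^ n)" by (simp add: ennreal_leI)
  qed simp_all
  also have "\<dots> = ennreal 2"
    by (rule suminf_ennreal_eq) (use geometric_sums[of "1/2::real"] in auto)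
  finally show ?thesis by simp
qed

lemma
  fixes \<alpha> t :: real
  assumes "0 < \<alpha>" "\<alpha> < 1" "0 < t"
  shows integrable_exp_beta_law: "integrable (beta_law (1 - \<alpha>) (t + \<alpha>)) (\<lambda>u. exp (t * u / 2))"
    and integral_exp_beta_law_le: "(\<integral>u. exp (t * u / 2) \<partial>beta_law (1 - \<alpha>) (t + \<alpha>)) \<le> 2"
proof -
  note * = nn_integral_exp_beta_law_le[OF assms]
  show int: "integrable (beta_law (1 - \<alpha>) (t + \<alpha>)) (\<lambda>u. exp (t * u / 2))"
    by (rule integrableI_nonneg) (use * in \<open>auto simp: less_top[symmetric] top_unique\<close>)
  show "(\<integral>u. exp (t * u / 2) \<partial>beta_law (1 - \<alpha>) (t + \<alpha>)) \<le> 2"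
    using * by (subst (asm) nn_integral_eq_integral[OF int]) (auto simp flip: ennreal_numeral)
qed

section \<open>Mean and variance of the homozygosity\<close>

lemma tendsto_power_div_pochhammer:
  "((\<lambda>t::real. t ^ k / pochhammer (t + 1) k) \<longlongrightarrow> 1) at_top"
proof (induction k)
  case (Suc k)
  have "((\<lambda>t::real. t / (t + 1 + real k)) \<longlongrightarrow> 1) at_top" by real_asymp
  from tendsto_mult[OF Suc this] show ?case by (simp add: pochhammer_Suc mult_ac)
qed simp

text \<open>The induction splits \<open>t * (1 - x * y)\<close> into
  \<open>t * (1 - x) + x * (t * (1 - y))\<close>. It shows that the mean differs from its leading
  term by a relative error of order 1 / t, small enough to survive multiplication by
  \<open>a\<close>.\<close>

lemma tendsto_power_div_pochhammer_rate:
  "\<exists>L. ((\<lambda>t::real. t * (1 - t ^ k / pochhammer (t + 1) k)) \<longlongrightarrow> L) at_top"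
proof (induction k)
  case (Suc k)
  then obtain L where L: "((\<lambda>t::real. t * (1 - t ^ k / pochhammer (t + 1) k)) \<longlongrightarrow> L) at_top" by blast
  have "((\<lambda>t::real. t * (1 - t / (t + 1 + real k))) \<longlongrightarrow> 1 + real k) at_top" by real_asymp
  from tendsto_add[OF L tendsto_mult[OF tendsto_power_div_pochhammer[of k] this]]
  have "((\<lambda>t::real. t * (1 - t ^ k / pochhammer (t + 1) k) +
      t ^ k / pochhammer (t + 1) k * (t * (1 - t / (t + 1 + real k)))) \<longlongrightarrow> L + 1 * (1 + real k)) at_top" .
  moreover have "t * (1 - x / y) + x / y * (t * (1 - t / z)) = t * (1 - t * x / (y * z))" for t x y z :: real
    by (simp add: algebra_simps)
  ultimately show ?case by (intro exI) (simp add: pochhammer_Suc)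
qed (auto intro!: exI[of _ 0])

text \<open>The expansion 1 + c j / t of a shifted ratio; the induction step for the second limit
  uses the first. The order 1 / t is required because the leading terms of the variance
  cancel.\<close>

lemma tendsto_pochhammer_ratio:
  fixes c :: real
  shows "((\<lambda>t. pochhammer (t + c + 1) j / pochhammer (t + 1) j) \<longlongrightarrow> 1) at_top"
    and "((\<lambda>t. t * (pochhammer (t + c + 1) j / pochhammer (t + 1) j - 1)) \<longlongrightarrow> c * j) at_top"
proof (induction j)
  case (Suc j)
  { case 1
    have "((\<lambda>t. (t + c + 1 + real j) / (t + 1 + real j)) \<longlongrightarrow> 1) at_top" by real_asymp
    from tendsto_mult[OF Suc(1) this] show ?case by (simp add: pochhammer_Suc mult_ac)
  next
    case 2
    have "((\<lambda>t. t * ((t + c + 1 + real j) / (t + 1 + real j) - 1)) \<longlongrightarrow> c) at_top" by real_asymp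
    from tendsto_add[OF Suc(2) tendsto_mult[OF Suc(1) this]]
    have "((\<lambda>t. t * (pochhammer (t + c + 1) j / pochhammer (t + 1) j - 1) +
      pochhammer (t + c + 1) j / pochhammer (t + 1) j *
        (t * ((t + c + 1 + real j) / (t + 1 + real j) - 1))) \<longlongrightarrow> c * j + 1 * c) at_top" .
    moreover have "t * (x / y - 1) + x / y * (t * (a / z - 1)) = t * (x * a / (y * z) - 1)" for t x y z a :: real
      by (simp add: algebra_simps)
    moreover have "c * j + 1 * c = c * Suc j" by (simp add: algebra_simps)
    ultimately show ?case by (simp only: pochhammer_Suc)
  }
qed simp_all

section \<open>Exact recursions for the mean and the variance\<close>

locale PD_parameters =
  fixes \<alpha> :: real and m :: nat
  assumes alpha: "0 < \<alpha>" "\<alpha> < 1"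
    and m: "2 \<le> m"
begin

text \<open>\<open>C\<close> is Gamma (m - \<alpha>) / Gamma (1 - \<alpha>), and \<open>Q\<close> is
  the same with \<open>2 * m\<close> in place of \<open>m\<close>. The Pochhammer form combines with
  the Beta moments by algebra alone. The mean behaves like \<open>C / t ^ (m - 1)\<close>.\<close>

definition C :: real where "C = pochhammer (1 - \<alpha>) (m - 1)"

definition Q :: real where "Q = pochhammer (1 - \<alpha>) (2 * m - 1)"

text \<open>\<open>h t\<close> and \<open>v t\<close> are the exact mean and variance of the homozygosity for parameter \<open>t\<close>;
  \<open>\<Delta>h\<close> and \<open>\<Delta>v\<close> are their changes when one stick of relative length \<open>u\<close> is broken off.\<close>

definition h :: "real \<Rightarrow> real" where
  "h t = C / pochhammer (t + 1) (m - 1)"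

definition v :: "real \<Rightarrow> real" where
  "v t = (Q + (t + \<alpha>) * C\<^sup>2) / pochhammer (t + 1) (2 * m - 1) - (h t)\<^sup>2"

definition \<Delta>h :: "real \<Rightarrow> real \<Rightarrow> real" where
  "\<Delta>h t u = u ^ m + (1 - u) ^ m * h (t + \<alpha>) - h t"

definition \<Delta>v :: "real \<Rightarrow> real \<Rightarrow> real" where
  "\<Delta>v t u = (1 - u) ^ (2 * m) * v (t + \<alpha>) - v t"

text \<open>Here \<open>t\<close> is the parameter before the break, and the remainder has parameter
  \<open>t + \<alpha>\<close>. The first stick has second Beta parameter \<theta> + \<alpha>, which
  is why \<open>t + \<alpha>\<close> and not \<open>t\<close> occurs.\<close>

abbreviation B :: "real \<Rightarrow> real measure" where
  "B t \<equiv> beta_law (1 - \<alpha>) (t + \<alpha>)"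

lemma C_pos: "C > 0"
  unfolding C_def using alpha by (intro pochhammer_pos) auto

lemma h_pos: "0 \<le> t \<Longrightarrow> 0 < h t"
  unfolding h_def using C_pos by (intro divide_pos_pos pochhammer_pos) auto

lemma integrable_B: "0 < t \<Longrightarrow> integrable (B t) (\<lambda>u. u ^ p * (1 - u) ^ q)"
  using alpha by (intro integrable_beta_law) auto

lemma integrable_B' [simp]:
  assumes "0 < t"
  shows "integrable (B t) (\<lambda>u. u ^ p)" "integrable (B t) (\<lambda>u. (1 - u) ^ q)"
  using integrable_B[OF assms, of p 0] integrable_B[OF assms, of 0 q] by simp_all

lemma integral_B:
  "0 < t \<Longrightarrow> (\<integral>u. u ^ p * (1 - u) ^ q \<partial>B t) =
    pochhammer (1 - \<alpha>) p * pochhammer (t + \<alpha>) q / pochhammer (t + 1) (p + q)"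
  using alpha by (subst integral_beta_law) (auto simp: add_ac)

lemma prob_space_B: "0 < t \<Longrightarrow> prob_space (B t)"
  using alpha by (intro prob_space_beta_law) auto

lemma pochhammer_alpha_m: "pochhammer (1 - \<alpha>) m = C * (m - \<alpha>)"
  "pochhammer (1 - \<alpha>) (2 * m) = Q * (2 * m - \<alpha>)"
proof -
  obtain k where k: "m = Suc k" using m by (cases m) auto
  have k2: "2 * m = Suc (2 * m - 1)" using m by simp
  show "pochhammer (1 - \<alpha>) m = C * (m - \<alpha>)"
    unfolding C_def by (subst (1) k, subst pochhammer_Suc) (simp add: k algebra_simps)
  show "pochhammer (1 - \<alpha>) (2 * m) = Q * (2 * m - \<alpha>)"
    unfolding Q_def by (subst k2, subst pochhammer_Suc) (use m in \<open>simp add: of_nat_diff algebra_simps\<close>)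
qed

lemma pochhammer_t:
  fixes t :: real
  shows "pochhammer (t + 1) m = pochhammer (t + 1) (m - 1) * (t + m)"
    and "pochhammer (t + 1) (2 * m) = pochhammer (t + 1) (2 * m - 1) * (t + 2 * m)"
    and "pochhammer (t + \<alpha>) m = (t + \<alpha>) * pochhammer (t + \<alpha> + 1) (m - 1)"
    and "pochhammer (t + \<alpha>) (2 * m) = (t + \<alpha>) * pochhammer (t + \<alpha> + 1) (2 * m - 1)"
proof -
  have k: "m = Suc (m - 1)" "2 * m = Suc (2 * m - 1)" using m by simp_all
  show "pochhammer (t + 1) m = pochhammer (t + 1) (m - 1) * (t + m)"
    by (subst k(1), subst pochhammer_Suc) (use m in \<open>simp add: of_nat_diff algebra_simps\<close>)
  show "pochhammer (t + 1) (2 * m) = pochhammer (t + 1) (2 * m - 1) * (t + 2 * m)"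
    by (subst k(2), subst pochhammer_Suc) (use m in \<open>simp add: of_nat_diff algebra_simps\<close>)
  show "pochhammer (t + \<alpha>) m = (t + \<alpha>) * pochhammer (t + \<alpha> + 1) (m - 1)"
    by (subst k(1), subst pochhammer_rec) simp
  show "pochhammer (t + \<alpha>) (2 * m) = (t + \<alpha>) * pochhammer (t + \<alpha> + 1) (2 * m - 1)"
    by (subst k(2), subst pochhammer_rec) simp
qed

text \<open>The expectation of H = u^m + (1 - u)^m H', where H' belongs to the remainder after the
  first break. The two terms add up because (m - \<alpha>) + (t + \<alpha>) = t + m is the last
  factor of the common denominator.\<close>

lemma h_recursion:
  assumes t: "0 < t"
  shows "(\<integral>u. u ^ m \<partial>B t) + (\<integral>u. (1 - u) ^ m \<partial>B t) * h (t + \<alpha>) = h t"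
proof -
  have pos: "pochhammer (t + 1) (m - 1) > 0" "pochhammer (t + \<alpha> + 1) (m - 1) > 0"
    using t alpha by (auto intro!: pochhammer_pos)
  have "(\<integral>u. u ^ m \<partial>B t) = C * (m - \<alpha>) / (pochhammer (t + 1) (m - 1) * (t + m))"
    using integral_B[OF t, of m 0] by (simp add: pochhammer_t pochhammer_alpha_m)
  moreover have "(\<integral>u. (1 - u) ^ m \<partial>B t) =
      (t + \<alpha>) * pochhammer (t + \<alpha> + 1) (m - 1) / (pochhammer (t + 1) (m - 1) * (t + m))"
    using integral_B[OF t, of 0 m] by (simp add: pochhammer_t)
  ultimately have "(\<integral>u. u ^ m \<partial>B t) + (\<integral>u. (1 - u) ^ m \<partial>B t) * h (t + \<alpha>) =
      (C * (m - \<alpha>) + C * (t + \<alpha>)) / (pochhammer (t + 1) (m - 1) * (t + m))"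
    using pos(2) by (simp add: h_def add_divide_distrib mult.commute)
  also have "C * (m - \<alpha>) + C * (t + \<alpha>) = C * (t + m)" by (simp add: algebra_simps)
  finally show ?thesis using t by (simp add: h_def)
qed

lemma integral_\<Delta>h:
  assumes t: "0 < t"
  shows "(\<integral>u. \<Delta>h t u \<partial>B t) = 0"
proof -
  interpret prob_space "B t" by (rule prob_space_B) fact
  show ?thesis using h_recursion[OF t] t prob_space by (simp add: \<Delta>h_def)
qed

text \<open>This is the law of total variance at the first break. The proof goes through the second
  moment, whose recursion is linear, and subtracts the squared mean at the end.\<close>

lemma integral_\<Delta>v:
  assumes t: "0 < t"
  shows "(\<integral>u. \<Delta>v t u \<partial>B t) = - (\<integral>u. (\<Delta>h t u)\<^sup>2 \<partial>B t)"
proof -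
  interpret prob_space "B t" by (rule prob_space_B) fact
  define h' where "h' = h (t + \<alpha>)"
  \<comment> \<open>\<open>q\<close> is the second moment of the homozygosity.\<close>
  define q where "q x = (Q + (x + \<alpha>) * C\<^sup>2) / pochhammer (x + 1) (2 * m - 1)" for x
  have v: "v x = q x - (h x)\<^sup>2" for x by (simp add: v_def q_def)
  define E1 where "E1 = (\<integral>u. u ^ (2 * m) \<partial>B t)"
  define E2 where "E2 = (\<integral>u. u ^ m * (1 - u) ^ m \<partial>B t)"
  define E3 where "E3 = (\<integral>u. (1 - u) ^ (2 * m) \<partial>B t)"
  define F1 where "F1 = (\<integral>u. u ^ m \<partial>B t)"
  define F2 where "F2 = (\<integral>u. (1 - u) ^ m \<partial>B t)"
  have pos: "pochhammer (t + 1) (2 * m - 1) > 0" "pochhammer (t + \<alpha> + 1) (m - 1) > 0"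
    "pochhammer (t + \<alpha> + 1) (2 * m - 1) > 0" "t + 2 * real m > 0"
    using t alpha by (auto intro!: pochhammer_pos)
  have "E1 = Q * (2 * m - \<alpha>) / (pochhammer (t + 1) (2 * m - 1) * (t + 2 * m))"
    using integral_B[OF t, of "2 * m" 0] by (simp add: E1_def pochhammer_t pochhammer_alpha_m)
  moreover have "h' * E2 = C * (C * (m - \<alpha>)) * (t + \<alpha>) / (pochhammer (t + 1) (2 * m - 1) * (t + 2 * m))"
    using integral_B[OF t, of m m] pos
    by (simp add: E2_def h'_def h_def pochhammer_t pochhammer_alpha_m flip: mult_2)
  moreover have "E3 * q (t + \<alpha>) = (t + \<alpha>) * (Q + (t + 2 * \<alpha>) * C\<^sup>2) / (pochhammer (t + 1) (2 * m - 1) * (t + 2 * m))"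
    using integral_B[OF t, of 0 "2 * m"] pos
    by (simp add: E3_def q_def pochhammer_t)
  moreover have "Q * (2 * m - \<alpha>) + 2 * (C * (C * (m - \<alpha>)) * (t + \<alpha>)) + (t + \<alpha>) * (Q + (t + 2 * \<alpha>) * C\<^sup>2) =
      (Q + (t + \<alpha>) * C\<^sup>2) * (t + 2 * m)"
    by (simp add: algebra_simps power2_eq_square)
  \<comment> \<open>The left-hand side is the expectation of (u^m + (1 - u)^m H')^2 for an H'
    independent of \<open>u\<close> with mean \<open>h'\<close> and second moment
    \<open>q (t + \<alpha>)\<close>.\<close>
  ultimately have "E1 + 2 * (h' * E2) + E3 * q (t + \<alpha>) =
      (Q + (t + \<alpha>) * C\<^sup>2) * (t + 2 * m) / (pochhammer (t + 1) (2 * m - 1) * (t + 2 * m))"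
    by (simp add: add_divide_distrib[symmetric])
  also have "\<dots> = q t" using pos(4) by (simp add: q_def)
  finally have q: "E1 + 2 * (h' * E2) + E3 * q (t + \<alpha>) = q t" .
  have F: "F1 + F2 * h' = h t"
    using h_recursion[OF t] by (simp add: F1_def F2_def h'_def)
  have "(\<Delta>h t u)\<^sup>2 = u ^ (2 * m) + 2 * h' * (u ^ m * (1 - u) ^ m) + h'\<^sup>2 * (1 - u) ^ (2 * m) + (h t)\<^sup>2
      - 2 * h t * u ^ m - 2 * h t * h' * (1 - u) ^ m" for u
    by (simp add: \<Delta>h_def h'_def power_mult[of _ m 2, symmetric] mult.commute[of 2 m] power_mult power2_eq_square algebra_simps)
  then have "(\<integral>u. (\<Delta>h t u)\<^sup>2 \<partial>B t) = E1 + 2 * h' * E2 + h'\<^sup>2 * E3 + (h t)\<^sup>2 - 2 * h t * F1 - 2 * h t * h' * F2"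
    using t prob_space integrable_B[OF t, of m m] by (simp add: E1_def E2_def E3_def F1_def F2_def)
  also have "\<dots> = E1 + 2 * h' * E2 + h'\<^sup>2 * E3 + (h t)\<^sup>2 - 2 * h t * (F1 + F2 * h')"
    by (simp add: algebra_simps)
  also have "\<dots> = v t - E3 * v (t + \<alpha>)"
    using q unfolding F v by (simp add: h'_def algebra_simps power2_eq_square)
  also have "\<dots> = - (\<integral>u. \<Delta>v t u \<partial>B t)"
    using t prob_space by (simp add: \<Delta>v_def E3_def)
  finally show ?thesis by simp
qed

lemma sigma_sq_eq: "sigma_sq \<alpha> m = Q / C\<^sup>2 + \<alpha> - (real m)\<^sup>2"
  and Gamma_C: "Gamma (1 - \<alpha>) / Gamma (real m - \<alpha>) = 1 / C"
proof -
  have "1 - \<alpha> \<notin> \<int>\<^sub>\<le>\<^sub>0" using alpha by (auto elim!: nonpos_Ints_cases)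
  then have *: "C = Gamma (m - \<alpha>) / Gamma (1 - \<alpha>)" "Q = Gamma (2 * m - \<alpha>) / Gamma (1 - \<alpha>)"
    using m by (auto simp: C_def Q_def pochhammer_Gamma of_nat_diff algebra_simps)
  have pos: "Gamma (1 - \<alpha>) > 0" "Gamma (m - \<alpha>) > 0"
    using alpha m by (auto intro!: Gamma_real_pos)
  show "sigma_sq \<alpha> m = Q / C\<^sup>2 + \<alpha> - (real m)\<^sup>2"
    unfolding sigma_sq_def * using pos by (simp add: field_simps power2_eq_square)
  show "Gamma (1 - \<alpha>) / Gamma (real m - \<alpha>) = 1 / C"
    unfolding * using pos by simp
qed

lemma pochhammer_mono:
  fixes x y :: real
  assumes "0 \<le> x" "x \<le> y"
  shows "pochhammer x k \<le> pochhammer y k"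
  unfolding pochhammer_prod using assms by (intro prod_mono) auto

text \<open>After splitting \<open>C\<close> off \<open>Q\<close>, the remaining product is compared
  factor by factor with \<open>C\<close> itself, keeping its two smallest factors; this gives Q /
  C^2 \<ge> (m - \<alpha>) (m - \<alpha> + 1) / (1 - \<alpha>). After multiplication by 1 -
  \<alpha>, this exceeds m^2 - \<alpha> by \<alpha> m (m - 2) + m, which is positive.\<close>

lemma sigma_sq_pos: "sigma_sq \<alpha> m > 0"
proof -
  obtain k where k: "m - 1 = Suc k" using m by (cases "m - 1") auto
  have Q: "Q = C * ((m - \<alpha>) * pochhammer (m - \<alpha> + 1) (m - 1))"
  proof -
    have "2 * m - 1 = (m - 1) + Suc (m - 1)" using m by simp
    then have "Q = C * pochhammer (1 - \<alpha> + real (m - 1)) (Suc (m - 1))"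
      unfolding Q_def C_def by (simp only: pochhammer_product')
    moreover have "1 - \<alpha> + real (m - 1) = m - \<alpha>" using m by (simp add: of_nat_diff)
    ultimately show ?thesis by (simp only: pochhammer_rec)
  qed
  have "pochhammer (m - \<alpha> + 1) (m - 1) = (m - \<alpha> + 1) * pochhammer (m - \<alpha> + 1 + 1) k"
    unfolding k by (rule pochhammer_rec)
  also have "\<dots> \<ge> (m - \<alpha> + 1) * pochhammer (1 - \<alpha> + 1) k"
    using alpha m by (intro mult_left_mono pochhammer_mono) auto
  also have "(m - \<alpha> + 1) * pochhammer (1 - \<alpha> + 1) k = (m - \<alpha> + 1) / (1 - \<alpha>) * C"
    unfolding C_def k pochhammer_rec using alpha by simp
  finally have "(m - \<alpha>) * ((m - \<alpha> + 1) / (1 - \<alpha>) * C) \<le> (m - \<alpha>) * pochhammer (m - \<alpha> + 1) (m - 1)"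
    using alpha m by (intro mult_left_mono) auto
  then have "(m - \<alpha>) * ((m - \<alpha> + 1) / (1 - \<alpha>)) \<le> Q / C\<^sup>2"
    using C_pos by (simp add: Q power2_eq_square pos_le_divide_eq mult.assoc)
  moreover have "(m - \<alpha>) * (m - \<alpha> + 1) > ((real m)\<^sup>2 - \<alpha>) * (1 - \<alpha>)"
  proof -
    have "(m - \<alpha>) * (m - \<alpha> + 1) - ((real m)\<^sup>2 - \<alpha>) * (1 - \<alpha>) = \<alpha> * (m * (real m - 2)) + m"
      by (simp add: algebra_simps power2_eq_square)
    also have "\<dots> > 0" using alpha m by (intro add_nonneg_pos mult_nonneg_nonneg) auto
    finally show ?thesis by simp
  qed
  then have "(m - \<alpha>) * ((m - \<alpha> + 1) / (1 - \<alpha>)) > (real m)\<^sup>2 - \<alpha>"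
    using alpha by (simp add: field_simps)
  ultimately show ?thesis unfolding sigma_sq_eq by linarith
qed

text \<open>Both terms of \<open>v\<close> have order t^(2 - 2m), one more than the claimed one, and
  cancel to leading order. Factoring out the longer Pochhammer symbol leaves the ratio
  \<open>?r\<close>, which is 1 + m (m - 1) / t + o(1/t); together with the summand
  \<open>m * ?r\<close> this produces the m^2 in \<open>sigma_sq\<close>.\<close>

lemma tendsto_v: "((\<lambda>t. t ^ (2 * m - 1) * v t) \<longlongrightarrow> C\<^sup>2 * sigma_sq \<alpha> m) at_top"
proof -
  let ?r = "\<lambda>t::real. pochhammer (t + m + 1) (m - 1) / pochhammer (t + 1) (m - 1)"
  have "((\<lambda>t. t * (?r t - 1) + m * ?r t) \<longlongrightarrow> real m * real (m - 1) + real m * 1) at_top"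
    by (rule tendsto_add[OF tendsto_pochhammer_ratio(2) tendsto_mult[OF tendsto_const tendsto_pochhammer_ratio(1)]])
  from tendsto_mult[OF tendsto_power_div_pochhammer tendsto_add[OF tendsto_const
      tendsto_mult[OF tendsto_const tendsto_diff[OF tendsto_const this]]]]
  have "((\<lambda>t. t ^ (2 * m - 1) / pochhammer (t + 1) (2 * m - 1) *
      (Q + C\<^sup>2 * (\<alpha> - (t * (?r t - 1) + m * ?r t)))) \<longlongrightarrow>
    1 * (Q + C\<^sup>2 * (\<alpha> - (real m * real (m - 1) + real m * 1)))) at_top" .
  also have "1 * (Q + C\<^sup>2 * (\<alpha> - (real m * real (m - 1) + real m * 1))) = C\<^sup>2 * sigma_sq \<alpha> m"
    using C_pos m by (simp add: sigma_sq_eq field_simps power2_eq_square of_nat_diff)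
  finally show ?thesis
  proof (rule Lim_transform_eventually)
    show "\<forall>\<^sub>F t in at_top. t ^ (2 * m - 1) / pochhammer (t + 1) (2 * m - 1) *
      (Q + C\<^sup>2 * (\<alpha> - (t * (?r t - 1) + m * ?r t))) = t ^ (2 * m - 1) * v t"
      using eventually_gt_at_top[of 0]
    proof eventually_elim
      fix t :: real assume t: "0 < t"
      let ?P = "pochhammer (t + 1) (m - 1)" and ?R = "pochhammer (t + 1) (2 * m - 1)"
      have pos: "?P > 0" "?R > 0" using t by (auto intro!: pochhammer_pos)
      have "2 * m - 1 = (m - 1) + Suc (m - 1)" using m by simp
      then have "?R = ?P * pochhammer (t + 1 + real (m - 1)) (Suc (m - 1))"
        by (simp only: pochhammer_product')
      moreover have "t + 1 + real (m - 1) = t + m" using m by (simp add: of_nat_diff)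
      ultimately have R: "?R = ?P * ((t + m) * pochhammer (t + m + 1) (m - 1))"
        by (simp only: pochhammer_rec)
      have "t * (?r t - 1) + m * ?r t = (t + m) * ?r t - t"
        by (simp add: algebra_simps add_divide_distrib)
      also have "(t + m) * ?r t = ?R / ?P\<^sup>2"
        unfolding R power2_eq_square using pos(1) by simp
      finally have "Q + C\<^sup>2 * (\<alpha> - (t * (?r t - 1) + m * ?r t)) = Q + (t + \<alpha>) * C\<^sup>2 - C\<^sup>2 * ?R / ?P\<^sup>2"
        by (simp add: algebra_simps)
      also have "\<dots> = ?R * v t"
        using pos by (simp add: v_def h_def power_divide field_simps)
      finally show "t ^ (2 * m - 1) / ?R * (Q + C\<^sup>2 * (\<alpha> - (t * (?r t - 1) + m * ?r t))) = t ^ (2 * m - 1) * v t"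
        using pos by simp
    qed
  qed
qed

lemma h_le: "0 < t \<Longrightarrow> h t \<le> C / t ^ (m - 1)"
  unfolding h_def using C_pos power_le_pochhammer[of t "m - 1"]
  by (intro divide_left_mono mult_pos_pos pochhammer_pos) auto

end

section \<open>Elementary inequalities for powers and exponentials\<close>

lemma power_div_fact_le_exp:
  fixes x :: real
  assumes "0 \<le> x"
  shows "x ^ n / fact n \<le> exp x"
proof -
  have "(\<Sum>k\<in>{n}. x ^ k /\<^sub>R fact k) \<le> (\<Sum>k. x ^ k /\<^sub>R fact k)"
    using assms by (intro sum_le_suminf summable_exp_generic) auto
  also have "\<dots> = exp x" by (rule sums_unique[OF exp_converges, symmetric])
  finally show ?thesis by (simp add: field_simps)
qed

text \<open>One term of the exponential series at (1 + y) / 4. The rate 1/4 leaves room for a second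
  factor exp (y / 4) under the integrable exp (y / 2).\<close>

lemma power_le_exp:
  fixes y :: real
  assumes "0 \<le> y"
  shows "(1 + y) ^ n \<le> fact n * 4 ^ n * exp (1 / 4) * exp (y / 4)"
proof -
  have "((1 + y) / 4) ^ n / fact n \<le> exp ((1 + y) / 4)"
    using assms by (intro power_div_fact_le_exp) auto
  then have "(1 + y) ^ n \<le> fact n * 4 ^ n * exp ((1 + y) / 4)"
    by (simp add: power_divide field_simps)
  also have "exp ((1 + y) / 4) = exp (1 / 4) * exp (y / 4)"
    by (simp add: exp_add[symmetric] add_divide_distrib)
  finally show ?thesis by (simp add: mult_ac)
qed

lemma exp_Taylor2_le:
  fixes x :: real
  shows "\<bar>exp x - 1 - x - x\<^sup>2 / 2\<bar> \<le> \<bar>x\<bar> ^ 3 * exp \<bar>x\<bar>"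
proof -
  obtain s where s: "\<bar>s\<bar> \<le> \<bar>x\<bar>" "exp x = (\<Sum>k<3. x ^ k / fact k) + exp s / fact 3 * x ^ 3"
    using Maclaurin_exp_le[of x 3] by auto
  have "\<bar>exp x - 1 - x - x\<^sup>2 / 2\<bar> = \<bar>x\<bar> ^ 3 * (exp s / 6)"
    using s(2) by (simp add: eval_nat_numeral abs_mult power_abs fact_numeral)
  also have "exp s / 6 \<le> exp \<bar>x\<bar>"
  proof -
    have "exp s \<le> exp \<bar>x\<bar>" using s(1) by simp
    then show ?thesis using exp_gt_zero[of "\<bar>x\<bar>"] by linarith
  qed
  finally show ?thesis by (simp add: mult_left_mono)
qed

lemma one_minus_power_bounds:
  fixes u :: real
  assumes "0 \<le> u" "u \<le> 1"
  shows "0 \<le> 1 - (1 - u) ^ n" "1 - (1 - u) ^ n \<le> real n * u"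
  using assms Bernoulli_inequality[of "- u" n] by (auto simp: power_le_one)

lemma one_plus_power_le:
  fixes y :: real
  assumes "0 \<le> y" "1 \<le> n"
  shows "1 + y ^ n \<le> (1 + y) ^ n"
  using assms(2)
proof (induction n rule: nat_induct_at_least)
  case (Suc n)
  have "1 + y ^ Suc n \<le> (1 + y ^ n) * (1 + y)"
    using assms by (simp add: algebra_simps)
  also have "\<dots> \<le> (1 + y) ^ n * (1 + y)"
    using assms Suc by (intro mult_right_mono) auto
  finally show ?case by (simp add: mult.commute)
qed simp

section \<open>Uniform size of the increments of mean and variance\<close>

context PD_parameters
begin

lemma integral_B_power_le: "0 < t \<Longrightarrow> t ^ p * (\<integral>u. u ^ p \<partial>B t) \<le> fact p"
  using beta_law_moment_le[of \<alpha> t p] alpha by (simp add: power_mult_distrib)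

lemma AE_B_I: "(\<And>u. 0 < u \<Longrightarrow> u < 1 \<Longrightarrow> P u) \<Longrightarrow> AE u in B t. P u"
  by (rule AE_mp[OF AE_beta_law]) auto

lemma one_minus_moment_bounds:
  assumes "0 < t"
  shows "0 \<le> 1 - (\<integral>u. (1 - u) ^ n \<partial>B t)" "1 - (\<integral>u. (1 - u) ^ n \<partial>B t) \<le> n / t"
proof -
  interpret prob_space "B t" by (rule prob_space_B) fact
  have int: "integrable (B t) (\<lambda>u. u)" using integrable_B'(1)[OF assms, of 1] by simp
  have eq: "(\<integral>u. 1 - (1 - u) ^ n \<partial>B t) = 1 - (\<integral>u. (1 - u) ^ n \<partial>B t)"
    using assms prob_space by simp
  show "0 \<le> 1 - (\<integral>u. (1 - u) ^ n \<partial>B t)"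
    unfolding eq[symmetric] by (intro integral_nonneg_AE AE_B_I one_minus_power_bounds) auto
  have "(\<integral>u. 1 - (1 - u) ^ n \<partial>B t) \<le> (\<integral>u. real n * u \<partial>B t)"
    using assms int by (intro integral_mono_AE AE_B_I one_minus_power_bounds) auto
  also have "\<dots> \<le> n / t"
  proof -
    have "(\<integral>u. u \<partial>B t) \<le> 1 / t"
      using integral_B_power_le[OF assms, of 1] assms by (simp add: field_simps)
    from mult_left_mono[OF this, of "real n"] show ?thesis by simp
  qed
  finally show "1 - (\<integral>u. (1 - u) ^ n \<partial>B t) \<le> n / t" unfolding eq .
qed

lemma h_shift_le:
  assumes "0 < t"
  shows "0 \<le> t ^ (m - 1) * h (t + \<alpha>)" "t ^ (m - 1) * h (t + \<alpha>) \<le> C"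
proof -
  show "0 \<le> t ^ (m - 1) * h (t + \<alpha>)"
    using assms alpha h_pos[of "t + \<alpha>"] by simp
  have "h (t + \<alpha>) \<le> C / (t + \<alpha>) ^ (m - 1)" using assms alpha by (intro h_le) auto
  also have "\<dots> \<le> C / t ^ (m - 1)"
    using assms alpha C_pos by (intro divide_left_mono power_mono mult_pos_pos) auto
  finally show "t ^ (m - 1) * h (t + \<alpha>) \<le> C" using assms by (simp add: field_simps)
qed

text \<open>The recursion expresses h (t + \<alpha>) - h t through moments of \<open>u\<close>,
  which shows its order t^(-m) without differentiating \<open>h\<close>. The other two terms of
  \<open>\<Delta>h\<close> are u^m and a loss of at most m u h (t + \<alpha>) by Bernoulli's
  inequality.\<close>

lemma \<Delta>h_bound:
  assumes "0 < t" "0 < u" "u < 1"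
  shows "t ^ m * \<bar>\<Delta>h t u\<bar> \<le> (1 + 2 * m * C + fact m) * (1 + (t * u) ^ m)"
proof -
  define h' where "h' = h (t + \<alpha>)"
  have m': "t ^ m = t * t ^ (m - 1)" using m by (simp add: power_eq_if)
  have th': "0 \<le> t ^ (m - 1) * h'" "t ^ (m - 1) * h' \<le> C" "0 \<le> h'"
    using h_shift_le[OF assms(1)] h_pos[of "t + \<alpha>"] assms alpha by (auto simp: h'_def)
  have h: "h' - h t = (1 - (\<integral>u. (1 - u) ^ m \<partial>B t)) * h' - (\<integral>u. u ^ m \<partial>B t)"
    using h_recursion[OF assms(1)] by (simp add: h'_def algebra_simps)
  have *: "0 \<le> (\<integral>u. u ^ m \<partial>B t)"
    by (intro integral_nonneg_AE AE_B_I) auto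
  have "\<bar>h' - h t\<bar> \<le> (m / t) * h' + (\<integral>u. u ^ m \<partial>B t)"
    unfolding h using one_minus_moment_bounds[OF assms(1), of m] th'(3) *
      mult_right_mono[OF one_minus_moment_bounds(2)[OF assms(1), of m] th'(3)]
      mult_nonneg_nonneg[OF one_minus_moment_bounds(1)[OF assms(1), of m] th'(3)]
    by linarith
  then have "t ^ m * \<bar>h' - h t\<bar> \<le> t ^ m * ((m / t) * h' + (\<integral>u. u ^ m \<partial>B t))"
    using assms by (intro mult_left_mono) auto
  also have "\<dots> = m * (t ^ (m - 1) * h') + t ^ m * (\<integral>u. u ^ m \<partial>B t)"
    using assms by (simp add: m' field_simps)
  also have "\<dots> \<le> m * C + fact m"
    using th' integral_B_power_le[OF assms(1), of m] by (intro add_mono mult_left_mono) auto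
  finally have 1: "t ^ m * \<bar>h' - h t\<bar> \<le> m * C + fact m" .
  have "(1 - (1 - u) ^ m) * h' \<le> (m * u) * h'"
    using one_minus_power_bounds[of u m] assms th' by (intro mult_right_mono) auto
  then have "t ^ m * ((1 - (1 - u) ^ m) * h') \<le> t ^ m * ((m * u) * h')"
    using assms by (intro mult_left_mono) auto
  also have "\<dots> = m * (t * u) * (t ^ (m - 1) * h')" by (simp add: m')
  also have "\<dots> \<le> m * (t * u) * C" using th' assms by (intro mult_left_mono) auto
  also have "\<dots> \<le> m * (1 + (t * u) ^ m) * C"
  proof -
    have "t * u \<le> 1 + (t * u) ^ m"
      using self_le_power[of "t * u" m] assms m by (cases "t * u \<le> 1") (auto intro: order.trans)
    then show ?thesis using C_pos by (intro mult_right_mono mult_left_mono) auto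
  qed
  finally have 2: "t ^ m * ((1 - (1 - u) ^ m) * h') \<le> m * C * (1 + (t * u) ^ m)"
    by (simp add: mult_ac)
  have "\<Delta>h t u = u ^ m - (1 - (1 - u) ^ m) * h' + (h' - h t)"
    by (simp add: \<Delta>h_def h'_def algebra_simps)
  moreover have "0 \<le> (1 - (1 - u) ^ m) * h'" "0 \<le> u ^ m"
    using one_minus_power_bounds[of u m] assms th' by auto
  ultimately have "\<bar>\<Delta>h t u\<bar> \<le> u ^ m + (1 - (1 - u) ^ m) * h' + \<bar>h' - h t\<bar>"
    by linarith
  then have "t ^ m * \<bar>\<Delta>h t u\<bar> \<le> t ^ m * (u ^ m + (1 - (1 - u) ^ m) * h' + \<bar>h' - h t\<bar>)"
    using assms by (intro mult_left_mono) auto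
  also have "\<dots> = (t * u) ^ m + t ^ m * ((1 - (1 - u) ^ m) * h') + t ^ m * \<bar>h' - h t\<bar>"
    by (simp add: algebra_simps power_mult_distrib)
  also have "\<dots> \<le> (t * u) ^ m + m * C * (1 + (t * u) ^ m) + (m * C + fact m)"
    using 1 2 by linarith
  also have "\<dots> \<le> (1 + 2 * m * C + fact m) * (1 + (t * u) ^ m)"
  proof -
    have "0 \<le> (m * C + fact m) * (t * u) ^ m" using C_pos assms by simp
    then show ?thesis by (simp add: algebra_simps)
  qed
  finally show ?thesis .
qed

text \<open>Domination by a multiple of exp (t u / 2) gives integral bounds that do not depend on
  \<open>t\<close>. All error terms are brought to this form.\<close>

lemma integrable_B_dominated:
  fixes f :: "real \<Rightarrow> real"
  assumes "0 < t" "f \<in> borel_measurable borel"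
    and "\<And>u. 0 < u \<Longrightarrow> u < 1 \<Longrightarrow> \<bar>f u\<bar> \<le> K * exp (t * u / 2)"
  shows "integrable (B t) f" "\<bar>\<integral>u. f u \<partial>B t\<bar> \<le> 2 * K"
proof -
  \<comment> \<open>The domination at the interior point 1/2 forces \<open>K\<close> to be
    nonnegative.\<close>
  have K: "0 \<le> K"
    using order.trans[OF abs_ge_zero assms(3)[of "1/2"]] by (simp add: zero_le_mult_iff not_le[symmetric])
  have int: "integrable (B t) (\<lambda>u. K * exp (t * u / 2))"
    using assms alpha by (intro integrable_mult_right integrable_exp_beta_law) auto
  show f: "integrable (B t) f"
  proof (rule Bochner_Integration.integrable_bound[OF int])
    show "AE u in B t. norm (f u) \<le> norm (K * exp (t * u / 2))"
      using K by (intro AE_B_I) (auto simp: abs_mult intro: assms(3))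
  qed (use assms in auto)
  have "\<bar>\<integral>u. f u \<partial>B t\<bar> \<le> (\<integral>u. \<bar>f u\<bar> \<partial>B t)" by (rule integral_abs_bound)
  also have "\<dots> \<le> (\<integral>u. K * exp (t * u / 2) \<partial>B t)"
    using assms f int by (intro integral_mono_AE AE_B_I) auto
  also have "\<dots> = K * (\<integral>u. exp (t * u / 2) \<partial>B t)" by simp
  also have "\<dots> \<le> K * 2"
    using assms alpha K by (intro mult_left_mono integral_exp_beta_law_le) auto
  finally show "\<bar>\<integral>u. f u \<partial>B t\<bar> \<le> 2 * K" by simp
qed

lemma \<Delta>h_measurable [measurable]: "\<Delta>h t \<in> borel_measurable borel"
  and \<Delta>v_measurable [measurable]: "\<Delta>v t \<in> borel_measurable borel"
  unfolding \<Delta>h_def \<Delta>v_def by measurable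

lemma v_bound: "\<exists>T c. 1 \<le> T \<and> 0 \<le> c \<and> (\<forall>t\<ge>T. t ^ (2 * m - 1) * \<bar>v t\<bar> \<le> c)"
proof -
  let ?L = "C\<^sup>2 * sigma_sq \<alpha> m"
  have L: "?L > 0" using C_pos sigma_sq_pos by simp
  have "eventually (\<lambda>t. dist (t ^ (2 * m - 1) * v t) ?L < 1) at_top"
    using tendsto_v by (rule tendstoD) simp
  then obtain T where T: "\<And>t. t \<ge> T \<Longrightarrow> dist (t ^ (2 * m - 1) * v t) ?L < 1"
    by (auto simp: eventually_at_top_linorder)
  have "t ^ (2 * m - 1) * \<bar>v t\<bar> \<le> ?L + 1" if "t \<ge> max T 1" for t
  proof -
    have "t ^ (2 * m - 1) * \<bar>v t\<bar> = \<bar>t ^ (2 * m - 1) * v t\<bar>"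
      using that by (simp add: abs_mult)
    also have "\<dots> \<le> ?L + 1" using T[of t] that L by (auto simp: dist_real_def)
    finally show ?thesis .
  qed
  then show ?thesis using L by (intro exI[of _ "max T 1"] exI[of _ "?L + 1"]) auto
qed

text \<open>As for \<open>\<Delta>h\<close>, the difference v (t + \<alpha>) - v t is rewritten by
  the recursion. What remains are two Bernoulli losses of \<open>v (t + \<alpha>)\<close>, each of
  order t^(-1) relative to \<open>v\<close>, and the second moment of \<open>\<Delta>h\<close>; all
  have order t^(-2m).\<close>

lemma \<Delta>v_bound:
  "\<exists>T c. 1 \<le> T \<and> 0 \<le> c \<and>
    (\<forall>t u. T \<le> t \<longrightarrow> 0 < u \<longrightarrow> u < 1 \<longrightarrow> t ^ (2 * m) * \<bar>\<Delta>v t u\<bar> \<le> c * (1 + (t * u) ^ m))"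
proof -
  obtain T c where T: "1 \<le> T" "0 \<le> c" "\<And>t. T \<le> t \<Longrightarrow> t ^ (2 * m - 1) * \<bar>v t\<bar> \<le> c"
    using v_bound by blast
  define c1 where "c1 = 1 + 2 * m * C + fact m"
  have c1: "0 \<le> c1" using C_pos by (simp add: c1_def)
  define e where "e = fact (2 * m) * 4 ^ (2 * m) * exp (1 / 4 :: real)"
  define c2 where "c2 = 2 * (c1\<^sup>2 * e)"
  have c2: "0 \<le> c2" by (simp add: c2_def e_def)
  have "t ^ (2 * m) * \<bar>\<Delta>v t u\<bar> \<le> (2 * (2 * m * c) + c2) * (1 + (t * u) ^ m)"
    if t: "T \<le> t" and u: "0 < u" "u < 1" for t u
  proof -
    have t0: "0 < t" using t T by simp
    define v' where "v' = v (t + \<alpha>)"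
    have m2: "t ^ (2 * m) = t * t ^ (2 * m - 1)" using m by (simp add: power_eq_if)
    have v': "t ^ (2 * m - 1) * \<bar>v'\<bar> \<le> c"
    proof -
      have "t ^ (2 * m - 1) * \<bar>v'\<bar> \<le> (t + \<alpha>) ^ (2 * m - 1) * \<bar>v'\<bar>"
        using t0 alpha by (intro mult_right_mono power_mono) auto
      also have "\<dots> \<le> c" unfolding v'_def using t alpha by (intro T) auto
      finally show ?thesis .
    qed
    have "\<bar>t ^ (2 * m) * (\<integral>u. (\<Delta>h t u)\<^sup>2 \<partial>B t)\<bar> = \<bar>\<integral>u. t ^ (2 * m) * (\<Delta>h t u)\<^sup>2 \<partial>B t\<bar>"
      by simp
    also have "\<dots> \<le> 2 * (c1\<^sup>2 * e)"
    proof (rule integrable_B_dominated(2)[OF t0])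
      fix u :: real assume u: "0 < u" "u < 1"
      have "\<bar>t ^ (2 * m) * (\<Delta>h t u)\<^sup>2\<bar> = (t ^ m * \<bar>\<Delta>h t u\<bar>)\<^sup>2"
        by (simp add: power_mult_distrib abs_mult mult.commute[of 2 m] power_mult)
      also have "\<dots> \<le> (c1 * (1 + (t * u) ^ m))\<^sup>2"
        unfolding c1_def using \<Delta>h_bound[OF t0 u] t0 by (intro power_mono) auto
      also have "\<dots> = c1\<^sup>2 * (1 + (t * u) ^ m)\<^sup>2" by (simp add: power_mult_distrib)
      also have "\<dots> \<le> c1\<^sup>2 * (e * exp (t * u / 2))"
      proof (intro mult_left_mono)
        have "1 + (t * u) ^ m \<le> (1 + t * u) ^ m"
          using t0 u m by (intro one_plus_power_le) auto
        then have "(1 + (t * u) ^ m)\<^sup>2 \<le> ((1 + t * u) ^ m)\<^sup>2"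
          using t0 u by (intro power_mono) auto
        also have "\<dots> = (1 + t * u) ^ (2 * m)" by (simp add: power_mult[symmetric] mult.commute)
        also have "\<dots> \<le> e * exp (t * u / 4)"
          unfolding e_def using t0 u by (intro power_le_exp) auto
        also have "\<dots> \<le> e * exp (t * u / 2)"
          using t0 u by (intro mult_left_mono) (auto simp: e_def)
        finally show "(1 + (t * u) ^ m)\<^sup>2 \<le> e * exp (t * u / 2)" .
      qed simp
      finally show "\<bar>t ^ (2 * m) * (\<Delta>h t u)\<^sup>2\<bar> \<le> c1\<^sup>2 * e * exp (t * u / 2)" by simp
    qed measurable
    finally have 1: "t ^ (2 * m) * (\<integral>u. (\<Delta>h t u)\<^sup>2 \<partial>B t) \<le> c2" by (simp add: c2_def)
    \<comment> \<open>Applied twice: with \<open>y = t * u\<close> to the pointwise loss and with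
      \<open>y = 1\<close> to the mean loss.\<close>
    have bound: "t ^ (2 * m) * \<bar>x * v'\<bar> \<le> (2 * m * y) * c" if "0 \<le> x" "x \<le> (2 * m) * y / t" "0 \<le> y" for x y :: real
    proof -
      have "t ^ (2 * m) * \<bar>x * v'\<bar> = (t * x) * (t ^ (2 * m - 1) * \<bar>v'\<bar>)"
        using that by (simp add: m2 abs_mult)
      also have "\<dots> \<le> (2 * m * y) * c"
        using that v' t0 by (intro mult_mono[of "t * x" "2 * m * y"]) (auto simp: field_simps)
      finally show ?thesis .
    qed
    define E where "E = (\<integral>u. (1 - u) ^ (2 * m) \<partial>B t)"
    have "v' - v t = (1 - E) * v' + (\<integral>u. \<Delta>v t u \<partial>B t)"
    proof -
      interpret prob_space "B t" by (rule prob_space_B) fact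
      have "(\<integral>u. \<Delta>v t u \<partial>B t) = E * v' - v t"
        using t0 prob_space by (simp add: \<Delta>v_def E_def v'_def)
      then show ?thesis by (simp add: algebra_simps)
    qed
    then have "\<Delta>v t u = - ((1 - (1 - u) ^ (2 * m)) * v') + (1 - E) * v' - (\<integral>u. (\<Delta>h t u)\<^sup>2 \<partial>B t)"
      using integral_\<Delta>v[OF t0] by (simp add: \<Delta>v_def[of t u] v'_def algebra_simps)
    moreover have "0 \<le> (\<integral>u. (\<Delta>h t u)\<^sup>2 \<partial>B t)" by simp
    ultimately have "\<bar>\<Delta>v t u\<bar> \<le> \<bar>(1 - (1 - u) ^ (2 * m)) * v'\<bar> + \<bar>(1 - E) * v'\<bar> + (\<integral>u. (\<Delta>h t u)\<^sup>2 \<partial>B t)"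
      by linarith
    then have "t ^ (2 * m) * \<bar>\<Delta>v t u\<bar> \<le> t ^ (2 * m) * (\<bar>(1 - (1 - u) ^ (2 * m)) * v'\<bar> + \<bar>(1 - E) * v'\<bar> + (\<integral>u. (\<Delta>h t u)\<^sup>2 \<partial>B t))"
      using t0 by (intro mult_left_mono) auto
    also have "\<dots> = t ^ (2 * m) * \<bar>(1 - (1 - u) ^ (2 * m)) * v'\<bar> + t ^ (2 * m) * \<bar>(1 - E) * v'\<bar>
        + t ^ (2 * m) * (\<integral>u. (\<Delta>h t u)\<^sup>2 \<partial>B t)"
      by (simp add: algebra_simps)
    also have "\<dots> \<le> (2 * m * (t * u)) * c + (2 * m * (1::real)) * c + c2"
    proof (intro add_mono 1)
      show "t ^ (2 * m) * \<bar>(1 - (1 - u) ^ (2 * m)) * v'\<bar> \<le> (2 * m * (t * u)) * c"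
        using one_minus_power_bounds[of u "2 * m"] u t0 by (intro bound) auto
      show "t ^ (2 * m) * \<bar>(1 - E) * v'\<bar> \<le> (2 * m * (1::real)) * c"
        unfolding E_def using one_minus_moment_bounds[OF t0, of "2 * m"] by (intro bound) auto
    qed
    also have "\<dots> \<le> (2 * m * (1 + (t * u) ^ m)) * c + (2 * m * (1 + (t * u) ^ m)) * c + c2 * (1 + (t * u) ^ m)"
    proof -
      have "t * u \<le> 1 + (t * u) ^ m"
        using self_le_power[of "t * u" m] t0 u m by (cases "t * u \<le> 1") (auto intro: order.trans)
      moreover have "0 \<le> (t * u) ^ m" using t0 u by simp
      moreover have "c2 * 1 \<le> c2 * (1 + (t * u) ^ m)"
        using c2 t0 u by (intro mult_left_mono) auto
      ultimately show ?thesis using T(2)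
        by (intro add_mono mult_right_mono mult_left_mono) auto
    qed
    also have "\<dots> = (2 * (2 * m * c) + c2) * (1 + (t * u) ^ m)" by (simp add: algebra_simps)
    finally show ?thesis .
  qed
  then show ?thesis using T(1,2) c2 by (intro exI[of _ T] exI[of _ "2 * (2 * m * c) + c2"]) auto
qed

end

section \<open>One step of the stick-breaking process\<close>

text \<open>The unit interval is built in, so that a product of cutoffs vanishes also on the null
  event where some \<open>U k\<close> leaves it.\<close>

definition cutoff :: "real \<Rightarrow> real \<Rightarrow> real" where
  "cutoff \<kappa> u = indicator {0<..<1} u * indicator {..\<kappa>} u"

lemma cutoff_bounds: "0 \<le> cutoff \<kappa> u" "cutoff \<kappa> u \<le> 1"
  by (auto simp: cutoff_def indicator_def)

lemma cutoff_measurable [measurable]: "cutoff \<kappa> \<in> borel_measurable borel"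
  unfolding cutoff_def[abs_def] by measurable

context PD_parameters
begin

lemma Z_power_le_exp:
  fixes y :: real
  assumes "0 \<le> y"
  shows "(1 + y ^ m) ^ k \<le> fact (m * k) * 4 ^ (m * k) * exp (1 / 4) * exp (y / 4)"
proof -
  have "(1 + y ^ m) ^ k \<le> ((1 + y) ^ m) ^ k"
    using assms m by (intro power_mono one_plus_power_le) auto
  then show ?thesis
    using power_le_exp[OF assms, of "m * k"] by (simp add: power_mult)
qed

text \<open>The mean of \<open>\<Delta>h\<close> vanishes and that of \<open>\<Delta>v\<close> cancels the second
  moment of \<open>\<Delta>h\<close>, so only a third-order error remains. The cutoff makes
  the \<open>m\<close>-th power of \<open>u\<close> exponentially integrable: it turns \<open>q (t u) ^ m\<close> into a small multiple of \<open>t u\<close>.\<close>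

lemma one_step:
  fixes N :: nat
  shows "\<exists>T q0 c. 1 \<le> T \<and> 0 < q0 \<and> 0 < c \<and>
    (\<forall>t p q \<kappa>. T \<le> t \<longrightarrow> 0 < \<kappa> \<longrightarrow> 0 \<le> q \<longrightarrow> q \<le> q0 \<longrightarrow> \<bar>p\<bar> \<le> q * t ^ m \<longrightarrow> q * (t * \<kappa>) ^ (m - 1) \<le> q0 \<longrightarrow>
      integrable (B t) (\<lambda>u. cutoff \<kappa> u * exp (p * \<Delta>h t u + p\<^sup>2 / 2 * \<Delta>v t u)) \<and>
      \<bar>(\<integral>u. cutoff \<kappa> u * exp (p * \<Delta>h t u + p\<^sup>2 / 2 * \<Delta>v t u) \<partial>B t) - 1\<bar>
        \<le> c * (q ^ 3 + 1 / (t * \<kappa>) ^ N))"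
proof -
  define c1 where "c1 = 1 + 2 * m * C + fact m"
  have c1: "c1 > 0" using C_pos m unfolding c1_def by (intro add_pos_pos) auto
  obtain T c2 where T: "1 \<le> T" "0 \<le> c2" and
    v_bound: "\<And>t u. T \<le> t \<Longrightarrow> 0 < u \<Longrightarrow> u < 1 \<Longrightarrow> t ^ (2 * m) * \<bar>\<Delta>v t u\<bar> \<le> c2 * (1 + (t * u) ^ m)"
    using \<Delta>v_bound by metis
  define c4 where "c4 = c1 + c2"
  have c4: "c4 > 0" using c1 T by (simp add: c4_def)
  \<comment> \<open>The bound 1 allows \<open>q\<^sup>2\<close> to be replaced by \<open>q\<close>;
    the bound 1 / (4 c4) keeps the exponent \<open>D\<close> below 1/4 + t u / 4 in modulus under
    the cutoff.\<close>
  define q0 where "q0 = min 1 (1 / (4 * c4))"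
  have q0: "0 < q0" "q0 \<le> 1" "c4 * q0 \<le> 1 / 4" using c4 by (auto simp: q0_def min_def field_simps)
  define e where "e k = fact (m * k) * 4 ^ (m * k) * exp (1 / 4 :: real)" for k
  have e_pos: "e k > 0" for k by (simp add: e_def)
  have e: "(1 + y ^ m) ^ k \<le> e k * exp (y / 4)" if "0 \<le> y" for y :: real and k
    using Z_power_le_exp[OF that, of k] by (simp add: e_def)
  \<comment> \<open>Three errors: \<open>K1\<close> for the Taylor remainder below the cutoff,
    \<open>K2\<close> for the mass above it, \<open>K3\<close> for the terms of third and fourth
    order in \<open>q\<close> contained in the square of \<open>D\<close>.\<close>
  define K1 where "K1 = c4 ^ 3 * exp (1 / 4) * e 3"
  define K2 where "K2 = (1 + c4 + c4\<^sup>2) * e (2 + N)"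
  define K3 where "K3 = (c1 * c2 + c2\<^sup>2) * e 2"
  define K where "K = K1 + K2 + K3"
  have K_pos: "K1 \<ge> 0" "K2 \<ge> 0" "K3 \<ge> 0" "K > 0"
    using c4 c1 T(2) e_pos by (auto simp: K1_def K2_def K3_def K_def less_imp_le intro!: add_pos_nonneg)
  show ?thesis
  proof (rule exI[of _ T], rule exI[of _ q0], rule exI[of _ "2 * K"], safe)
    show "1 \<le> T" "0 < q0" "0 < 2 * K" using T q0 K_pos by auto
    fix t p q \<kappa> :: real
    assume t: "T \<le> t" and \<kappa>: "0 < \<kappa>" and q: "0 \<le> q" "q \<le> q0" "\<bar>p\<bar> \<le> q * t ^ m" "q * (t * \<kappa>) ^ (m - 1) \<le> q0"
    have t0: "0 < t" "1 \<le> t" using t T by auto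
    have q1: "q \<le> 1" using q q0 by simp
    define D where "D u = p * \<Delta>h t u + p\<^sup>2 / 2 * \<Delta>v t u" for u
    define f where "f u = cutoff \<kappa> u * exp (D u)" for u
    \<comment> \<open>The part of \<open>D u + (D u)\<^sup>2 / 2\<close> up to second order in
      \<open>q\<close>, where \<open>\<Delta>v\<close> counts as second order. Its integral is
      exactly zero by the two recursions.\<close>
    define l where "l u = p * \<Delta>h t u + p\<^sup>2 / 2 * (\<Delta>v t u + (\<Delta>h t u)\<^sup>2)" for u
    define R where "R = q ^ 3 + 1 / (t * \<kappa>) ^ N"
    have [measurable]: "D \<in> borel_measurable borel" "f \<in> borel_measurable borel"
      unfolding D_def[abs_def] f_def[abs_def] by measurable
    have ph: "\<bar>p * \<Delta>h t u\<bar> \<le> c1 * q * (1 + (t * u) ^ m)" if "0 < u" "u < 1" for u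
    proof -
      have "\<bar>p * \<Delta>h t u\<bar> \<le> q * t ^ m * \<bar>\<Delta>h t u\<bar>"
        unfolding abs_mult using q by (intro mult_right_mono) auto
      also have "\<dots> = q * (t ^ m * \<bar>\<Delta>h t u\<bar>)" by simp
      also have "\<dots> \<le> q * (c1 * (1 + (t * u) ^ m))"
        unfolding c1_def using q t0 that by (intro mult_left_mono \<Delta>h_bound) auto
      finally show ?thesis by (simp add: mult_ac)
    qed
    have pv: "\<bar>p\<^sup>2 * \<Delta>v t u\<bar> \<le> c2 * q\<^sup>2 * (1 + (t * u) ^ m)" if "0 < u" "u < 1" for u
    proof -
      have "p\<^sup>2 \<le> (q * t ^ m)\<^sup>2" using q t0 by (intro abs_le_square_iff[THEN iffD1]) auto
      also have "(q * t ^ m)\<^sup>2 = q\<^sup>2 * t ^ (2 * m)" by (simp add: power_mult_distrib power_mult[symmetric] mult.commute)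
      finally have "\<bar>p\<^sup>2 * \<Delta>v t u\<bar> \<le> q\<^sup>2 * t ^ (2 * m) * \<bar>\<Delta>v t u\<bar>"
        unfolding abs_mult by (intro mult_right_mono) auto
      also have "\<dots> = q\<^sup>2 * (t ^ (2 * m) * \<bar>\<Delta>v t u\<bar>)" by simp
      also have "\<dots> \<le> q\<^sup>2 * (c2 * (1 + (t * u) ^ m))"
        using t that by (intro mult_left_mono v_bound) auto
      finally show ?thesis by (simp add: mult_ac)
    qed
    have D_le: "\<bar>D u\<bar> \<le> c4 * q * (1 + (t * u) ^ m)" if "0 < u" "u < 1" for u
    proof -
      have "\<bar>D u\<bar> \<le> \<bar>p * \<Delta>h t u\<bar> + \<bar>p\<^sup>2 * \<Delta>v t u\<bar>"
      proof -
        have "D u = p * \<Delta>h t u + (p\<^sup>2 * \<Delta>v t u) / 2" by (simp add: D_def)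
        then show ?thesis by linarith
      qed
      also have "\<dots> \<le> c1 * q * (1 + (t * u) ^ m) + c2 * q\<^sup>2 * (1 + (t * u) ^ m)"
        using ph[OF that] pv[OF that] by simp
      also have "\<dots> \<le> c1 * q * (1 + (t * u) ^ m) + c2 * q * (1 + (t * u) ^ m)"
      proof -
        have "q\<^sup>2 \<le> q" using q q1 by (simp add: power2_eq_square mult_left_le)
        then show ?thesis using T that t0
          by (intro add_mono order.refl mult_right_mono mult_left_mono) auto
      qed
      finally show ?thesis by (simp add: c4_def algebra_simps)
    qed
    have R0: "0 \<le> q ^ 3" "0 \<le> 1 / (t * \<kappa>) ^ N" "0 \<le> R"
      using q t0 \<kappa> by (auto simp: R_def)
    have main: "\<bar>f u - 1 - D u - (D u)\<^sup>2 / 2\<bar> \<le> (K1 + K2) * R * exp (t * u / 2)" if u: "0 < u" "u < 1" for u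
    proof (cases "u \<le> \<kappa>")
      case True
      define y where "y = t * u"
      have y: "0 \<le> y" using t0 u by (simp add: y_def)
      \<comment> \<open>Here the cutoff acts: \<open>m - 1\<close> of the \<open>m\<close> factors
        are bounded by \<open>t * \<kappa>\<close> and absorbed with \<open>q\<close> into
        \<open>q0\<close>, so that only a linear exponent is left.\<close>
      have "q * y ^ m = (q * y ^ (m - 1)) * y" using m by (simp add: power_eq_if)
      also have "\<dots> \<le> q0 * y"
      proof (intro mult_right_mono)
        have "q * y ^ (m - 1) \<le> q * (t * \<kappa>) ^ (m - 1)"
          unfolding y_def using True u t0 q by (intro mult_left_mono power_mono) auto
        then show "q * y ^ (m - 1) \<le> q0" using q by linarith
      qed (use y in auto)
      finally have "q * (1 + y ^ m) \<le> q0 * (1 + y)" using q by (simp add: algebra_simps)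
      then have "c4 * (q * (1 + y ^ m)) \<le> c4 * (q0 * (1 + y))" using c4 by (intro mult_left_mono) auto
      also have "\<dots> \<le> 1 / 4 * (1 + y)"
        unfolding mult.assoc[symmetric] using q0 y by (intro mult_right_mono) auto
      finally have D4: "\<bar>D u\<bar> \<le> 1 / 4 + y / 4" using D_le[OF u] by (simp add: y_def algebra_simps)
      have "f u = exp (D u)" using True u by (simp add: f_def cutoff_def)
      then have "\<bar>f u - 1 - D u - (D u)\<^sup>2 / 2\<bar> \<le> \<bar>D u\<bar> ^ 3 * exp \<bar>D u\<bar>"
        using exp_Taylor2_le by simp
      also have "\<dots> \<le> (c4 * q * (1 + y ^ m)) ^ 3 * (exp (1 / 4) * exp (y / 4))"
        using D_le[OF u] D4 unfolding y_def
        by (intro mult_mono power_mono) (auto simp flip: exp_add)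
      also have "\<dots> = c4 ^ 3 * q ^ 3 * exp (1 / 4) * (1 + y ^ m) ^ 3 * exp (y / 4)"
        by (simp add: power_mult_distrib)
      also have "\<dots> \<le> c4 ^ 3 * q ^ 3 * exp (1 / 4) * (e 3 * exp (y / 4)) * exp (y / 4)"
        using c4 q y e[of y 3] by (intro mult_right_mono mult_left_mono) auto
      also have "\<dots> = K1 * q ^ 3 * exp (y / 2)"
        by (simp add: K1_def exp_add[symmetric])
      also have "\<dots> \<le> (K1 + K2) * R * exp (y / 2)"
        using K_pos R0 by (intro mult_right_mono mult_mono) (auto simp: R_def)
      finally show ?thesis by (simp add: y_def)
    next
      case False
      define y where "y = t * u"
      define Z where "Z = 1 + y ^ m"
      have y: "0 \<le> y" using t0 u by (simp add: y_def)
      have Z: "1 \<le> Z" using y by (simp add: Z_def)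
      \<comment> \<open>Markov's inequality in pointwise form: above the cutoff the factor (y / (t
        \<kappa>))^N is at least 1, and \<open>y ^ N\<close> is absorbed by the exponential
        weight.\<close>
      have "y / (t * \<kappa>) \<ge> 1" using False t0 \<kappa> by (simp add: y_def)
      then have yN: "1 \<le> y ^ N / (t * \<kappa>) ^ N" by (metis one_le_power power_divide)
      have D: "\<bar>D u\<bar> \<le> c4 * Z"
      proof -
        have "c4 * q * Z \<le> c4 * 1 * Z" using q1 c4 Z by (intro mult_right_mono mult_left_mono) auto
        then show ?thesis using D_le[OF u] by (simp add: y_def Z_def)
      qed
      have "f u = 0" using False by (simp add: f_def cutoff_def)
      then have "\<bar>f u - 1 - D u - (D u)\<^sup>2 / 2\<bar> \<le> 1 + \<bar>D u\<bar> + \<bar>D u\<bar>\<^sup>2"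
        using zero_le_power2[of "D u"] unfolding power2_abs by linarith
      also have "\<dots> \<le> 1 * Z\<^sup>2 + c4 * Z\<^sup>2 + c4\<^sup>2 * Z\<^sup>2"
      proof (intro add_mono)
        show "1 \<le> 1 * Z\<^sup>2" using Z by simp
        have "c4 * Z \<le> c4 * Z\<^sup>2" using Z c4 by (intro mult_left_mono) (auto simp: power2_eq_square)
        then show "\<bar>D u\<bar> \<le> c4 * Z\<^sup>2" using D by simp
        have "\<bar>D u\<bar>\<^sup>2 \<le> (c4 * Z)\<^sup>2" using D by (intro power_mono) auto
        then show "\<bar>D u\<bar>\<^sup>2 \<le> c4\<^sup>2 * Z\<^sup>2" by (simp add: power_mult_distrib)
      qed
      also have "\<dots> = (1 + c4 + c4\<^sup>2) * Z\<^sup>2 * 1" by (simp add: algebra_simps)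
      also have "\<dots> \<le> (1 + c4 + c4\<^sup>2) * Z\<^sup>2 * (y ^ N / (t * \<kappa>) ^ N)"
        using c4 yN by (intro mult_left_mono) auto
      also have "\<dots> = (1 + c4 + c4\<^sup>2) * (1 / (t * \<kappa>) ^ N) * (Z\<^sup>2 * y ^ N)" by simp
      also have "\<dots> \<le> (1 + c4 + c4\<^sup>2) * (1 / (t * \<kappa>) ^ N) * (e (2 + N) * exp (y / 2))"
      proof (intro mult_left_mono)
        have "y \<le> Z" unfolding Z_def
          using self_le_power[of y m] y m by (cases "y \<le> 1") (auto intro: order.trans)
        then have "Z\<^sup>2 * y ^ N \<le> Z\<^sup>2 * Z ^ N" using y by (intro mult_left_mono power_mono) auto
        also have "\<dots> = Z ^ (2 + N)" by (simp only: power_add)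
        also have "\<dots> \<le> e (2 + N) * exp (y / 4)" unfolding Z_def by (rule e[OF y])
        also have "\<dots> \<le> e (2 + N) * exp (y / 2)" using y e_pos[of "2 + N"] by (intro mult_left_mono) auto
        finally show "Z\<^sup>2 * y ^ N \<le> e (2 + N) * exp (y / 2)" .
      qed (use c4 R0 in auto)
      also have "\<dots> = K2 * (1 / (t * \<kappa>) ^ N) * exp (y / 2)" by (simp add: K2_def)
      also have "\<dots> \<le> (K1 + K2) * R * exp (y / 2)"
        using K_pos R0 by (intro mult_right_mono mult_mono) (auto simp: R_def)
      finally show ?thesis by (simp add: y_def)
    qed
    have rest: "\<bar>1 + D u + (D u)\<^sup>2 / 2 - 1 - l u\<bar> \<le> K3 * R * exp (t * u / 2)" if u: "0 < u" "u < 1" for u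
    proof -
      define y where "y = t * u"
      have y: "0 \<le> y" using t0 u by (simp add: y_def)
      define Z where "Z = 1 + y ^ m"
      have Z: "1 \<le> Z" using y by (simp add: Z_def)
      define a b where "a = p * \<Delta>h t u" and "b = p\<^sup>2 * \<Delta>v t u"
      have a: "\<bar>a\<bar> \<le> c1 * q * Z" and b: "\<bar>b\<bar> \<le> c2 * q\<^sup>2 * Z"
        using ph[OF u] pv[OF u] by (auto simp: a_def b_def Z_def y_def)
      have "1 + D u + (D u)\<^sup>2 / 2 - 1 - l u = a * b / 2 + b * b / 8"
        by (simp add: D_def l_def a_def b_def power2_eq_square field_simps)
      also have "\<bar>\<dots>\<bar> \<le> \<bar>a\<bar> * \<bar>b\<bar> + \<bar>b\<bar> * \<bar>b\<bar>"
      proof -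
        have "\<bar>a * b / 2 + b * b / 8\<bar> \<le> \<bar>a\<bar> * \<bar>b\<bar> / 2 + b * b / 8"
          by (rule order.trans[OF abs_triangle_ineq]) (simp add: abs_mult)
        moreover have "0 \<le> \<bar>a\<bar> * \<bar>b\<bar>" "0 \<le> b * b" "\<bar>b\<bar> * \<bar>b\<bar> = b * b" by auto
        ultimately show ?thesis by linarith
      qed
      also have "\<dots> \<le> (c1 * q * Z) * (c2 * q\<^sup>2 * Z) + (c2 * q\<^sup>2 * Z) * (c2 * q\<^sup>2 * Z)"
        using a b by (intro add_mono mult_mono) (use c1 T(2) q Z in auto)
      also have "\<dots> = (c1 * c2 + c2\<^sup>2 * q) * (q ^ 3 * Z\<^sup>2)"
        by (simp add: eval_nat_numeral algebra_simps)
      also have "\<dots> \<le> (c1 * c2 + c2\<^sup>2 * 1) * (q ^ 3 * (e 2 * exp (y / 2)))"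
      proof (intro mult_mono add_mono mult_left_mono)
        have "Z\<^sup>2 \<le> e 2 * exp (y / 4)" unfolding Z_def by (rule e[OF y])
        also have "\<dots> \<le> e 2 * exp (y / 2)" using y e_pos[of 2] by (intro mult_left_mono) auto
        finally show "Z\<^sup>2 \<le> e 2 * exp (y / 2)" .
      qed (use c1 T(2) q q1 Z in auto)
      also have "\<dots> = K3 * q ^ 3 * exp (y / 2)" by (simp add: K3_def)
      also have "\<dots> \<le> K3 * R * exp (y / 2)"
        using K_pos R0 by (intro mult_right_mono mult_left_mono) (auto simp: R_def)
      finally show ?thesis by (simp add: y_def)
    qed
    have l_int: "integrable (B t) (\<Delta>h t)" "integrable (B t) (\<lambda>u. (\<Delta>h t u)\<^sup>2)" "integrable (B t) (\<Delta>v t)"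
    proof -
      interpret prob_space "B t" by (rule prob_space_B) (rule t0)
      show "integrable (B t) (\<Delta>h t)" "integrable (B t) (\<Delta>v t)"
        using t0 by (auto simp: \<Delta>h_def[abs_def] \<Delta>v_def[abs_def])
      show "integrable (B t) (\<lambda>u. (\<Delta>h t u)\<^sup>2)"
      proof (rule integrable_B_dominated(1)[OF t0(1)])
        fix u :: real assume u: "0 < u" "u < 1"
        have "1 * \<bar>\<Delta>h t u\<bar> \<le> t ^ m * \<bar>\<Delta>h t u\<bar>" using t0 by (intro mult_right_mono) auto
        also have "\<dots> \<le> c1 * (1 + (t * u) ^ m)" unfolding c1_def using t0 u by (intro \<Delta>h_bound)
        finally have "\<bar>\<Delta>h t u\<bar>\<^sup>2 \<le> (c1 * (1 + (t * u) ^ m))\<^sup>2" by (intro power_mono) auto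
        also have "\<dots> = c1\<^sup>2 * (1 + (t * u) ^ m)\<^sup>2" by (simp add: power_mult_distrib)
        also have "\<dots> \<le> c1\<^sup>2 * (e 2 * exp (t * u / 2))"
        proof (intro mult_left_mono)
          have "(1 + (t * u) ^ m)\<^sup>2 \<le> e 2 * exp (t * u / 4)" using t0 u by (intro e) auto
          also have "\<dots> \<le> e 2 * exp (t * u / 2)" using t0 u e_pos[of 2] by (intro mult_left_mono) auto
          finally show "(1 + (t * u) ^ m)\<^sup>2 \<le> e 2 * exp (t * u / 2)" .
        qed simp
        finally show "\<bar>(\<Delta>h t u)\<^sup>2\<bar> \<le> c1\<^sup>2 * e 2 * exp (t * u / 2)" by simp
      qed measurable
    qed
    have l: "integrable (B t) l" "(\<integral>u. l u \<partial>B t) = 0"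
      unfolding l_def using l_int integral_\<Delta>h[OF t0(1)] integral_\<Delta>v[OF t0(1)] by simp_all
    have [measurable]: "l \<in> borel_measurable borel" unfolding l_def[abs_def] by measurable
    have err: "\<bar>f u - 1 - l u\<bar> \<le> K * R * exp (t * u / 2)" if u: "0 < u" "u < 1" for u
    proof -
      have "\<bar>f u - 1 - l u\<bar> \<le> \<bar>f u - 1 - D u - (D u)\<^sup>2 / 2\<bar> + \<bar>1 + D u + (D u)\<^sup>2 / 2 - 1 - l u\<bar>"
        by linarith
      also have "\<dots> \<le> (K1 + K2) * R * exp (t * u / 2) + K3 * R * exp (t * u / 2)"
        using main[OF u] rest[OF u] by simp
      finally show ?thesis by (simp add: K_def algebra_simps)
    qed
    have meas: "(\<lambda>u. f u - 1 - l u) \<in> borel_measurable borel" by measurable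
    have g: "integrable (B t) (\<lambda>u. f u - 1 - l u)"
      by (rule integrable_B_dominated(1)[OF t0(1) meas]) (rule err)
    have g': "\<bar>\<integral>u. f u - 1 - l u \<partial>B t\<bar> \<le> 2 * (K * R)"
      by (rule integrable_B_dominated(2)[OF t0(1) meas]) (rule err)
    interpret prob_space "B t" by (rule prob_space_B) (rule t0)
    have "integrable (B t) (\<lambda>u. (f u - 1 - l u) + (1 + l u))"
      using g l(1) by (intro Bochner_Integration.integrable_add) auto
    then have f: "integrable (B t) f" by simp
    have "(\<integral>u. f u - 1 - l u \<partial>B t) = (\<integral>u. f u \<partial>B t) - 1"
      using f l prob_space by simp
    then have "\<bar>(\<integral>u. f u \<partial>B t) - 1\<bar> \<le> 2 * K * R" using g' by simp
    with f show "integrable (B t) (\<lambda>u. cutoff \<kappa> u * exp (p * \<Delta>h t u + p\<^sup>2 / 2 * \<Delta>v t u))"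
      "\<bar>(\<integral>u. cutoff \<kappa> u * exp (p * \<Delta>h t u + p\<^sup>2 / 2 * \<Delta>v t u) \<partial>B t) - 1\<bar>
        \<le> 2 * K * (q ^ 3 + 1 / (t * \<kappa>) ^ N)"
      unfolding f_def D_def R_def by simp_all
  qed
qed

end

section \<open>Exponential moments of the homozygosity\<close>

text \<open>Fubini for the joint law. Both integrals are taken over the original space, with a
  second sample point for the fresh variable, so no product space has to be carried along.\<close>

lemma (in prob_space) nn_integral_indep_var:
  assumes ind: "indep_var S X T Y"
    and f: "f \<in> borel_measurable (S \<Otimes>\<^sub>M T)"
  shows "(\<integral>\<^sup>+\<omega>. f (X \<omega>, Y \<omega>) \<partial>M) = (\<integral>\<^sup>+\<omega>. \<integral>\<^sup>+\<omega>'. f (X \<omega>, Y \<omega>') \<partial>M \<partial>M)"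
proof -
  have X[measurable]: "X \<in> measurable M S" and Y[measurable]: "Y \<in> measurable M T"
    and eq: "distr M S X \<Otimes>\<^sub>M distr M T Y = distr M (S \<Otimes>\<^sub>M T) (\<lambda>x. (X x, Y x))"
    using ind by (auto simp: indep_var_distribution_eq)
  interpret Y: prob_space "distr M T Y" by (rule prob_space_distr) simp
  note f[measurable]
  have "(\<integral>\<^sup>+\<omega>. f (X \<omega>, Y \<omega>) \<partial>M) = (\<integral>\<^sup>+z. f z \<partial>distr M (S \<Otimes>\<^sub>M T) (\<lambda>x. (X x, Y x)))"
    by (subst nn_integral_distr) auto
  also have "\<dots> = (\<integral>\<^sup>+x. \<integral>\<^sup>+y. f (x, y) \<partial>distr M T Y \<partial>distr M S X)"
    unfolding eq[symmetric] by (subst Y.nn_integral_fst[symmetric]) auto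
  also have "\<dots> = (\<integral>\<^sup>+\<omega>. \<integral>\<^sup>+y. f (X \<omega>, y) \<partial>distr M T Y \<partial>M)"
    by (subst nn_integral_distr) auto
  also have "\<dots> = (\<integral>\<^sup>+\<omega>. \<integral>\<^sup>+\<omega>'. f (X \<omega>, Y \<omega>') \<partial>M \<partial>M)"
    by (intro nn_integral_cong nn_integral_distr) auto
  finally show ?thesis .
qed

lemma stick_breaking_sum: "(\<Sum>k<n. stick_breaking x k) = 1 - (\<Prod>k<n. 1 - x k)"
  by (induction n) (auto simp: stick_breaking_def algebra_simps)

lemma
  assumes "\<And>k. 0 \<le> x k \<and> x k \<le> 1"
  shows stick_breaking_nonneg: "0 \<le> stick_breaking x k"
    and stick_breaking_power_sum_le: "1 \<le> m \<Longrightarrow> (\<Sum>k<n. stick_breaking x k ^ m) \<le> 1"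
    and summable_stick_breaking_power: "1 \<le> m \<Longrightarrow> summable (\<lambda>k. stick_breaking x k ^ m)"
proof -
  have W: "0 \<le> (\<Prod>k<n. 1 - x k)" "(\<Prod>k<n. 1 - x k) \<le> 1" for n
    using assms by (auto intro!: prod_nonneg prod_le_1)
  show nn: "0 \<le> stick_breaking x k" for k
    using W assms by (simp add: stick_breaking_def)
  have le1: "stick_breaking x k \<le> 1" for k
    using W assms[of k] unfolding stick_breaking_def by (intro mult_le_one) auto
  have le: "(\<Sum>k<n. stick_breaking x k ^ m) \<le> 1" if "1 \<le> m" for n m
  proof -
    have "(\<Sum>k<n. stick_breaking x k ^ m) \<le> (\<Sum>k<n. stick_breaking x k)"
      using nn le1 that by (intro sum_mono) (use power_decreasing[of 1 m] in auto)
    also have "\<dots> \<le> 1" using W[of n] by (simp add: stick_breaking_sum)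
    finally show ?thesis .
  qed
  then show "1 \<le> m \<Longrightarrow> (\<Sum>k<n. stick_breaking x k ^ m) \<le> 1" .
  show "1 \<le> m \<Longrightarrow> summable (\<lambda>k. stick_breaking x k ^ m)"
    using le nn by (intro summableI_nonneg_bounded[of _ 1]) auto
qed

lemma homozygosity_rearrangement:
  assumes "descending_rearrangement x p" "\<And>i. 0 \<le> x i" "summable (\<lambda>i. x i ^ m)"
  shows "homozygosity m p = homozygosity m x"
proof -
  obtain \<pi> where \<pi>: "bij \<pi>" "\<And>i. p i = x (\<pi> i)"
    using assms(1) by (auto simp: descending_rearrangement_def)
  have "suminf ((\<lambda>i. x i ^ m) \<circ> \<pi>) = (\<Sum>i. x i ^ m)"
    using assms \<pi> by (intro suminf_reindex) (auto simp: bij_def)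
  then show ?thesis by (simp add: homozygosity_def \<pi> o_def)
qed

text \<open>It turns a factor 1 - \<delta> into exp (- 2 \<delta>). This is the origin of the factor
  2 in the lower bounds for the exponential moments, whereas 1 + \<delta> \<le> exp \<delta> serves
  the upper ones.\<close>

lemma exp_neg_le_one_minus:
  fixes x :: real
  assumes "0 \<le> x" "x \<le> 1 / 2"
  shows "exp (- 2 * x) \<le> 1 - x"
proof -
  have "x\<^sup>2 \<le> x * (1 / 2)" unfolding power2_eq_square using assms by (intro mult_left_mono) auto
  then have "- 2 * x \<le> ln (1 - x)" using ln_one_minus_pos_lower_bound[OF assms] by linarith
  then show ?thesis using assms by (subst (asm) ln_ge_iff) auto
qed

context PD_parameters
begin

lemma h_tendsto_0: "(h \<longlongrightarrow> 0) at_top"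
proof (rule tendsto_sandwich[of "\<lambda>_. 0" _ _ "\<lambda>t. C / t"])
  show "\<forall>\<^sub>F t in at_top. 0 \<le> h t"
    using eventually_ge_at_top[of 0] by eventually_elim (use h_pos in \<open>auto intro: less_imp_le\<close>)
  show "\<forall>\<^sub>F t in at_top. h t \<le> C / t"
    using eventually_ge_at_top[of 1]
  proof eventually_elim
    case (elim t)
    have "h t \<le> C / t ^ (m - 1)" using elim by (intro h_le) auto
    also have "\<dots> \<le> C / t ^ 1"
      using elim m C_pos by (intro divide_left_mono power_increasing) auto
    finally show ?case by simp
  qed
  show "((\<lambda>t. C / t) \<longlongrightarrow> 0) at_top" by real_asymp
qed simp

lemma v_tendsto_0: "(v \<longlongrightarrow> 0) at_top"
proof -
  obtain T c where T: "1 \<le> T" "0 \<le> c" "\<And>t. T \<le> t \<Longrightarrow> t ^ (2 * m - 1) * \<bar>v t\<bar> \<le> c"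
    using v_bound by blast
  show ?thesis
  proof (rule Lim_null_comparison)
    show "\<forall>\<^sub>F t in at_top. norm (v t) \<le> c / t"
      using eventually_ge_at_top[of T]
    proof eventually_elim
      case (elim t)
      have "t ^ 1 \<le> t ^ (2 * m - 1)" using elim T m by (intro power_increasing) auto
      then have "t * \<bar>v t\<bar> \<le> t ^ (2 * m - 1) * \<bar>v t\<bar>" by (intro mult_right_mono) auto
      also have "\<dots> \<le> c" using T elim by auto
      finally show ?case using elim T by (simp add: field_simps)
    qed
    show "((\<lambda>t. c / t) \<longlongrightarrow> 0) at_top" by real_asymp
  qed
qed

end

section \<open>The stick-breaking (Griffiths-Engen-McCloskey) process at a fixed parameter\<close>

locale GEM = PD_parameters + prob_space M for M :: "'w measure" +
  fixes U :: "nat \<Rightarrow> 'w \<Rightarrow> real" and \<theta> :: real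
  assumes theta: "0 < \<theta>"
    and indep: "indep_vars (\<lambda>_. borel) U UNIV"
    and U_beta: "\<And>k. distributed M lborel (U k) (beta_density (1 - \<alpha>) (\<theta> + real (k + 1) * \<alpha>))"
begin

abbreviation \<tau> :: "nat \<Rightarrow> real" where "\<tau> k \<equiv> \<theta> + real k * \<alpha>"

lemma tau_pos: "0 < \<tau> k"
  using theta alpha by (intro add_pos_nonneg) auto

definition W :: "nat \<Rightarrow> (nat \<Rightarrow> real) \<Rightarrow> real" where
  "W n x = (\<Prod>k<n. 1 - x k)"

text \<open>\<open>s\<close> times the conditional mean of the homozygosity given the first
  \<open>n\<close> sticks, plus s^2 / 2 times its conditional variance. It is deterministic at
  \<open>n = 0\<close> and tends to \<open>s\<close> times the homozygosity, so it joins the two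
  sides of the moment estimate.\<close>

definition \<Phi> :: "real \<Rightarrow> nat \<Rightarrow> (nat \<Rightarrow> real) \<Rightarrow> real" where
  "\<Phi> s n x = s * ((\<Sum>k<n. stick_breaking x k ^ m) + W n x ^ m * h (\<tau> n))
    + s\<^sup>2 / 2 * W n x ^ (2 * m) * v (\<tau> n)"

definition G :: "real \<Rightarrow> real \<Rightarrow> nat \<Rightarrow> (nat \<Rightarrow> real) \<Rightarrow> real" where
  "G s \<kappa> n x = (\<Prod>k<n. cutoff \<kappa> (x k)) * exp (\<Phi> s n x)"

lemma W_Suc: "W (Suc n) x = W n x * (1 - x n)"
  by (simp add: W_def)

text \<open>By homogeneity the past enters the new increment only through the effective tilt
  \<open>s * W n x ^ m\<close>, and the increment has the form treated for a single break.\<close>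

lemma \<Phi>_Suc:
  "\<Phi> s (Suc n) x = \<Phi> s n x + ((s * W n x ^ m) * \<Delta>h (\<tau> n) (x n) + (s * W n x ^ m)\<^sup>2 / 2 * \<Delta>v (\<tau> n) (x n))"
proof -
  have "\<tau> (Suc n) = \<tau> n + \<alpha>" by (simp add: algebra_simps)
  moreover have "stick_breaking x n = W n x * x n" by (simp add: stick_breaking_def W_def)
  moreover have "W n x ^ (2 * m) = (W n x ^ m)\<^sup>2" by (simp add: mult.commute flip: power_mult)
  ultimately have "\<Phi> s (Suc n) x = s * ((\<Sum>k<n. stick_breaking x k ^ m) + W n x ^ m * x n ^ m
      + W n x ^ m * (1 - x n) ^ m * h (\<tau> n + \<alpha>)) + s\<^sup>2 / 2 * ((W n x ^ m)\<^sup>2 * (1 - x n) ^ (2 * m)) * v (\<tau> n + \<alpha>)"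
    and "\<Phi> s n x = s * ((\<Sum>k<n. stick_breaking x k ^ m) + W n x ^ m * h (\<tau> n)) + s\<^sup>2 / 2 * (W n x ^ m)\<^sup>2 * v (\<tau> n)"
    by (simp_all only: \<Phi>_def W_Suc power_mult_distrib sum.lessThan_Suc)
  then show ?thesis
    by (simp only: \<Delta>h_def \<Delta>v_def power2_eq_square) (simp add: field_simps)
qed

lemma G_Suc:
  "G s \<kappa> (Suc n) x = G s \<kappa> n x * (cutoff \<kappa> (x n) *
    exp ((s * W n x ^ m) * \<Delta>h (\<tau> n) (x n) + (s * W n x ^ m)\<^sup>2 / 2 * \<Delta>v (\<tau> n) (x n)))"
  by (simp add: G_def \<Phi>_Suc exp_add mult_ac)

lemma G_nonneg: "0 \<le> G s \<kappa> n x"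
  unfolding G_def by (intro mult_nonneg_nonneg prod_nonneg) (auto simp: cutoff_bounds)

lemma W_restrict: "k \<le> n \<Longrightarrow> W k (restrict x {..<n}) = W k x"
  unfolding W_def by (intro prod.cong) auto

text \<open>\<open>G\<close> at time \<open>n\<close> is a function of the past alone. Together with
  the independence of disjoint index blocks this allows the stick \<open>n\<close> to be integrated
  out first.\<close>

lemma G_restrict: "G s \<kappa> n (restrict x {..<n}) = G s \<kappa> n x"
proof -
  have "stick_breaking (restrict x {..<n}) k = stick_breaking x k" if "k < n" for k
    using that W_restrict[of k n x] by (simp add: stick_breaking_def W_def)
  then show ?thesis by (simp add: G_def \<Phi>_def W_restrict)
qed

lemma U_measurable [measurable]: "U k \<in> borel_measurable M"
  using indep by (auto simp: indep_vars_def)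

lemma distr_U: "distr M borel (U k) = B (\<tau> k)"
proof -
  have "distr M borel (U k) = distr M lborel (U k)" by (rule distr_cong) auto
  also have "\<dots> = beta_law (1 - \<alpha>) (\<theta> + real (k + 1) * \<alpha>)"
    unfolding beta_law_def by (rule distributed_distr_eq_density) (rule U_beta)
  finally show ?thesis by (simp add: algebra_simps)
qed

lemma AE_U: "AE \<omega> in M. \<forall>k. 0 < U k \<omega> \<and> U k \<omega> < 1"
proof (subst AE_all_countable, intro allI)
  fix k
  have "AE u in distr M borel (U k). 0 < u \<and> u < 1" unfolding distr_U by (rule AE_B_I) simp
  then show "AE \<omega> in M. 0 < U k \<omega> \<and> U k \<omega> < 1" by (subst (asm) AE_distr_iff) auto
qed

lemma indep_var_past: "indep_var (PiM {..<n} (\<lambda>_. borel)) (\<lambda>\<omega>. restrict (\<lambda>k. U k \<omega>) {..<n})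
    (PiM {n} (\<lambda>_. borel)) (\<lambda>\<omega>. restrict (\<lambda>k. U k \<omega>) {n})"
  using indep by (rule indep_var_restrict) auto

lemma W_measurable_PiM [measurable]: "k \<le> n \<Longrightarrow> W k \<in> borel_measurable (PiM {..<n} (\<lambda>_. borel))"
  unfolding W_def[abs_def]
  by (intro borel_measurable_prod borel_measurable_diff borel_measurable_const measurable_component_singleton) auto

lemma G_measurable_PiM [measurable]: "G s \<kappa> n \<in> borel_measurable (PiM {..<n} (\<lambda>_. borel))"
proof -
  have [measurable]: "(\<lambda>x. x k) \<in> borel_measurable (PiM {..<n} (\<lambda>_. borel))" if "k < n" for k
    using that by (intro measurable_component_singleton) auto
  have [measurable]: "(\<lambda>x. stick_breaking x k ^ m) \<in> borel_measurable (PiM {..<n} (\<lambda>_. borel))" if "k < n" for k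
    using that W_measurable_PiM[of k n] unfolding stick_breaking_def W_def[symmetric] by simp
  have [measurable]: "W n \<in> borel_measurable (PiM {..<n} (\<lambda>_. borel))" by (rule W_measurable_PiM) simp
  have [measurable]: "(\<lambda>x. \<Sum>k<n. stick_breaking x k ^ m) \<in> borel_measurable (PiM {..<n} (\<lambda>_. borel))"
    by (rule borel_measurable_sum) auto
  have [measurable]: "(\<lambda>x. \<Prod>k<n. cutoff \<kappa> (x k)) \<in> borel_measurable (PiM {..<n} (\<lambda>_. borel))"
    by (rule borel_measurable_prod) auto
  show ?thesis unfolding G_def[abs_def] \<Phi>_def by measurable
qed

lemma G_measurable [measurable]: "(\<lambda>\<omega>. G s \<kappa> n (\<lambda>k. U k \<omega>)) \<in> borel_measurable M"
  unfolding G_def[abs_def] \<Phi>_def W_def stick_breaking_def by measurable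

abbreviation EG :: "real \<Rightarrow> real \<Rightarrow> nat \<Rightarrow> ennreal" where
  "EG s \<kappa> n \<equiv> \<integral>\<^sup>+\<omega>. G s \<kappa> n (\<lambda>k. U k \<omega>) \<partial>M"

text \<open>Given the past, the integral over stick \<open>n\<close> is the one-step integral at the
  effective tilt. That tilt is random but almost surely at most \<open>\<bar>s\<bar>\<close> in
  modulus, which is why the hypothesis ranges over all such \<open>p\<close>.\<close>

lemma EG_step:
  assumes "\<And>p. \<bar>p\<bar> \<le> \<bar>s\<bar> \<Longrightarrow>
    integrable (B (\<tau> n)) (\<lambda>u. cutoff \<kappa> u * exp (p * \<Delta>h (\<tau> n) u + p\<^sup>2 / 2 * \<Delta>v (\<tau> n) u)) \<and>
    \<bar>(\<integral>u. cutoff \<kappa> u * exp (p * \<Delta>h (\<tau> n) u + p\<^sup>2 / 2 * \<Delta>v (\<tau> n) u) \<partial>B (\<tau> n)) - 1\<bar> \<le> \<delta>"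
  shows "ennreal (1 - \<delta>) * EG s \<kappa> n \<le> EG s \<kappa> (Suc n)"
    and "EG s \<kappa> (Suc n) \<le> ennreal (1 + \<delta>) * EG s \<kappa> n"
proof -
  define g where "g p = (\<integral>\<^sup>+u. cutoff \<kappa> u * exp (p * \<Delta>h (\<tau> n) u + p\<^sup>2 / 2 * \<Delta>v (\<tau> n) u) \<partial>B (\<tau> n))" for p
  have gm: "(\<lambda>u. ennreal (cutoff \<kappa> u * exp (q * \<Delta>h (\<tau> n) u + q\<^sup>2 / 2 * \<Delta>v (\<tau> n) u)))
      \<in> borel_measurable (B (\<tau> n))" for q
    by measurable
  define p where "p x = s * W n x ^ m" for x
  have g: "ennreal (1 - \<delta>) \<le> g q" "g q \<le> ennreal (1 + \<delta>)" if "\<bar>q\<bar> \<le> \<bar>s\<bar>" for q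
    unfolding g_def using assms[OF that]
    by (subst nn_integral_eq_integral; auto simp: cutoff_bounds intro!: ennreal_leI)+
  let ?F = "\<lambda>x u. G s \<kappa> n x * (cutoff \<kappa> u * exp (p x * \<Delta>h (\<tau> n) u + (p x)\<^sup>2 / 2 * \<Delta>v (\<tau> n) u))"
  let ?f = "\<lambda>z. ennreal (?F (fst z) (snd z n))"
  let ?r = "\<lambda>\<omega> A. restrict (\<lambda>k. U k \<omega>) A"
  have [measurable]: "p \<in> borel_measurable (PiM {..<n} (\<lambda>_. borel))"
    unfolding p_def[abs_def] by measurable
  have [measurable]: "(\<lambda>x. x n) \<in> borel_measurable (PiM {n} (\<lambda>_. borel))"
    by (rule measurable_component_singleton) simp
  have [simp]: "p (?r \<omega> {..<n}) = p (\<lambda>k. U k \<omega>)" for \<omega>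
    by (simp add: p_def W_restrict)
  have "EG s \<kappa> (Suc n) = (\<integral>\<^sup>+\<omega>. ?f (?r \<omega> {..<n}, ?r \<omega> {n}) \<partial>M)"
    by (simp add: G_Suc G_restrict) (simp add: p_def)
  also have "\<dots> = (\<integral>\<^sup>+\<omega>. \<integral>\<^sup>+\<omega>'. ?f (?r \<omega> {..<n}, ?r \<omega>' {n}) \<partial>M \<partial>M)"
    by (rule nn_integral_indep_var[OF indep_var_past]) measurable
  also have "\<dots> = (\<integral>\<^sup>+\<omega>. \<integral>\<^sup>+u. ?F (\<lambda>k. U k \<omega>) u \<partial>distr M borel (U n) \<partial>M)"
    by (intro nn_integral_cong) (simp add: G_restrict nn_integral_distr)
  also have "\<dots> = (\<integral>\<^sup>+\<omega>. ennreal (G s \<kappa> n (\<lambda>k. U k \<omega>)) * g (p (\<lambda>k. U k \<omega>)) \<partial>M)"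
    unfolding distr_U g_def ennreal_mult'[OF G_nonneg]
    by (intro nn_integral_cong nn_integral_cmult gm)
  finally have eq: "EG s \<kappa> (Suc n) = \<dots>" .
  have p_le: "AE \<omega> in M. \<bar>p (\<lambda>k. U k \<omega>)\<bar> \<le> \<bar>s\<bar>"
    using AE_U
  proof eventually_elim
    case (elim \<omega>)
    then have "0 \<le> W n (\<lambda>k. U k \<omega>)" "W n (\<lambda>k. U k \<omega>) \<le> 1"
      unfolding W_def by (auto intro!: prod_nonneg prod_le_1 simp: less_imp_le)
    then show ?case by (simp add: p_def abs_mult power_le_one mult_left_le)
  qed
  show "ennreal (1 - \<delta>) * EG s \<kappa> n \<le> EG s \<kappa> (Suc n)"
    unfolding eq by (subst nn_integral_cmult[symmetric], simp, intro nn_integral_mono_AE)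
      (use p_le in \<open>eventually_elim, subst mult.commute, auto intro!: mult_left_mono g\<close>)
  show "EG s \<kappa> (Suc n) \<le> ennreal (1 + \<delta>) * EG s \<kappa> n"
    unfolding eq by (subst nn_integral_cmult[symmetric], simp, intro nn_integral_mono_AE)
      (use p_le in \<open>eventually_elim, subst (2) mult.commute, auto intro!: mult_left_mono g\<close>)
qed

lemma EG_0: "EG s \<kappa> 0 = ennreal (exp (s * h \<theta> + s\<^sup>2 / 2 * v \<theta>))"
  by (simp add: G_def \<Phi>_def W_def emeasure_space_1)

lemma EG_bounds:
  assumes step: "\<And>n p. \<bar>p\<bar> \<le> \<bar>s\<bar> \<Longrightarrow>
    integrable (B (\<tau> n)) (\<lambda>u. cutoff \<kappa> u * exp (p * \<Delta>h (\<tau> n) u + p\<^sup>2 / 2 * \<Delta>v (\<tau> n) u)) \<and>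
    \<bar>(\<integral>u. cutoff \<kappa> u * exp (p * \<Delta>h (\<tau> n) u + p\<^sup>2 / 2 * \<Delta>v (\<tau> n) u) \<partial>B (\<tau> n)) - 1\<bar> \<le> \<delta> n"
    and \<delta>: "\<And>n. 0 \<le> \<delta> n" "\<And>n. \<delta> n \<le> 1 / 2"
  shows "ennreal (exp (s * h \<theta> + s\<^sup>2 / 2 * v \<theta> - 2 * (\<Sum>k<n. \<delta> k))) \<le> EG s \<kappa> n"
    and "EG s \<kappa> n \<le> ennreal (exp (s * h \<theta> + s\<^sup>2 / 2 * v \<theta> + (\<Sum>k<n. \<delta> k)))"
proof (induction n)
  case 0
  { case 1 show ?case by (subst EG_0) simp
  next
    case 2 show ?case by (subst EG_0) simp }
next
  case (Suc n)
  let ?e = "s * h \<theta> + s\<^sup>2 / 2 * v \<theta>"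
  { case 1
    have "exp (?e - 2 * (\<Sum>k<Suc n. \<delta> k)) = exp (- 2 * \<delta> n) * exp (?e - 2 * (\<Sum>k<n. \<delta> k))"
      by (simp add: exp_add[symmetric] algebra_simps)
    also have "\<dots> \<le> (1 - \<delta> n) * exp (?e - 2 * (\<Sum>k<n. \<delta> k))"
      using \<delta> by (intro mult_right_mono exp_neg_le_one_minus) auto
    finally have "ennreal (exp (?e - 2 * (\<Sum>k<Suc n. \<delta> k))) \<le> ennreal (1 - \<delta> n) * ennreal (exp (?e - 2 * (\<Sum>k<n. \<delta> k)))"
      by (subst ennreal_mult''[symmetric]) (auto intro: ennreal_leI)
    also have "\<dots> \<le> ennreal (1 - \<delta> n) * EG s \<kappa> n" by (intro mult_left_mono Suc) simp
    also have "\<dots> \<le> EG s \<kappa> (Suc n)" by (rule EG_step(1)) (rule step)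
    finally show ?case .
  next
    case 2
    have "EG s \<kappa> (Suc n) \<le> ennreal (1 + \<delta> n) * EG s \<kappa> n" by (rule EG_step(2)) (rule step)
    also have "\<dots> \<le> ennreal (1 + \<delta> n) * ennreal (exp (?e + (\<Sum>k<n. \<delta> k)))"
      by (intro mult_left_mono Suc) simp
    also have "\<dots> = ennreal ((1 + \<delta> n) * exp (?e + (\<Sum>k<n. \<delta> k)))"
      using \<delta>(1)[of n] by (subst ennreal_mult) auto
    also have "\<dots> \<le> ennreal (exp (\<delta> n) * exp (?e + (\<Sum>k<n. \<delta> k)))"
      by (intro ennreal_leI mult_right_mono) auto
    also have "exp (\<delta> n) * exp (?e + (\<Sum>k<n. \<delta> k)) = exp (?e + (\<Sum>k<Suc n. \<delta> k))"
      by (simp add: exp_add[symmetric] algebra_simps)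
    finally show ?case .
  }
qed

definition bounded_sticks :: "real \<Rightarrow> 'w \<Rightarrow> bool" where
  "bounded_sticks \<kappa> \<omega> \<longleftrightarrow> (\<forall>k. 0 < U k \<omega> \<and> U k \<omega> < 1 \<and> U k \<omega> \<le> \<kappa>)"

lemma bounded_sticks_measurable [measurable]: "Measurable.pred M (bounded_sticks \<kappa>)"
  unfolding bounded_sticks_def[abs_def] by measurable

abbreviation H :: "'w \<Rightarrow> real" where
  "H \<omega> \<equiv> homozygosity m (stick_breaking (\<lambda>k. U k \<omega>))"

text \<open>The terms of \<open>\<Phi>\<close> with \<open>h\<close> and \<open>v\<close> vanish
  because their argument \<open>\<tau> n\<close> grows, while the powers of \<open>W\<close> stay
  below 1. If some stick violates the cutoff, the product contains a zero factor from that index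
  on.\<close>

lemma G_tendsto:
  "(\<lambda>n. G s \<kappa> n (\<lambda>k. U k \<omega>)) \<longlonglongrightarrow> indicator {\<omega>. bounded_sticks \<kappa> \<omega>} \<omega> * exp (s * H \<omega>)"
proof (cases "bounded_sticks \<kappa> \<omega>")
  case True
  let ?x = "\<lambda>k. U k \<omega>"
  have x: "0 \<le> ?x k \<and> ?x k \<le> 1" "cutoff \<kappa> (?x k) = 1" for k
    using True by (auto simp: bounded_sticks_def cutoff_def less_imp_le)
  have W: "0 \<le> W n ?x" "W n ?x \<le> 1" for n
    using x unfolding W_def by (auto intro!: prod_nonneg prod_le_1)
  have tau: "filterlim (\<lambda>n. \<tau> n) at_top sequentially" using alpha by real_asymp
  have W0: "(\<lambda>n. W n ?x ^ k * f (\<tau> n)) \<longlonglongrightarrow> 0" if f: "(f \<longlongrightarrow> 0) at_top" for f :: "real \<Rightarrow> real" and k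
  proof (rule Lim_null_comparison)
    show "\<forall>\<^sub>F n in sequentially. norm (W n ?x ^ k * f (\<tau> n)) \<le> \<bar>f (\<tau> n)\<bar>"
      using W by (intro always_eventually allI) (simp add: abs_mult power_le_one mult_left_le_one_le)
    show "(\<lambda>n. \<bar>f (\<tau> n)\<bar>) \<longlonglongrightarrow> 0"
      by (rule tendsto_rabs_zero[OF filterlim_compose[OF f tau]])
  qed
  have "summable (\<lambda>k. stick_breaking ?x k ^ m)"
    using m x by (intro summable_stick_breaking_power) auto
  then have "(\<lambda>n. \<Sum>k<n. stick_breaking ?x k ^ m) \<longlonglongrightarrow> H \<omega>"
    unfolding homozygosity_def by (rule summable_LIMSEQ)
  from tendsto_add[OF tendsto_mult[OF tendsto_const[of s] tendsto_add[OF this W0[OF h_tendsto_0, of m]]]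
      tendsto_mult[OF tendsto_const[of "s\<^sup>2 / 2"] W0[OF v_tendsto_0, of "2 * m"]]]
  have "(\<lambda>n. \<Phi> s n ?x) \<longlonglongrightarrow> s * (H \<omega> + 0) + s\<^sup>2 / 2 * 0"
    unfolding \<Phi>_def by (simp add: mult.assoc)
  from tendsto_exp[OF this] show ?thesis using True by (simp add: G_def x)
next
  case False
  then obtain k where "cutoff \<kappa> (U k \<omega>) = 0"
    by (auto simp: bounded_sticks_def cutoff_def indicator_def)
  then have "G s \<kappa> n (\<lambda>k. U k \<omega>) = 0" if "n > k" for n
    using that unfolding G_def by (auto intro!: prod_zero)
  then have "\<forall>\<^sub>F n in sequentially. G s \<kappa> n (\<lambda>k. U k \<omega>) = 0"
    by (intro eventually_mono[OF eventually_gt_at_top[of k]])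
  then show ?thesis using False by (simp add: tendsto_eventually)
qed

lemma H_measurable [measurable]: "H \<in> borel_measurable M"
  unfolding homozygosity_def[abs_def] stick_breaking_def by measurable

lemma AE_H_bounds: "AE \<omega> in M. 0 \<le> H \<omega> \<and> H \<omega> \<le> 1"
  using AE_U
proof eventually_elim
  case (elim \<omega>)
  let ?x = "\<lambda>k. U k \<omega>"
  have x: "0 \<le> ?x k \<and> ?x k \<le> 1" for k using elim by (auto simp: less_imp_le)
  have m1: "1 \<le> m" using m by simp
  have summ: "summable (\<lambda>k. stick_breaking ?x k ^ m)"
    by (rule summable_stick_breaking_power[OF x m1])
  show ?case unfolding homozygosity_def
    using suminf_nonneg[OF summ] suminf_le_const[OF summ stick_breaking_power_sum_le[OF x m1]]
    by (simp add: stick_breaking_nonneg x)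
qed

text \<open>One constant dominates all \<open>n\<close>, as needed for dominated convergence at
  fixed \<theta>: the partial sums of the powers lie in [0, 1], and \<open>h\<close> and
  \<open>v\<close> are bounded along \<open>\<tau>\<close>.\<close>

lemma G_bounded: "\<exists>K. \<forall>n. AE \<omega> in M. norm (G s \<kappa> n (\<lambda>k. U k \<omega>)) \<le> K"
proof -
  have tau: "filterlim (\<lambda>n. \<tau> n) at_top sequentially" using alpha by real_asymp
  have "convergent (\<lambda>n. \<bar>h (\<tau> n)\<bar>)" "convergent (\<lambda>n. \<bar>v (\<tau> n)\<bar>)"
    using filterlim_compose[OF h_tendsto_0 tau] filterlim_compose[OF v_tendsto_0 tau]
    by (auto intro!: convergentI tendsto_rabs)
  then have "Bseq (\<lambda>n. \<bar>h (\<tau> n)\<bar>)" "Bseq (\<lambda>n. \<bar>v (\<tau> n)\<bar>)"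
    by (auto intro: convergent_imp_Bseq)
  then obtain K1 K2 where "\<forall>n. norm \<bar>h (\<tau> n)\<bar> \<le> K1" "\<forall>n. norm \<bar>v (\<tau> n)\<bar> \<le> K2"
    unfolding Bseq_def by auto
  then have K: "\<bar>h (\<tau> n)\<bar> \<le> K1" "\<bar>v (\<tau> n)\<bar> \<le> K2" for n by auto
  have "AE \<omega> in M. norm (G s \<kappa> n (\<lambda>k. U k \<omega>)) \<le> exp (\<bar>s\<bar> * (1 + K1) + s\<^sup>2 / 2 * K2)" for n
    using AE_U
  proof eventually_elim
    case (elim \<omega>)
    let ?x = "\<lambda>k. U k \<omega>"
    have x: "0 \<le> ?x k \<and> ?x k \<le> 1" for k using elim by (auto simp: less_imp_le)
    have W: "0 \<le> W n ?x" "W n ?x \<le> 1"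
      using x unfolding W_def by (auto intro!: prod_nonneg prod_le_1)
    have S: "0 \<le> (\<Sum>k<n. stick_breaking ?x k ^ m)" "(\<Sum>k<n. stick_breaking ?x k ^ m) \<le> 1"
      using m x by (auto intro!: sum_nonneg stick_breaking_power_sum_le zero_le_power stick_breaking_nonneg)
    have Wh: "\<bar>W n ?x ^ m * h (\<tau> n)\<bar> \<le> 1 * K1" "\<bar>W n ?x ^ (2 * m) * v (\<tau> n)\<bar> \<le> 1 * K2"
      unfolding abs_mult using W K by (intro mult_mono; auto simp: power_le_one)+
    have "\<Phi> s n ?x = s * ((\<Sum>k<n. stick_breaking ?x k ^ m) + W n ?x ^ m * h (\<tau> n))
        + s\<^sup>2 / 2 * (W n ?x ^ (2 * m) * v (\<tau> n))" by (simp add: \<Phi>_def)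
    also have "\<dots> \<le> \<bar>s\<bar> * \<bar>(\<Sum>k<n. stick_breaking ?x k ^ m) + W n ?x ^ m * h (\<tau> n)\<bar>
        + s\<^sup>2 / 2 * \<bar>W n ?x ^ (2 * m) * v (\<tau> n)\<bar>"
      by (intro add_mono mult_left_mono) (auto simp flip: abs_mult)
    also have "\<dots> \<le> \<bar>s\<bar> * (1 + K1) + s\<^sup>2 / 2 * K2"
      using S Wh by (intro add_mono mult_left_mono) auto
    finally have \<Phi>_le: "\<Phi> s n ?x \<le> \<bar>s\<bar> * (1 + K1) + s\<^sup>2 / 2 * K2" .
    have "(\<Prod>k<n. cutoff \<kappa> (?x k)) * exp (\<Phi> s n ?x) \<le> 1 * exp (\<bar>s\<bar> * (1 + K1) + s\<^sup>2 / 2 * K2)"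
      using \<Phi>_le by (intro mult_mono prod_le_1) (auto simp: cutoff_bounds)
    then show ?case using G_nonneg[of s \<kappa> n ?x] by (simp add: G_def)
  qed
  then show ?thesis by blast
qed

lemma exp_moment_bounds:
  assumes step: "\<And>n p. \<bar>p\<bar> \<le> \<bar>s\<bar> \<Longrightarrow>
    integrable (B (\<tau> n)) (\<lambda>u. cutoff \<kappa> u * exp (p * \<Delta>h (\<tau> n) u + p\<^sup>2 / 2 * \<Delta>v (\<tau> n) u)) \<and>
    \<bar>(\<integral>u. cutoff \<kappa> u * exp (p * \<Delta>h (\<tau> n) u + p\<^sup>2 / 2 * \<Delta>v (\<tau> n) u) \<partial>B (\<tau> n)) - 1\<bar> \<le> \<delta> n"
    and \<delta>: "\<And>n. 0 \<le> \<delta> n" "\<And>n. \<delta> n \<le> 1 / 2" "\<And>n. (\<Sum>k<n. \<delta> k) \<le> \<eta>"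
  shows "exp (s * h \<theta> + s\<^sup>2 / 2 * v \<theta> - 2 * \<eta>) \<le> (\<integral>\<omega>. indicator {\<omega>. bounded_sticks \<kappa> \<omega>} \<omega> * exp (s * H \<omega>) \<partial>M)"
    and "(\<integral>\<omega>. indicator {\<omega>. bounded_sticks \<kappa> \<omega>} \<omega> * exp (s * H \<omega>) \<partial>M) \<le> exp (s * h \<theta> + s\<^sup>2 / 2 * v \<theta> + \<eta>)"
proof -
  let ?E = "\<lambda>\<omega>. indicator {\<omega>. bounded_sticks \<kappa> \<omega>} \<omega> * exp (s * H \<omega>)"
  obtain K where K: "\<And>n. AE \<omega> in M. norm (G s \<kappa> n (\<lambda>k. U k \<omega>)) \<le> K"
    using G_bounded by blast
  have E_meas: "?E \<in> borel_measurable M" by measurable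
  have lim: "AE \<omega> in M. (\<lambda>n. G s \<kappa> n (\<lambda>k. U k \<omega>)) \<longlonglongrightarrow> ?E \<omega>" by (intro AE_I2 G_tendsto)
  have dom: "\<And>n. integrable M (\<lambda>\<omega>. G s \<kappa> n (\<lambda>k. U k \<omega>))"
    "(\<lambda>n. \<integral>\<omega>. G s \<kappa> n (\<lambda>k. U k \<omega>) \<partial>M) \<longlonglongrightarrow> (\<integral>\<omega>. ?E \<omega> \<partial>M)"
    using integrable_dominated_convergence2[OF E_meas G_measurable integrable_const[of K] lim K]
      integral_dominated_convergence[OF E_meas G_measurable integrable_const[of K] lim K] by blast+
  have eq: "EG s \<kappa> n = ennreal (\<integral>\<omega>. G s \<kappa> n (\<lambda>k. U k \<omega>) \<partial>M)" for n
    by (intro nn_integral_eq_integral dom) (auto simp: G_nonneg)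
  show "exp (s * h \<theta> + s\<^sup>2 / 2 * v \<theta> - 2 * \<eta>) \<le> (\<integral>\<omega>. ?E \<omega> \<partial>M)"
  proof (rule LIMSEQ_le_const[OF dom(2)], intro exI allI impI)
    fix n
    have b: "ennreal (exp (s * h \<theta> + s\<^sup>2 / 2 * v \<theta> - 2 * (\<Sum>k<n. \<delta> k))) \<le> EG s \<kappa> n"
      by (rule EG_bounds(1)[of s \<kappa> \<delta> n, OF step \<delta>(1,2)])
    have "exp (s * h \<theta> + s\<^sup>2 / 2 * v \<theta> - 2 * \<eta>) \<le> exp (s * h \<theta> + s\<^sup>2 / 2 * v \<theta> - 2 * (\<Sum>k<n. \<delta> k))"
      using \<delta>(3)[of n] by simp
    also have "\<dots> \<le> (\<integral>\<omega>. G s \<kappa> n (\<lambda>k. U k \<omega>) \<partial>M)"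
      using b unfolding eq
      by (subst (asm) ennreal_le_iff) (auto intro!: integral_nonneg simp: G_nonneg)
    finally show "exp (s * h \<theta> + s\<^sup>2 / 2 * v \<theta> - 2 * \<eta>) \<le> (\<integral>\<omega>. G s \<kappa> n (\<lambda>k. U k \<omega>) \<partial>M)" .
  qed
  show "(\<integral>\<omega>. ?E \<omega> \<partial>M) \<le> exp (s * h \<theta> + s\<^sup>2 / 2 * v \<theta> + \<eta>)"
  proof (rule LIMSEQ_le_const2[OF dom(2)], intro exI allI impI)
    fix n
    have b: "EG s \<kappa> n \<le> ennreal (exp (s * h \<theta> + s\<^sup>2 / 2 * v \<theta> + (\<Sum>k<n. \<delta> k)))"
      by (rule EG_bounds(2)[of s \<kappa> \<delta> n, OF step \<delta>(1,2)])
    have "(\<integral>\<omega>. G s \<kappa> n (\<lambda>k. U k \<omega>) \<partial>M) \<le> exp (s * h \<theta> + s\<^sup>2 / 2 * v \<theta> + (\<Sum>k<n. \<delta> k))"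
      using b unfolding eq
      by (subst (asm) ennreal_le_iff) auto
    also have "\<dots> \<le> exp (s * h \<theta> + s\<^sup>2 / 2 * v \<theta> + \<eta>)" using \<delta>(3)[of n] by simp
    finally show "(\<integral>\<omega>. G s \<kappa> n (\<lambda>k. U k \<omega>) \<partial>M) \<le> exp (s * h \<theta> + s\<^sup>2 / 2 * v \<theta> + \<eta>)" .
  qed
qed

text \<open>Markov's inequality for exp (\<tau> k u / 2), whose mean is at most 2.\<close>

lemma prob_U_gt: "prob {\<omega> \<in> space M. \<kappa> < U k \<omega>} \<le> 2 * exp (- (\<tau> k * \<kappa> / 2))"
proof -
  let ?c = "exp (- (\<tau> k * \<kappa> / 2))"
  have "{\<omega> \<in> space M. \<kappa> < U k \<omega>} = U k -` {\<kappa><..} \<inter> space M" by auto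
  then have "emeasure M {\<omega> \<in> space M. \<kappa> < U k \<omega>} = (\<integral>\<^sup>+u. indicator {\<kappa><..} u \<partial>B (\<tau> k))"
    by (simp add: emeasure_distr flip: distr_U)
  also have "\<dots> \<le> (\<integral>\<^sup>+u. ennreal ?c * ennreal (exp (\<tau> k * u / 2)) \<partial>B (\<tau> k))"
  proof (intro nn_integral_mono)
    fix u
    show "indicator {\<kappa><..} u \<le> ennreal ?c * ennreal (exp (\<tau> k * u / 2))"
    proof (cases "\<kappa> < u")
      case True
      have "1 \<le> ?c * exp (\<tau> k * u / 2)"
        using True tau_pos[of k] by (simp add: exp_add[symmetric])
      then show ?thesis using True by (simp add: ennreal_mult[symmetric] ennreal_1[symmetric] del: ennreal_1)
    qed simp
  qed
  also have "\<dots> \<le> ennreal ?c * 2"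
    using alpha tau_pos by (subst nn_integral_cmult) (auto intro!: mult_left_mono nn_integral_exp_beta_law_le)
  also have "\<dots> = ennreal (2 * ?c)" by (simp add: ennreal_mult mult.commute)
  finally show ?thesis by (simp add: emeasure_eq_measure)
qed

text \<open>A union bound over all sticks. Since \<open>\<tau> k\<close> grows linearly, the tail
  bounds form a geometric series of ratio exp (- z) with z = \<alpha> \<kappa> / 2, and 1 / (1 - exp
  (- z)) \<le> 1 + 1 / z.\<close>

lemma prob_not_bounded_sticks:
  assumes \<kappa>: "0 < \<kappa>"
  shows "prob {\<omega> \<in> space M. \<not> bounded_sticks \<kappa> \<omega>} \<le> 2 * exp (- (\<theta> * \<kappa> / 2)) * (1 + 2 / (\<alpha> * \<kappa>))"
proof -
  let ?z = "\<alpha> * \<kappa> / 2"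
  let ?A = "\<lambda>k. {\<omega> \<in> space M. \<kappa> < U k \<omega>}"
  have z: "0 < ?z" using \<kappa> alpha by simp
  have bound: "prob (?A k) \<le> 2 * exp (- (\<theta> * \<kappa> / 2)) * exp (- ?z) ^ k" for k
  proof -
    have "exp (- (\<tau> k * \<kappa> / 2)) = exp (- (\<theta> * \<kappa> / 2)) * exp (- ?z) ^ k"
      by (simp add: exp_of_nat_mult[symmetric] exp_add[symmetric] algebra_simps add_divide_distrib)
    then show ?thesis using prob_U_gt[of \<kappa> k] by simp
  qed
  have e1: "exp (- ?z) < 1" using z by (subst exp_less_one_iff) simp
  have geo: "(\<lambda>k. 2 * exp (- (\<theta> * \<kappa> / 2)) * exp (- ?z) ^ k) sums (2 * exp (- (\<theta> * \<kappa> / 2)) * (1 / (1 - exp (- ?z))))"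
    using e1 by (intro sums_mult geometric_sums) (simp del: exp_less_one_iff)
  have summ: "summable (\<lambda>k. prob (?A k))"
    by (rule summable_comparison_test'[OF sums_summable[OF geo]]) (use bound in auto)
  have "prob {\<omega> \<in> space M. \<not> bounded_sticks \<kappa> \<omega>} \<le> prob (\<Union>k. ?A k)"
  proof (rule finite_measure_mono_AE)
    show "AE \<omega> in M. \<omega> \<in> {\<omega> \<in> space M. \<not> bounded_sticks \<kappa> \<omega>} \<longrightarrow> \<omega> \<in> (\<Union>k. ?A k)"
      using AE_U by eventually_elim (auto simp: bounded_sticks_def not_le)
  qed measurable
  also have "\<dots> \<le> (\<Sum>k. prob (?A k))"
    by (rule finite_measure_subadditive_countably) (use summ in auto)
  also have "\<dots> \<le> 2 * exp (- (\<theta> * \<kappa> / 2)) * (1 / (1 - exp (- ?z)))"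
    unfolding sums_unique[OF geo] by (intro suminf_le bound summ sums_summable[OF geo])
  also have "1 / (1 - exp (- ?z)) \<le> 1 + 2 / (\<alpha> * \<kappa>)"
  proof -
    have "1 + ?z \<le> exp ?z" by (rule exp_ge_add_one_self)
    then have "exp (- ?z) \<le> 1 / (1 + ?z)" using z by (simp add: exp_minus field_simps)
    then have "1 - exp (- ?z) \<ge> ?z / (1 + ?z)" using z by (simp add: field_simps)
    then have "1 / (1 - exp (- ?z)) \<le> 1 / (?z / (1 + ?z))"
      using z by (intro divide_left_mono mult_pos_pos) auto
    also have "\<dots> = 1 + 2 / (\<alpha> * \<kappa>)" using z \<kappa> alpha by (simp add: field_simps)
    finally show ?thesis .
  qed
  finally show ?thesis by (simp add: mult_left_mono)
qed

end

section \<open>From exponential moments to large deviations\<close>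

context prob_space
begin

text \<open>A two-sided Chernoff bound on the event \<open>A\<close>, with the complement of
  \<open>A\<close> counted separately. Both signs of the tilt occur because \<open>F\<close> may lie
  on either side of 0.\<close>

lemma prob_le_exp_moments:
  fixes Y :: "'a \<Rightarrow> real"
  assumes [measurable]: "Y \<in> borel_measurable M" "Measurable.pred M A" "F \<in> sets borel"
    and F: "\<And>z. z \<in> F \<Longrightarrow> x \<le> \<bar>z\<bar>"
    and l: "0 \<le> l" "0 \<le> b"
    and int: "\<And>l. integrable M (\<lambda>\<omega>. indicator {\<omega>. A \<omega>} \<omega> * exp (l * b * Y \<omega>))"
  shows "prob {\<omega> \<in> space M. Y \<omega> \<in> F} \<le> prob {\<omega> \<in> space M. \<not> A \<omega>} + exp (- (l * b * x)) *
    ((\<integral>\<omega>. indicator {\<omega>. A \<omega>} \<omega> * exp (l * b * Y \<omega>) \<partial>M)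
      + (\<integral>\<omega>. indicator {\<omega>. A \<omega>} \<omega> * exp ((- l) * b * Y \<omega>) \<partial>M))"
proof -
  let ?E = "\<lambda>l \<omega>. indicator {\<omega>. A \<omega>} \<omega> * exp (l * b * Y \<omega>)"
  have ind: "integrable M (indicator {\<omega> \<in> space M. Q \<omega>} :: 'a \<Rightarrow> real)" if "Measurable.pred M Q" for Q
    using that by (intro integrable_real_indicator) (auto simp: less_top[symmetric])
  have "prob {\<omega> \<in> space M. Y \<omega> \<in> F} = (\<integral>\<omega>. indicator {\<omega> \<in> space M. Y \<omega> \<in> F} \<omega> \<partial>M)"
    by simp
  also have "\<dots> \<le> (\<integral>\<omega>. indicator {\<omega> \<in> space M. \<not> A \<omega>} \<omega> + exp (- (l * b * x)) * (?E l \<omega> + ?E (- l) \<omega>) \<partial>M)"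
  proof (rule integral_mono)
    fix \<omega> assume \<omega>: "\<omega> \<in> space M"
    show "indicator {\<omega> \<in> space M. Y \<omega> \<in> F} \<omega> \<le>
        indicator {\<omega> \<in> space M. \<not> A \<omega>} \<omega> + exp (- (l * b * x)) * (?E l \<omega> + ?E (- l) \<omega>)"
    proof (cases "Y \<omega> \<in> F \<and> A \<omega>")
      case True
      then have "x \<le> Y \<omega> \<or> x \<le> - Y \<omega>" using F[of "Y \<omega>"] by auto
      then have "l * b * x \<le> l * b * Y \<omega> \<or> l * b * x \<le> l * b * (- Y \<omega>)"
        using l by (meson mult_left_mono mult_nonneg_nonneg)
      then have "1 \<le> exp (l * b * Y \<omega> - l * b * x) \<or> 1 \<le> exp (- (l * b * Y \<omega>) - l * b * x)"
        by auto
      then have "1 \<le> exp (l * b * Y \<omega> - l * b * x) + exp (- (l * b * Y \<omega>) - l * b * x)"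
        using exp_gt_zero[of "l * b * Y \<omega> - l * b * x"] exp_gt_zero[of "- (l * b * Y \<omega>) - l * b * x"]
        by linarith
      also have "\<dots> = exp (- (l * b * x)) * (?E l \<omega> + ?E (- l) \<omega>)"
        using True by (simp add: distrib_left exp_add[symmetric])
      finally show ?thesis using True \<omega> by simp
    qed (use \<omega> in \<open>auto simp: indicator_def\<close>)
  qed (intro Bochner_Integration.integrable_add integrable_mult_right int integrable_real_indicator; simp add: less_top[symmetric])+
  also have "\<dots> = prob {\<omega> \<in> space M. \<not> A \<omega>} + exp (- (l * b * x)) * ((\<integral>\<omega>. ?E l \<omega> \<partial>M) + (\<integral>\<omega>. ?E (- l) \<omega> \<partial>M))"
    using int[of l] int[of "- l"] ind[of "\<lambda>\<omega>. \<not> A \<omega>"] by simp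
  finally show ?thesis .
qed

text \<open>Exponential tilting without a change of measure. The tilted mass is split into the
  window around \<open>x\<close> and two tails, and shifting the tilt by \<eta> towards a tail
  bounds that tail. If both tail bounds are small, the window must carry most of the mass.\<close>

lemma prob_near_ge_exp_moments:
  fixes Y :: "'a \<Rightarrow> real"
  assumes [measurable]: "Y \<in> borel_measurable M" "Measurable.pred M A"
    and \<eta>: "0 \<le> \<eta>" "0 \<le> b"
    and int: "\<And>l. integrable M (\<lambda>\<omega>. indicator {\<omega>. A \<omega>} \<omega> * exp (l * b * Y \<omega>))"
  shows "(\<integral>\<omega>. indicator {\<omega>. A \<omega>} \<omega> * exp (l * b * Y \<omega>) \<partial>M) \<le>
      exp (b * (l * x + \<bar>l\<bar> * d)) * prob {\<omega> \<in> space M. \<bar>Y \<omega> - x\<bar> < d}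
    + exp (- (b * \<eta> * (x + d))) * (\<integral>\<omega>. indicator {\<omega>. A \<omega>} \<omega> * exp ((l + \<eta>) * b * Y \<omega>) \<partial>M)
    + exp (b * \<eta> * (x - d)) * (\<integral>\<omega>. indicator {\<omega>. A \<omega>} \<omega> * exp ((l - \<eta>) * b * Y \<omega>) \<partial>M)"
proof -
  let ?E = "\<lambda>l \<omega>. indicator {\<omega>. A \<omega>} \<omega> * exp (l * b * Y \<omega>)"
  let ?I = "indicator {\<omega> \<in> space M. \<bar>Y \<omega> - x\<bar> < d} :: 'a \<Rightarrow> real"
  have ind: "integrable M ?I"
    by (intro integrable_real_indicator) (auto simp: less_top[symmetric])
  have "(\<integral>\<omega>. ?E l \<omega> \<partial>M) \<le> (\<integral>\<omega>. exp (b * (l * x + \<bar>l\<bar> * d)) * ?I \<omega>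
      + exp (- (b * \<eta> * (x + d))) * ?E (l + \<eta>) \<omega> + exp (b * \<eta> * (x - d)) * ?E (l - \<eta>) \<omega> \<partial>M)"
  proof (rule integral_mono)
    fix \<omega> assume \<omega>: "\<omega> \<in> space M"
    let ?y = "Y \<omega>"
    consider "\<not> A \<omega>" | "A \<omega>" "\<bar>?y - x\<bar> < d" | "A \<omega>" "x + d \<le> ?y" | "A \<omega>" "?y \<le> x - d"
      by linarith
    then show "?E l \<omega> \<le> exp (b * (l * x + \<bar>l\<bar> * d)) * ?I \<omega>
      + exp (- (b * \<eta> * (x + d))) * ?E (l + \<eta>) \<omega> + exp (b * \<eta> * (x - d)) * ?E (l - \<eta>) \<omega>"
    proof cases
      case 1
      then show ?thesis by simp
    next
      case 2
      have "l * (?y - x) \<le> \<bar>l\<bar> * \<bar>?y - x\<bar>" by (metis abs_ge_self abs_mult)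
      also have "\<dots> \<le> \<bar>l\<bar> * d" using 2 by (intro mult_left_mono) auto
      finally have "b * (l * ?y) \<le> b * (l * x + \<bar>l\<bar> * d)"
        using \<eta> by (intro mult_left_mono) (auto simp: algebra_simps)
      then have "?E l \<omega> \<le> exp (b * (l * x + \<bar>l\<bar> * d)) * ?I \<omega>"
        using 2 \<omega> by (simp add: mult_ac)
      then show ?thesis by (simp add: add_increasing2)
    next
      case 3
      have "b * \<eta> * (x + d) \<le> b * \<eta> * ?y" using 3 \<eta> by (intro mult_left_mono) auto
      then have "l * b * ?y \<le> - (b * \<eta> * (x + d)) + (l + \<eta>) * b * ?y" by (simp add: algebra_simps)
      then have "?E l \<omega> \<le> exp (- (b * \<eta> * (x + d))) * ?E (l + \<eta>) \<omega>"
        using 3 by (simp add: exp_add[symmetric])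
      then show ?thesis by (simp add: add_increasing2 add_increasing)
    next
      case 4
      have "b * \<eta> * ?y \<le> b * \<eta> * (x - d)" using 4 \<eta> by (intro mult_left_mono) auto
      then have "l * b * ?y \<le> b * \<eta> * (x - d) + (l - \<eta>) * b * ?y" by (simp add: algebra_simps)
      then have "?E l \<omega> \<le> exp (b * \<eta> * (x - d)) * ?E (l - \<eta>) \<omega>"
        using 4 by (simp add: exp_add[symmetric])
      then show ?thesis by (simp add: add_increasing)
    qed
  qed (intro Bochner_Integration.integrable_add integrable_mult_right int integrable_real_indicator; simp add: less_top[symmetric])+
  also have "\<dots> = exp (b * (l * x + \<bar>l\<bar> * d)) * prob {\<omega> \<in> space M. \<bar>Y \<omega> - x\<bar> < d}
      + exp (- (b * \<eta> * (x + d))) * (\<integral>\<omega>. ?E (l + \<eta>) \<omega> \<partial>M) + exp (b * \<eta> * (x - d)) * (\<integral>\<omega>. ?E (l - \<eta>) \<omega> \<partial>M)"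
    using int[of "l + \<eta>"] int[of "l - \<eta>"] ind by simp
  finally show ?thesis .
qed

end

lemma scaled_log_ereal_le:
  assumes "p \<le> exp (b * c)" "0 \<le> p" "0 < b"
  shows "ereal (1 / b) * log_ereal p \<le> ereal c"
proof (cases "p = 0")
  case False
  then have "ln p \<le> ln (exp (b * c))" using assms by (subst ln_le_cancel_iff) auto
  then show ?thesis using assms False by (simp add: log_ereal_def field_simps)
qed (use assms in \<open>simp add: log_ereal_def\<close>)

lemma scaled_log_ereal_ge:
  assumes "exp (b * c) \<le> p" "0 < b"
  shows "ereal c \<le> ereal (1 / b) * log_ereal p"
proof -
  have p: "0 < p" using assms(1) exp_gt_zero by (rule less_le_trans[rotated])
  then have "b * c \<le> ln p" using assms by (subst ln_ge_iff) auto
  then show ?thesis using assms p by (simp add: log_ereal_def field_simps)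
qed

text \<open>The Gaussian case of the Gaertner-Ellis theorem on the line, with exponential moments restricted to
  events of overwhelming probability.\<close>

locale Gaussian_exp_moments =
  fixes M :: "real \<Rightarrow> 'w measure" and Y :: "real \<Rightarrow> 'w \<Rightarrow> real"
    and A :: "real \<Rightarrow> 'w \<Rightarrow> bool" and b :: "real \<Rightarrow> real" and s2 :: real
  assumes s2: "0 < s2"
    and prob: "\<forall>\<^sub>F \<theta> in at_top. prob_space (M \<theta>) \<and> Y \<theta> \<in> borel_measurable (M \<theta>) \<and>
      Measurable.pred (M \<theta>) (A \<theta>) \<and>
      (\<forall>l. integrable (M \<theta>) (\<lambda>\<omega>. indicator {\<omega>. A \<theta> \<omega>} \<omega> * exp (l * b \<theta> * Y \<theta> \<omega>)))"
    and b: "filterlim b at_top at_top"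
    and negligible: "\<And>L. \<forall>\<^sub>F \<theta> in at_top. measure (M \<theta>) {\<omega> \<in> space (M \<theta>). \<not> A \<theta> \<omega>} \<le> exp (- L * b \<theta>)"
    and mgf_le: "\<And>l e. 0 < e \<Longrightarrow> \<forall>\<^sub>F \<theta> in at_top.
      (\<integral>\<omega>. indicator {\<omega>. A \<theta> \<omega>} \<omega> * exp (l * b \<theta> * Y \<theta> \<omega>) \<partial>M \<theta>) \<le> exp (b \<theta> * (l\<^sup>2 * s2 / 2 + e))"
    and mgf_ge: "\<And>l e. 0 < e \<Longrightarrow> \<forall>\<^sub>F \<theta> in at_top.
      exp (b \<theta> * (l\<^sup>2 * s2 / 2 - e)) \<le> (\<integral>\<omega>. indicator {\<omega>. A \<theta> \<omega>} \<omega> * exp (l * b \<theta> * Y \<theta> \<omega>) \<partial>M \<theta>)"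
begin

abbreviation rate :: "real \<Rightarrow> real" where "rate z \<equiv> z\<^sup>2 / (2 * s2)"

abbreviation \<mu> :: "real \<Rightarrow> real measure" where "\<mu> \<theta> \<equiv> distr (M \<theta>) borel (Y \<theta>)"

lemma b_ge: "\<forall>\<^sub>F \<theta> in at_top. K \<le> b \<theta>"
  using b by (simp add: filterlim_at_top)

lemma upper_bound:
  assumes F: "F \<in> sets borel" "\<And>z. z \<in> F \<Longrightarrow> x \<le> \<bar>z\<bar>" and x: "0 \<le> x"
  shows "Limsup at_top (\<lambda>\<theta>. ereal (1 / b \<theta>) * log_ereal (measure (\<mu> \<theta>) F)) \<le> ereal (- rate x)"
proof (rule ereal_le_epsilon2)
  fix e :: real assume e: "0 < e"
  \<comment> \<open>The maximiser of l x - l^2 s2 / 2, with maximal value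
    \<open>rate x\<close>.\<close>
  define l where "l = x / s2"
  have l: "0 \<le> l" using x s2 by (simp add: l_def)
  have l_eq: "l\<^sup>2 * s2 / 2 - l * x = - rate x"
    using s2 by (simp add: l_def power2_eq_square field_simps)
  have "Limsup at_top (\<lambda>\<theta>. ereal (1 / b \<theta>) * log_ereal (measure (\<mu> \<theta>) F)) \<le> ereal (- rate x + e)"
  proof (rule Limsup_bounded)
    show "\<forall>\<^sub>F \<theta> in at_top. ereal (1 / b \<theta>) * log_ereal (measure (\<mu> \<theta>) F) \<le> ereal (- rate x + e)"
      \<comment> \<open>Three exponentials arise, from the excluded event and the two tilts; a large
        \<open>b\<close> makes the factor 3 at most exp (b e / 2).\<close>
      using prob b_ge[of 1] b_ge[of "ln 3 / (e / 2)"] negligible[of "rate x"]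
        mgf_le[OF half_gt_zero[OF e], of l] mgf_le[OF half_gt_zero[OF e], of "- l"]
    proof eventually_elim
      case (elim \<theta>)
      interpret prob_space "M \<theta>" using elim by simp
      have [measurable]: "Y \<theta> \<in> borel_measurable (M \<theta>)" "Measurable.pred (M \<theta>) (A \<theta>)" using elim by auto
      have "measure (\<mu> \<theta>) F = prob {\<omega> \<in> space (M \<theta>). Y \<theta> \<omega> \<in> F}"
        using F(1) by (subst measure_distr) (auto intro!: arg_cong[where f = prob])
      also have "\<dots> \<le> prob {\<omega> \<in> space (M \<theta>). \<not> A \<theta> \<omega>} + exp (- (l * b \<theta> * x)) *
          ((\<integral>\<omega>. indicator {\<omega>. A \<theta> \<omega>} \<omega> * exp (l * b \<theta> * Y \<theta> \<omega>) \<partial>M \<theta>)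
          + (\<integral>\<omega>. indicator {\<omega>. A \<theta> \<omega>} \<omega> * exp ((- l) * b \<theta> * Y \<theta> \<omega>) \<partial>M \<theta>))"
        using elim F l by (intro prob_le_exp_moments) auto
      also have "\<dots> \<le> exp (- rate x * b \<theta>) + exp (- (l * b \<theta> * x)) *
          (exp (b \<theta> * (l\<^sup>2 * s2 / 2 + e / 2)) + exp (b \<theta> * ((- l)\<^sup>2 * s2 / 2 + e / 2)))"
        using elim e by (intro add_mono mult_left_mono) auto
      also have "\<dots> = exp (- rate x * b \<theta>) + 2 * exp (b \<theta> * ((l\<^sup>2 * s2 / 2 - l * x) + e / 2))"
        by (simp add: exp_add[symmetric] algebra_simps)
      also have "\<dots> \<le> 3 * exp (b \<theta> * (- rate x + e / 2))"
      proof -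
        have "- rate x * b \<theta> \<le> b \<theta> * (- rate x + e / 2)"
          using elim(2) e by (simp add: algebra_simps)
        then have "exp (- rate x * b \<theta>) \<le> exp (b \<theta> * (- rate x + e / 2))" by simp
        then show ?thesis unfolding l_eq by linarith
      qed
      also have "\<dots> \<le> exp (b \<theta> * (e / 2)) * exp (b \<theta> * (- rate x + e / 2))"
      proof (intro mult_right_mono)
        have "ln 3 \<le> b \<theta> * (e / 2)" using elim(3) e by (simp add: field_simps)
        then have "exp (ln 3) \<le> exp (b \<theta> * (e / 2))" by (subst exp_le_cancel_iff)
        then show "3 \<le> exp (b \<theta> * (e / 2))" by simp
      qed simp
      also have "\<dots> = exp (b \<theta> * (- rate x + e))"
        by (simp add: exp_add[symmetric] algebra_simps)
      finally show ?case using elim(2) by (intro scaled_log_ereal_le) auto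
    qed
  qed
  then show "Limsup at_top (\<lambda>\<theta>. ereal (1 / b \<theta>) * log_ereal (measure (\<mu> \<theta>) F)) \<le> ereal (- rate x) + ereal e"
    by simp
qed

text \<open>Tilting by \<open>x / s2\<close> moves the centre of the Gaussian profile to
  \<open>x\<close>, so the tilted mass concentrates in every window around \<open>x\<close>.
  Removing the tilt inside the window costs \<open>rate x\<close>, up to errors that vanish with the
  window.\<close>

lemma lower_bound:
  assumes G: "open G" "x \<in> G"
  shows "ereal (- rate x) \<le> Liminf at_top (\<lambda>\<theta>. ereal (1 / b \<theta>) * log_ereal (measure (\<mu> \<theta>) G))"
proof (rule ereal_le_epsilon2)
  fix \<epsilon> :: real assume \<epsilon>: "0 < \<epsilon>"
  define l where "l = x / s2"
  obtain r where r: "0 < r" "\<And>y. \<bar>y - x\<bar> < r \<Longrightarrow> y \<in> G"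
    using G by (auto simp: open_dist dist_real_def)
  \<comment> \<open>The loss \<epsilon> is spent in three equal parts: on
    \<open>\<bar>l\<bar> * d\<close>, on \<open>e\<close> and on a factor 2. The added 1 keeps the
    quotient meaningful for \<open>l = 0\<close>.\<close>
  define d where "d = min r (\<epsilon> / (3 * (\<bar>l\<bar> + 1)))"
  have d: "0 < d" "d \<le> r" "\<bar>l\<bar> * d \<le> \<epsilon> / 3"
  proof -
    show "0 < d" "d \<le> r" using r \<epsilon> by (auto simp: d_def)
    have "\<bar>l\<bar> * d \<le> (\<bar>l\<bar> + 1) * (\<epsilon> / (3 * (\<bar>l\<bar> + 1)))"
      using \<open>0 < d\<close> by (intro mult_mono) (auto simp: d_def)
    also have "\<dots> = \<epsilon> / 3" by (simp add: field_simps add_nonneg_eq_0_iff)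
    finally show "\<bar>l\<bar> * d \<le> \<epsilon> / 3" .
  qed
  \<comment> \<open>The maximiser of \<eta> d - \<eta>^2 s2 / 2, so that each tail gains d^2 / (2
    s2) in the exponent.\<close>
  define \<eta> where "\<eta> = d / s2"
  \<comment> \<open>A third of the tail gain covers the error of the tail moment, another that of
    the main moment, and the last makes each tail at most a quarter of the tilted mass.\<close>
  define e where "e = min (\<epsilon> / 3) (d\<^sup>2 / (6 * s2))"
  have e: "0 < e" "e \<le> \<epsilon> / 3" "3 * e \<le> d\<^sup>2 / (2 * s2)"
    using \<epsilon> d s2 by (auto simp: e_def min_def field_simps)
  have \<eta>: "0 \<le> \<eta>" using d s2 by (simp add: \<eta>_def)
  have exponents: "(l + \<eta>)\<^sup>2 * s2 / 2 - \<eta> * (x + d) = l\<^sup>2 * s2 / 2 - d\<^sup>2 / (2 * s2)"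
    "(l - \<eta>)\<^sup>2 * s2 / 2 + \<eta> * (x - d) = l\<^sup>2 * s2 / 2 - d\<^sup>2 / (2 * s2)"
    "l\<^sup>2 * s2 / 2 - l * x = - rate x"
    using s2 by (simp_all add: l_def \<eta>_def power2_eq_square field_simps)
  have "ereal (- rate x - \<epsilon>) \<le> Liminf at_top (\<lambda>\<theta>. ereal (1 / b \<theta>) * log_ereal (measure (\<mu> \<theta>) G))"
  proof (rule Liminf_bounded)
    show "\<forall>\<^sub>F \<theta> in at_top. ereal (- rate x - \<epsilon>) \<le> ereal (1 / b \<theta>) * log_ereal (measure (\<mu> \<theta>) G)"
      using prob b_ge[of 1] b_ge[of "ln 2 / (\<epsilon> / 3)"] b_ge[of "ln 4 / e"]
        mgf_ge[OF e(1), of l] mgf_le[OF e(1), of "l + \<eta>"] mgf_le[OF e(1), of "l - \<eta>"]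
    proof eventually_elim
      case (elim \<theta>)
      interpret prob_space "M \<theta>" using elim by simp
      have [measurable]: "Y \<theta> \<in> borel_measurable (M \<theta>)" "Measurable.pred (M \<theta>) (A \<theta>)" using elim by auto
      define p where "p = prob {\<omega> \<in> space (M \<theta>). \<bar>Y \<theta> \<omega> - x\<bar> < d}"
      define Q where "Q = exp (b \<theta> * (l\<^sup>2 * s2 / 2 - e))"
      have b1: "1 \<le> b \<theta>" by (rule elim)
      have 4: "4 * exp (- (b \<theta> * e)) \<le> 1"
      proof -
        have "ln 4 \<le> b \<theta> * e" using elim(4) e by (simp add: field_simps)
        then have "exp (ln 4) \<le> exp (b \<theta> * e)" by (subst exp_le_cancel_iff)
        then show ?thesis by (simp add: exp_minus field_simps)
      qed
      have tail: "exp (b \<theta> * (l\<^sup>2 * s2 / 2 - d\<^sup>2 / (2 * s2) + e)) \<le> Q / 4"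
      proof -
        have "b \<theta> * (l\<^sup>2 * s2 / 2 - d\<^sup>2 / (2 * s2) + e) \<le> b \<theta> * ((l\<^sup>2 * s2 / 2 - e) + - e)"
          using b1 e by (intro mult_left_mono) auto
        then have "exp (b \<theta> * (l\<^sup>2 * s2 / 2 - d\<^sup>2 / (2 * s2) + e)) \<le> Q * exp (- (b \<theta> * e))"
          unfolding Q_def exp_add[symmetric] by (simp add: algebra_simps)
        also have "\<dots> \<le> Q * (1 / 4)" using 4 by (intro mult_left_mono) (auto simp: Q_def)
        finally show ?thesis by simp
      qed
      have "Q \<le> (\<integral>\<omega>. indicator {\<omega>. A \<theta> \<omega>} \<omega> * exp (l * b \<theta> * Y \<theta> \<omega>) \<partial>M \<theta>)"
        unfolding Q_def by (rule elim)
      also have "\<dots> \<le> exp (b \<theta> * (l * x + \<bar>l\<bar> * d)) * p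
        + exp (- (b \<theta> * \<eta> * (x + d))) * (\<integral>\<omega>. indicator {\<omega>. A \<theta> \<omega>} \<omega> * exp ((l + \<eta>) * b \<theta> * Y \<theta> \<omega>) \<partial>M \<theta>)
        + exp (b \<theta> * \<eta> * (x - d)) * (\<integral>\<omega>. indicator {\<omega>. A \<theta> \<omega>} \<omega> * exp ((l - \<eta>) * b \<theta> * Y \<theta> \<omega>) \<partial>M \<theta>)"
        unfolding p_def using elim \<eta> b1 by (intro prob_near_ge_exp_moments) auto
      also have "\<dots> \<le> exp (b \<theta> * (l * x + \<bar>l\<bar> * d)) * p
        + exp (- (b \<theta> * \<eta> * (x + d))) * exp (b \<theta> * ((l + \<eta>)\<^sup>2 * s2 / 2 + e))
        + exp (b \<theta> * \<eta> * (x - d)) * exp (b \<theta> * ((l - \<eta>)\<^sup>2 * s2 / 2 + e))"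
        using elim by (intro add_mono mult_left_mono) auto
      also have "exp (- (b \<theta> * \<eta> * (x + d))) * exp (b \<theta> * ((l + \<eta>)\<^sup>2 * s2 / 2 + e)) =
          exp (b \<theta> * (((l + \<eta>)\<^sup>2 * s2 / 2 - \<eta> * (x + d)) + e))"
        unfolding exp_add[symmetric] by (intro arg_cong[where f = exp]) (simp add: algebra_simps)
      also have "exp (b \<theta> * \<eta> * (x - d)) * exp (b \<theta> * ((l - \<eta>)\<^sup>2 * s2 / 2 + e)) =
          exp (b \<theta> * (((l - \<eta>)\<^sup>2 * s2 / 2 + \<eta> * (x - d)) + e))"
        unfolding exp_add[symmetric] by (intro arg_cong[where f = exp]) (simp add: algebra_simps)
      finally have "Q / 2 \<le> exp (b \<theta> * (l * x + \<bar>l\<bar> * d)) * p"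
        using tail unfolding exponents by linarith
      then have "exp (- (b \<theta> * (l * x + \<bar>l\<bar> * d))) * (Q / 2) \<le>
          exp (- (b \<theta> * (l * x + \<bar>l\<bar> * d))) * (exp (b \<theta> * (l * x + \<bar>l\<bar> * d)) * p)"
        by (intro mult_left_mono) auto
      also have "\<dots> = p" by (simp add: mult.assoc[symmetric] exp_add[symmetric])
      also have "p \<le> measure (\<mu> \<theta>) G"
        unfolding p_def using r d G(1)
        by (subst measure_distr) (auto intro!: finite_measure_mono)
      finally have p: "exp (- (b \<theta> * (l * x + \<bar>l\<bar> * d))) * (Q / 2) \<le> measure (\<mu> \<theta>) G" .
      have "exp (b \<theta> * (- rate x - \<epsilon>)) \<le> exp (b \<theta> * ((l\<^sup>2 * s2 / 2 - l * x) - \<bar>l\<bar> * d - e) - ln 2)"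
      proof (subst exp_le_cancel_iff)
        have "ln 2 \<le> b \<theta> * (\<epsilon> / 3)" using elim(3) \<epsilon> by (simp add: field_simps)
        moreover have "b \<theta> * (- rate x - \<epsilon>) + b \<theta> * (\<epsilon> / 3) \<le> b \<theta> * (- rate x - \<bar>l\<bar> * d - e)"
          unfolding distrib_left[symmetric] using b1 d e by (intro mult_left_mono) auto
        ultimately show "b \<theta> * (- rate x - \<epsilon>) \<le> b \<theta> * ((l\<^sup>2 * s2 / 2 - l * x) - \<bar>l\<bar> * d - e) - ln 2"
          unfolding exponents by linarith
      qed
      also have "\<dots> = exp (b \<theta> * ((l\<^sup>2 * s2 / 2 - l * x) - \<bar>l\<bar> * d - e)) / 2"
        by (subst exp_diff) simp
      also have "exp (b \<theta> * ((l\<^sup>2 * s2 / 2 - l * x) - \<bar>l\<bar> * d - e)) = exp (- (b \<theta> * (l * x + \<bar>l\<bar> * d))) * Q"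
        unfolding Q_def exp_add[symmetric] by (intro arg_cong[where f = exp]) (simp add: algebra_simps)
      finally have "exp (b \<theta> * (- rate x - \<epsilon>)) \<le> measure (\<mu> \<theta>) G" using p by simp
      then show ?case using b1 by (intro scaled_log_ereal_ge) auto
    qed
  qed
  then have "ereal (- rate x - \<epsilon>) + ereal \<epsilon> \<le> Liminf at_top (\<lambda>\<theta>. ereal (1 / b \<theta>) * log_ereal (measure (\<mu> \<theta>) G)) + ereal \<epsilon>"
    by (rule add_right_mono)
  then show "ereal (- rate x) \<le> Liminf at_top (\<lambda>\<theta>. ereal (1 / b \<theta>) * log_ereal (measure (\<mu> \<theta>) G)) + ereal \<epsilon>"
    by simp
qed

text \<open>The rate increases with the modulus, so a closed set matters only through its distance
  from 0, and this is attained. The two-sided estimate therefore covers unbounded closed sets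
  directly.\<close>

theorem LDP_Gaussian: "LDP \<mu> (\<lambda>\<theta>. 1 / b \<theta>) (\<lambda>z. ereal (rate z))"
  unfolding LDP_def
proof (intro conjI allI impI)
  show "\<forall>\<^sub>F \<theta> in at_top. prob_space (\<mu> \<theta>) \<and> sets (\<mu> \<theta>) = sets borel"
    using prob by eventually_elim (auto intro: prob_space.prob_space_distr)
  show "filterlim (\<lambda>\<theta>. 1 / b \<theta>) (at_right 0) at_top"
    using filterlim_compose[OF filterlim_inverse_at_right_top b] by (simp add: inverse_eq_divide)
  show "rate_function (\<lambda>z. ereal (rate z))"
    unfolding rate_function_def
  proof (intro conjI allI)
    fix c :: ereal
    show "closed {x. ereal (rate x) \<le> c}"
      by (intro closed_Collect_le continuous_intros) (use s2 in auto)
  qed (use s2 in auto)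
next
  fix F :: "real set" assume F: "closed F"
  show "Limsup at_top (\<lambda>\<theta>. ereal (1 / b \<theta>) * log_ereal (measure (\<mu> \<theta>) F)) \<le> - (INF x\<in>F. ereal (rate x))"
  proof (cases "F = {}")
    case True
    have "\<forall>\<^sub>F \<theta> in at_top. ereal (1 / b \<theta>) * log_ereal (measure (\<mu> \<theta>) F) \<le> - \<infinity>"
      using b_ge[of 1] by eventually_elim (simp add: True log_ereal_def)
    then have "Limsup at_top (\<lambda>\<theta>. ereal (1 / b \<theta>) * log_ereal (measure (\<mu> \<theta>) F)) \<le> - \<infinity>"
      by (rule Limsup_bounded)
    then show ?thesis by simp
  next
    case False
    define x where "x = infdist 0 F"
    obtain z where z: "z \<in> F" "infdist 0 F = dist 0 z"
      using infdist_attains_inf[OF F False] by blast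
    have "(INF y\<in>F. ereal (rate y)) \<le> ereal (rate z)" by (rule INF_lower) (rule z)
    also have "ereal (rate z) = ereal (rate x)" using z by (simp add: x_def)
    finally have *: "- ereal (rate x) \<le> - (INF x\<in>F. ereal (rate x))" by (simp only: ereal_minus_le_minus)
    have "Limsup at_top (\<lambda>\<theta>. ereal (1 / b \<theta>) * log_ereal (measure (\<mu> \<theta>) F)) \<le> ereal (- rate x)"
    proof (rule upper_bound)
      show "x \<le> \<bar>y\<bar>" if "y \<in> F" for y using infdist_le[OF that, of 0] by (simp add: x_def)
    qed (use F in \<open>auto simp: x_def infdist_nonneg\<close>)
    also have "\<dots> = - ereal (rate x)" by simp
    also note *
    finally show ?thesis .
  qed
next
  fix G :: "real set" assume G: "open G"
  let ?L = "Liminf at_top (\<lambda>\<theta>. ereal (1 / b \<theta>) * log_ereal (measure (\<mu> \<theta>) G))"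
  have "- ?L \<le> ereal (rate x)" if "x \<in> G" for x
    using ereal_minus_le_minus[THEN iffD2, OF lower_bound[OF G that]] by simp
  then have "- ?L \<le> (INF x\<in>G. ereal (rate x))" by (rule INF_greatest)
  then show "- (INF x\<in>G. ereal (rate x)) \<le> ?L" by (subst ereal_uminus_le_reorder)
qed

end

section \<open>Moderate deviations of the homozygosity\<close>

text \<open>Comparison with the telescoping terms (\<theta>^2 / \<alpha>) (1 / x - 1 / (x +
  \<alpha>)); the induction keeps the remainder as a negative term. The total is of order \<theta>,
  which turns step errors of order a^(-3) into \<theta> / a^3.\<close>

lemma sum_inverse_squares_le:
  fixes \<theta> \<alpha> :: real
  assumes "0 < \<theta>" "0 < \<alpha>"
  shows "(\<Sum>k<n. (\<theta> / (\<theta> + real k * \<alpha>))\<^sup>2) \<le> 1 + \<theta> / \<alpha>"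
proof -
  have pos: "\<theta> + real k * \<alpha> > 0" for k using assms by (intro add_pos_nonneg) auto
  have "(\<Sum>k<Suc n. (\<theta> / (\<theta> + real k * \<alpha>))\<^sup>2) \<le> 1 + \<theta> / \<alpha> - \<theta>\<^sup>2 / (\<alpha> * (\<theta> + real n * \<alpha>))" for n
  proof (induction n)
    case 0
    show ?case using assms by (simp add: power2_eq_square)
  next
    case (Suc n)
    define x where "x = \<theta> + real n * \<alpha>"
    have x: "x > 0" using pos[of n] by (simp add: x_def)
    have x': "\<theta> + real (Suc n) * \<alpha> = x + \<alpha>" by (simp add: x_def algebra_simps)
    have "(\<theta> / (x + \<alpha>))\<^sup>2 = \<theta>\<^sup>2 / ((x + \<alpha>) * (x + \<alpha>))" by (simp add: power_divide power2_eq_square)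
    also have "\<dots> \<le> \<theta>\<^sup>2 / (x * (x + \<alpha>))"
      using x assms by (intro divide_left_mono mult_right_mono mult_pos_pos) auto
    also have "\<dots> = \<theta>\<^sup>2 / \<alpha> * (1 / x - 1 / (x + \<alpha>))"
    proof -
      have "1 / x - 1 / (x + \<alpha>) = \<alpha> / (x * (x + \<alpha>))" using x assms by (simp add: field_simps)
      then show ?thesis using assms by simp
    qed
    also have "\<dots> = \<theta>\<^sup>2 / (\<alpha> * x) - \<theta>\<^sup>2 / (\<alpha> * (x + \<alpha>))"
      by (simp add: right_diff_distrib)
    finally show ?case using Suc.IH unfolding sum.lessThan_Suc[of _ "Suc n"] x' x_def[symmetric] by linarith
  qed
  from this[of n] have "(\<Sum>k<Suc n. (\<theta> / (\<theta> + real k * \<alpha>))\<^sup>2) \<le> 1 + \<theta> / \<alpha>"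
    using pos[of n] assms by (smt (verit) divide_nonneg_pos mult_pos_pos zero_le_power2)
  moreover have "(\<Sum>k<n. (\<theta> / (\<theta> + real k * \<alpha>))\<^sup>2) \<le> (\<Sum>k<Suc n. (\<theta> / (\<theta> + real k * \<alpha>))\<^sup>2)"
    by simp
  ultimately show ?thesis by linarith
qed

context PD_parameters
begin

text \<open>The space and the sticks are quantified inside the eventuality, so the threshold for
  \<theta> depends on the parameters alone. The value of \<open>s\<close> is the tilt
  \<open>l\<close> at scale \<theta> / a^2, rewritten for the homozygosity itself.\<close>

lemma eventually_exp_moment_bounds:
  fixes a :: "real \<Rightarrow> real" and \<epsilon> l :: real
  assumes a: "filterlim a at_top at_top" and \<epsilon>: "0 < \<epsilon>" "\<epsilon> < 1"
  shows "\<exists>c>0. \<forall>\<^sub>F \<theta> in at_top. \<forall>(M :: 'w measure) U. GEM \<alpha> m M U \<theta> \<longrightarrow>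
    (let s = l * \<theta> ^ m / (a \<theta> * C); \<eta> = c * (1 + \<theta> / \<alpha>) / a \<theta> ^ 3; \<kappa> = a \<theta> powr ((1 - \<epsilon>) / (m - 1)) / \<theta>;
      E = (\<integral>\<omega>. indicator {\<omega>. GEM.bounded_sticks U \<kappa> \<omega>} \<omega> * exp (s * homozygosity m (stick_breaking (\<lambda>k. U k \<omega>))) \<partial>M)
    in exp (s * h \<theta> + s\<^sup>2 / 2 * v \<theta> - 2 * \<eta>) \<le> E \<and> E \<le> exp (s * h \<theta> + s\<^sup>2 / 2 * v \<theta> + \<eta>))"
proof -
  define \<beta> where "\<beta> = (1 - \<epsilon>) / real (m - 1)"
  have \<beta>: "0 < \<beta>" "\<beta> * real (m - 1) = 1 - \<epsilon>" using m \<epsilon> by (auto simp: \<beta>_def)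
  \<comment> \<open>With \<beta> N \<ge> 3 the error from above the cutoff is no larger than a^(-3),
    the order of the Taylor error; N \<ge> 2 makes it summable over the sticks.\<close>
  obtain N :: nat where N: "2 \<le> N" "3 \<le> \<beta> * N"
  proof -
    obtain N' :: nat where N': "3 / \<beta> \<le> N'" using real_arch_simple by blast
    have "3 \<le> \<beta> * real N'" using N' \<beta>(1) by (simp add: field_simps)
    also have "\<dots> \<le> \<beta> * real (N' + 2)" using \<beta>(1) by (intro mult_left_mono) auto
    finally show ?thesis by (intro that[of "N' + 2"]) auto
  qed
  obtain T q0 c where T: "1 \<le> T" "0 < q0" "0 < c" and
    *: "\<forall>t p q \<kappa>. T \<le> t \<longrightarrow> 0 < \<kappa> \<longrightarrow> 0 \<le> q \<longrightarrow> q \<le> q0 \<longrightarrow> \<bar>p\<bar> \<le> q * t ^ m \<longrightarrow> q * (t * \<kappa>) ^ (m - 1) \<le> q0 \<longrightarrow>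
      integrable (B t) (\<lambda>u. cutoff \<kappa> u * exp (p * \<Delta>h t u + p\<^sup>2 / 2 * \<Delta>v t u)) \<and>
      \<bar>(\<integral>u. cutoff \<kappa> u * exp (p * \<Delta>h t u + p\<^sup>2 / 2 * \<Delta>v t u) \<partial>B t) - 1\<bar> \<le> c * (q ^ 3 + 1 / (t * \<kappa>) ^ N)"
    using one_step[of N] by (elim exE conjE)
  note one_step = *[rule_format]
  define L where "L = \<bar>l\<bar> / C"
  have L: "0 \<le> L" using C_pos by (simp add: L_def)
  define c' where "c' = c * (L ^ 3 + 1)"
  have c': "0 < c'" using T L by (auto simp: c'_def intro!: mult_pos_pos add_nonneg_pos)
  have a_ge: "\<forall>\<^sub>F \<theta> in at_top. K \<le> a \<theta>" for K using a by (simp add: filterlim_at_top)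
  have ev1: "\<forall>\<^sub>F \<theta> in at_top. L * a \<theta> powr (- \<epsilon>) < q0"
  proof -
    have "((\<lambda>x. L * x powr (- \<epsilon>)) \<longlongrightarrow> 0) at_top" using \<epsilon> by real_asymp
    from filterlim_compose[OF this a] show ?thesis by (rule order_tendstoD) (rule T)
  qed
  have ev2: "\<forall>\<^sub>F \<theta> in at_top. c' / a \<theta> ^ 3 < 1 / 2"
  proof -
    have "((\<lambda>x. c' / x ^ 3) \<longlongrightarrow> 0) at_top" by real_asymp
    from filterlim_compose[OF this a] show ?thesis by (rule order_tendstoD) simp
  qed
  show ?thesis
  proof (intro exI[of _ c'] conjI c')
    show "\<forall>\<^sub>F \<theta> in at_top. \<forall>(M :: 'w measure) U. GEM \<alpha> m M U \<theta> \<longrightarrow>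
      (let s = l * \<theta> ^ m / (a \<theta> * C); \<eta> = c' * (1 + \<theta> / \<alpha>) / a \<theta> ^ 3; \<kappa> = a \<theta> powr ((1 - \<epsilon>) / (m - 1)) / \<theta>;
      E = (\<integral>\<omega>. indicator {\<omega>. GEM.bounded_sticks U \<kappa> \<omega>} \<omega> * exp (s * homozygosity m (stick_breaking (\<lambda>k. U k \<omega>))) \<partial>M)
      in exp (s * h \<theta> + s\<^sup>2 / 2 * v \<theta> - 2 * \<eta>) \<le> E \<and> E \<le> exp (s * h \<theta> + s\<^sup>2 / 2 * v \<theta> + \<eta>))"
      using ev1 ev2 eventually_ge_at_top[of T] a_ge[of 1]
    proof (eventually_elim, intro allI impI)
      fix \<theta> :: real and M :: "'w measure" and U :: "nat \<Rightarrow> 'w \<Rightarrow> real"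
      assume q0: "L * a \<theta> powr (- \<epsilon>) < q0" and half: "c' / a \<theta> ^ 3 < 1 / 2" and \<theta>: "T \<le> \<theta>" and a1: "1 \<le> a \<theta>"
        and gem: "GEM \<alpha> m M U \<theta>"
      interpret GEM \<alpha> m M U \<theta> by (rule gem)
      define s where "s = l * \<theta> ^ m / (a \<theta> * C)"
      define K where "K = a \<theta> powr \<beta>"
      define \<kappa> where "\<kappa> = K / \<theta>"
      define \<delta> where "\<delta> k = c' / a \<theta> ^ 3 * (\<theta> / \<tau> k)\<^sup>2" for k
      have a0: "0 < a \<theta>" using a1 by simp
      have \<theta>0: "0 < \<theta>" "1 \<le> \<theta>" using \<theta> T by auto
      have K1: "1 \<le> K" using a1 \<beta> by (simp add: K_def ge_one_powr_ge_zero)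
      have \<kappa>: "0 < \<kappa>" using K1 \<theta>0 by (simp add: \<kappa>_def)
      have K_pow: "K ^ (m - 1) = a \<theta> powr (1 - \<epsilon>)"
        unfolding K_def using a0 \<beta> by (simp add: powr_realpow[symmetric] powr_powr)
      have K_N: "a \<theta> ^ 3 \<le> K ^ N"
      proof -
        have "a \<theta> ^ 3 = a \<theta> powr 3" using a0 by simp
        also have "\<dots> \<le> a \<theta> powr (\<beta> * N)" using a1 N by (intro powr_mono) auto
        also have "\<dots> = K ^ N" unfolding K_def using a0 by (subst powr_realpow[symmetric]) (auto simp: powr_powr)
        finally show ?thesis .
      qed
      have step: "integrable (B (\<tau> k)) (\<lambda>u. cutoff \<kappa> u * exp (p * \<Delta>h (\<tau> k) u + p\<^sup>2 / 2 * \<Delta>v (\<tau> k) u)) \<and>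
        \<bar>(\<integral>u. cutoff \<kappa> u * exp (p * \<Delta>h (\<tau> k) u + p\<^sup>2 / 2 * \<Delta>v (\<tau> k) u) \<partial>B (\<tau> k)) - 1\<bar> \<le> \<delta> k"
        if p: "\<bar>p\<bar> \<le> \<bar>s\<bar>" for k p
      proof -
        define r where "r = \<theta> / \<tau> k"
        have \<tau>: "\<theta> \<le> \<tau> k" using alpha by simp
        have r: "0 < r" "r \<le> 1" using \<tau> \<theta>0 by (auto simp: r_def)
        have r\<tau>: "r * \<tau> k = \<theta>" using \<tau> \<theta>0 by (simp add: r_def)
        \<comment> \<open>Chosen so that \<open>q * \<tau> k ^ m\<close> equals
          \<open>\<bar>s\<bar>\<close>, the largest possible effective tilt.\<close>
        define q where "q = L / a \<theta> * r ^ m"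
        have q_nonneg: "0 \<le> q" using L a0 r by (simp add: q_def)
        have rm: "r ^ m = r * r ^ (m - 1)" using m by (simp add: power_eq_if)
        have La: "L / a \<theta> \<le> q0"
        proof -
          have "a \<theta> powr (- 1) \<le> a \<theta> powr (- \<epsilon>)" using a1 \<epsilon> by (intro powr_mono) auto
          then have "L * (1 / a \<theta>) \<le> L * a \<theta> powr (- \<epsilon>)"
            using L a0 by (intro mult_left_mono) (auto simp: powr_minus_divide)
          then show ?thesis using q0 by simp
        qed
        have "q \<le> L / a \<theta> * 1" unfolding q_def using L a0 r by (intro mult_left_mono power_le_one) auto
        then have q1: "q \<le> q0" using La by simp
        have "\<bar>s\<bar> = L / a \<theta> * (r * \<tau> k) ^ m"
          using C_pos a0 \<theta>0 unfolding r\<tau> by (simp add: s_def L_def abs_mult)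
        then have p': "\<bar>p\<bar> \<le> q * \<tau> k ^ m" using p by (simp add: q_def power_mult_distrib)
        have r\<tau>\<kappa>: "r * (\<tau> k * \<kappa>) = K" using r\<tau> \<theta>0 by (simp add: \<kappa>_def mult.assoc[symmetric])
        \<comment> \<open>The exponent of \<open>a\<close> in the cutoff is calibrated here: the
          product becomes L a^(-\<epsilon>) r, and the positive \<epsilon> brings it below
          \<open>q0\<close>.\<close>
        have "q * (\<tau> k * \<kappa>) ^ (m - 1) = L / a \<theta> * r * (r * (\<tau> k * \<kappa>)) ^ (m - 1)"
          by (simp add: q_def rm power_mult_distrib)
        also have "\<dots> = L * (a \<theta> powr (1 - \<epsilon>) / a \<theta>) * r" unfolding r\<tau>\<kappa> K_pow by simp
        also have "a \<theta> powr (1 - \<epsilon>) / a \<theta> = a \<theta> powr (- \<epsilon>)"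
          using a0 by (simp add: powr_diff powr_minus_divide)
        also have "L * a \<theta> powr (- \<epsilon>) * r \<le> L * a \<theta> powr (- \<epsilon>) * 1" using r L by (intro mult_left_mono) auto
        finally have q2: "q * (\<tau> k * \<kappa>) ^ (m - 1) \<le> q0" using q0 by simp
        \<comment> \<open>Both errors carry at least the second power of r = \<theta> / \<tau> k,
          which keeps their sum over \<open>k\<close> of order \<theta>.\<close>
        have "c * (q ^ 3 + 1 / (\<tau> k * \<kappa>) ^ N) \<le> c * (L ^ 3 / a \<theta> ^ 3 * r\<^sup>2 + 1 / a \<theta> ^ 3 * r\<^sup>2)"
        proof (intro mult_left_mono add_mono)
          have "q ^ 3 = L ^ 3 / a \<theta> ^ 3 * r ^ (m * 3)" by (simp add: q_def power_mult_distrib power_divide power_mult)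
          also have "\<dots> \<le> L ^ 3 / a \<theta> ^ 3 * r ^ 2"
            using L a0 r m by (intro mult_left_mono power_decreasing) auto
          finally show "q ^ 3 \<le> L ^ 3 / a \<theta> ^ 3 * r\<^sup>2" .
          have "1 / (\<tau> k * \<kappa>) ^ N = r ^ N / K ^ N"
            using r unfolding r\<tau>\<kappa>[symmetric] by (simp add: power_mult_distrib)
          also have "\<dots> \<le> r ^ 2 / a \<theta> ^ 3"
            using r N K_N a0 by (intro frac_le power_decreasing) auto
          finally show "1 / (\<tau> k * \<kappa>) ^ N \<le> 1 / a \<theta> ^ 3 * r\<^sup>2" by simp
        qed (use T in auto)
        also have "\<dots> = \<delta> k" by (simp add: \<delta>_def c'_def r_def algebra_simps add_divide_distrib)
        finally have "c * (q ^ 3 + 1 / (\<tau> k * \<kappa>) ^ N) \<le> \<delta> k" .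
        moreover have "T \<le> \<tau> k" using \<theta> \<tau> by simp
        ultimately show ?thesis
          using one_step[OF _ \<kappa> q_nonneg q1 p' q2] by (meson order.trans)
      qed
      have \<delta>: "0 \<le> \<delta> k" "\<delta> k \<le> 1 / 2" for k
      proof -
        show "0 \<le> \<delta> k" using c' a0 by (simp add: \<delta>_def)
        have "\<theta> / \<tau> k \<le> 1" "0 \<le> \<theta> / \<tau> k" using \<theta>0 alpha tau_pos[of k] by auto
        then have "\<delta> k \<le> c' / a \<theta> ^ 3 * 1"
          unfolding \<delta>_def using c' a0 by (intro mult_left_mono power_le_one) auto
        then show "\<delta> k \<le> 1 / 2" using half by linarith
      qed
      have sum: "(\<Sum>k<n. \<delta> k) \<le> c' * (1 + \<theta> / \<alpha>) / a \<theta> ^ 3" for n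
      proof -
        have "(\<Sum>k<n. \<delta> k) = c' / a \<theta> ^ 3 * (\<Sum>k<n. (\<theta> / \<tau> k)\<^sup>2)" by (simp add: \<delta>_def sum_distrib_left)
        also have "\<dots> \<le> c' / a \<theta> ^ 3 * (1 + \<theta> / \<alpha>)"
          using c' a0 \<theta>0 alpha by (intro mult_left_mono sum_inverse_squares_le) auto
        finally show ?thesis by simp
      qed
      have "exp (s * h \<theta> + s\<^sup>2 / 2 * v \<theta> - 2 * (c' * (1 + \<theta> / \<alpha>) / a \<theta> ^ 3))
        \<le> (\<integral>\<omega>. indicator {\<omega>. bounded_sticks \<kappa> \<omega>} \<omega> * exp (s * H \<omega>) \<partial>M)"
        by (rule exp_moment_bounds(1)[of s \<kappa> \<delta>, OF step \<delta> sum])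
      moreover have "(\<integral>\<omega>. indicator {\<omega>. bounded_sticks \<kappa> \<omega>} \<omega> * exp (s * H \<omega>) \<partial>M)
        \<le> exp (s * h \<theta> + s\<^sup>2 / 2 * v \<theta> + c' * (1 + \<theta> / \<alpha>) / a \<theta> ^ 3)"
        by (rule exp_moment_bounds(2)[of s \<kappa> \<delta>, OF step \<delta> sum])
      ultimately show "let s = l * \<theta> ^ m / (a \<theta> * C); \<eta> = c' * (1 + \<theta> / \<alpha>) / a \<theta> ^ 3; \<kappa> = a \<theta> powr ((1 - \<epsilon>) / (m - 1)) / \<theta>;
        E = (\<integral>\<omega>. indicator {\<omega>. bounded_sticks \<kappa> \<omega>} \<omega> * exp (s * H \<omega>) \<partial>M)
        in exp (s * h \<theta> + s\<^sup>2 / 2 * v \<theta> - 2 * \<eta>) \<le> E \<and> E \<le> exp (s * h \<theta> + s\<^sup>2 / 2 * v \<theta> + \<eta>)"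
        unfolding Let_def s_def \<kappa>_def K_def \<beta>_def by blast
    qed
  qed
qed

text \<open>The lower bound on \<open>a\<close> enters only here: it makes sticks longer than \<open>a powr ((1 - \<epsilon>) / (m - 1)) / \<theta>\<close>
  negligible on the exponential scale \<open>\<theta> / a\<^sup>2\<close>.\<close>

lemma eventually_long_sticks_negligible:
  fixes a :: "real \<Rightarrow> real" and \<epsilon> L :: real
  assumes a: "filterlim a at_top at_top" and \<epsilon>: "0 < \<epsilon>" "\<epsilon> < 1"
    and a_lower: "Liminf at_top (\<lambda>\<theta>. ereal (a \<theta> powr (1 - \<epsilon>) / \<theta> powr ((real m - 1) / (2 * real m - 1)))) > 0"
  shows "\<forall>\<^sub>F \<theta> in at_top. \<forall>(M :: 'w measure) U. GEM \<alpha> m M U \<theta> \<longrightarrow>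
    measure M {\<omega> \<in> space M. \<not> GEM.bounded_sticks U (a \<theta> powr ((1 - \<epsilon>) / (m - 1)) / \<theta>) \<omega>} \<le> exp (- L * (\<theta> / (a \<theta>)\<^sup>2))"
proof -
  define \<beta> where "\<beta> = (1 - \<epsilon>) / real (m - 1)"
  have m': "real (m - 1) = real m - 1" "real m - 1 > 0" using m by (auto simp: of_nat_diff)
  have \<beta>: "0 < \<beta>" using m \<epsilon> by (auto simp: \<beta>_def)
  \<comment> \<open>Taking the root of order m - 1 in the lower bound on \<open>a\<close> gives
    a^\<beta> \<ge> c1 \<theta>^\<gamma>, a bound on the cutoff measured in units of 1 /
    \<theta>.\<close>
  define \<gamma> where "\<gamma> = 1 / (2 * real m - 1)"
  have \<gamma>: "0 < \<gamma>" using m by (simp add: \<gamma>_def)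
  obtain c0 :: real where c0: "0 < c0"
    "\<forall>\<^sub>F \<theta> in at_top. c0 < a \<theta> powr (1 - \<epsilon>) / \<theta> powr ((real m - 1) / (2 * real m - 1))"
  proof -
    obtain c0 :: real where c0: "0 < ereal c0" "ereal c0 < Liminf at_top (\<lambda>\<theta>. ereal (a \<theta> powr (1 - \<epsilon>) / \<theta> powr ((real m - 1) / (2 * real m - 1))))"
      using ereal_dense2[OF a_lower] by auto
    have "\<forall>\<^sub>F \<theta> in at_top. ereal c0 < ereal (a \<theta> powr (1 - \<epsilon>) / \<theta> powr ((real m - 1) / (2 * real m - 1)))"
      by (rule less_LiminfD) (rule c0)
    then show ?thesis using c0 that[of c0] by simp
  qed
  define c1 where "c1 = c0 powr (1 / (real m - 1))"
  have c1: "0 < c1" using c0 by (simp add: c1_def)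
  have a_ge: "\<forall>\<^sub>F \<theta> in at_top. K \<le> a \<theta>" for K using a by (simp add: filterlim_at_top)
  have ev1: "\<forall>\<^sub>F \<theta> in at_top. 4 * \<bar>L\<bar> / (c1 powr (1 / \<gamma>)) \<le> a \<theta> powr (2 * \<epsilon>)"
  proof -
    have "filterlim (\<lambda>x::real. x powr (2 * \<epsilon>)) at_top at_top" using \<epsilon> by real_asymp
    from filterlim_compose[OF this a] show ?thesis by (simp add: filterlim_at_top)
  qed
  have ev2: "\<forall>\<^sub>F \<theta> in at_top. 2 * (1 + 2 * \<theta> / \<alpha>) \<le> exp (c1 * \<theta> powr \<gamma> / 4)"
    using c1 \<gamma> alpha by real_asymp
  show ?thesis
    using c0(2) ev1 ev2 eventually_ge_at_top[of 1] a_ge[of 1]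
  proof (eventually_elim, intro allI impI)
    fix \<theta> :: real and M :: "'w measure" and U :: "nat \<Rightarrow> 'w \<Rightarrow> real"
    assume low: "c0 < a \<theta> powr (1 - \<epsilon>) / \<theta> powr ((real m - 1) / (2 * real m - 1))"
      and L: "4 * \<bar>L\<bar> / (c1 powr (1 / \<gamma>)) \<le> a \<theta> powr (2 * \<epsilon>)"
      and e: "2 * (1 + 2 * \<theta> / \<alpha>) \<le> exp (c1 * \<theta> powr \<gamma> / 4)"
      and \<theta>: "1 \<le> \<theta>" and a1: "1 \<le> a \<theta>" and gem: "GEM \<alpha> m M U \<theta>"
    interpret GEM \<alpha> m M U \<theta> by (rule gem)
    define K where "K = a \<theta> powr \<beta>"
    have K1: "1 \<le> K" using a1 \<beta> by (simp add: K_def ge_one_powr_ge_zero)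
    have a0: "0 < a \<theta>" using a1 by simp
    have K\<gamma>: "c1 * \<theta> powr \<gamma> \<le> K"
    proof -
      have "c0 * \<theta> powr ((real m - 1) / (2 * real m - 1)) \<le> a \<theta> powr (1 - \<epsilon>)"
        using low \<theta> by (simp add: field_simps)
      then have "(c0 * \<theta> powr ((real m - 1) / (2 * real m - 1))) powr (1 / (real m - 1)) \<le> (a \<theta> powr (1 - \<epsilon>)) powr (1 / (real m - 1))"
        using c0 m' by (intro powr_mono2) auto
      moreover have "(real m - 1) / (2 * real m - 1) * (1 / (real m - 1)) = \<gamma>" using m' by (simp add: \<gamma>_def)
      moreover have "(1 - \<epsilon>) * (1 / (real m - 1)) = \<beta>" using m' by (simp add: \<beta>_def)
      ultimately show ?thesis using c0 \<theta>
        by (simp add: powr_mult powr_powr c1_def K_def del: times_divide_eq_right times_divide_eq_left)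
    qed
    have LK: "L * (\<theta> / (a \<theta>)\<^sup>2) \<le> K / 4"
    proof -
      \<comment> \<open>Since 1 / \<gamma> - 1 = 2 (m - 1), the power 1 / \<gamma> of K is K a^(2 -
        2 \<epsilon>). Hence \<theta> / a^2 is at most K times a multiple of a^(-2 \<epsilon>),
        which beats any constant \<open>L\<close>.\<close>
      have "(c1 * \<theta> powr \<gamma>) powr (1 / \<gamma>) \<le> K powr (1 / \<gamma>)"
        using K\<gamma> c1 \<gamma> by (intro powr_mono2) auto
      then have "c1 powr (1 / \<gamma>) * \<theta> \<le> K powr (1 / \<gamma>)"
        using c1 \<theta> \<gamma> by (simp add: powr_mult powr_powr)
      also have "K powr (1 / \<gamma>) = K * K powr (1 / \<gamma> - 1)"
        using K1 by (simp add: powr_diff)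
      also have "K powr (1 / \<gamma> - 1) = a \<theta> powr (2 * (1 - \<epsilon>))"
      proof -
        have "\<beta> * (1 / \<gamma> - 1) = 2 * (1 - \<epsilon>)" using m' by (simp add: \<beta>_def \<gamma>_def field_simps)
        then show ?thesis by (simp add: K_def powr_powr)
      qed
      also have "a \<theta> powr (2 * (1 - \<epsilon>)) = (a \<theta>)\<^sup>2 / a \<theta> powr (2 * \<epsilon>)"
        using a0 by (simp add: right_diff_distrib powr_diff)
      finally have 1: "c1 powr (1 / \<gamma>) * a \<theta> powr (2 * \<epsilon>) * (\<theta> / (a \<theta>)\<^sup>2) \<le> K"
        using a0 by (simp add: field_simps)
      have "4 * \<bar>L\<bar> \<le> c1 powr (1 / \<gamma>) * a \<theta> powr (2 * \<epsilon>)"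
        using L c1 by (simp add: field_simps)
      then have "4 * \<bar>L\<bar> * (\<theta> / (a \<theta>)\<^sup>2) \<le> c1 powr (1 / \<gamma>) * a \<theta> powr (2 * \<epsilon>) * (\<theta> / (a \<theta>)\<^sup>2)"
        using \<theta> by (intro mult_right_mono) auto
      moreover have "L * (\<theta> / (a \<theta>)\<^sup>2) \<le> \<bar>L\<bar> * (\<theta> / (a \<theta>)\<^sup>2)" using \<theta> by (intro mult_right_mono) auto
      ultimately show ?thesis using 1 by linarith
    qed
    have "prob {\<omega> \<in> space M. \<not> bounded_sticks (K / \<theta>) \<omega>} \<le> 2 * exp (- (\<theta> * (K / \<theta>) / 2)) * (1 + 2 / (\<alpha> * (K / \<theta>)))"
      using K1 \<theta> by (intro prob_not_bounded_sticks) auto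
    also have "\<dots> = exp (- (K / 2)) * (2 * (1 + 2 * \<theta> / (\<alpha> * K)))" using \<theta> by simp
    \<comment> \<open>Half of the decay is given up for the prefactor, which grows at most linearly
      in \<theta>, while \<open>K\<close> grows at least like a power of \<theta>.\<close>
    also have "\<dots> \<le> exp (- (K / 2)) * exp (K / 4)"
    proof (intro mult_left_mono)
      have "2 * \<theta> / (\<alpha> * K) \<le> 2 * \<theta> / (\<alpha> * 1)"
        using K1 \<theta> alpha by (intro divide_left_mono mult_left_mono mult_pos_pos) auto
      then have "2 * (1 + 2 * \<theta> / (\<alpha> * K)) \<le> exp (c1 * \<theta> powr \<gamma> / 4)" using e by simp
      also have "\<dots> \<le> exp (K / 4)" using K\<gamma> by simp
      finally show "2 * (1 + 2 * \<theta> / (\<alpha> * K)) \<le> exp (K / 4)" .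
    qed simp
    also have "\<dots> = exp (- (K / 4))" by (simp add: exp_add[symmetric])
    also have "\<dots> \<le> exp (- L * (\<theta> / (a \<theta>)\<^sup>2))" using LK by simp
    finally show "prob {\<omega> \<in> space M. \<not> bounded_sticks (a \<theta> powr ((1 - \<epsilon>) / (m - 1)) / \<theta>) \<omega>} \<le> exp (- L * (\<theta> / (a \<theta>)\<^sup>2))"
      unfolding K_def \<beta>_def .
  qed
qed

text \<open>The centring error is of order a / \<theta>, the product of a / sqrt \<theta> and 1 /
  sqrt \<theta>, and vanishes. So the first-order term disappears and the limit comes from the
  variance alone.\<close>

lemma exponent_tendsto:
  fixes a :: "real \<Rightarrow> real" and l :: real
  assumes a: "filterlim a at_top at_top" and a_sqrt: "((\<lambda>\<theta>. a \<theta> / sqrt \<theta>) \<longlongrightarrow> 0) at_top"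
  shows "((\<lambda>\<theta>. l * (a \<theta> * (\<theta> ^ (m - 1) * h \<theta> / C - 1)) + l\<^sup>2 / 2 * (\<theta> ^ (2 * m - 1) * v \<theta> / C\<^sup>2))
    \<longlongrightarrow> l\<^sup>2 * sigma_sq \<alpha> m / 2) at_top"
proof -
  obtain R where R: "((\<lambda>t::real. t * (1 - t ^ (m - 1) / pochhammer (t + 1) (m - 1))) \<longlongrightarrow> R) at_top"
    using tendsto_power_div_pochhammer_rate by blast
  have "((\<lambda>t::real. 1 / sqrt t) \<longlongrightarrow> 0) at_top" by real_asymp
  from tendsto_mult[OF tendsto_mult[OF a_sqrt this] R]
  have "((\<lambda>\<theta>. a \<theta> / sqrt \<theta> * (1 / sqrt \<theta>) * (\<theta> * (1 - \<theta> ^ (m - 1) / pochhammer (\<theta> + 1) (m - 1)))) \<longlongrightarrow> 0) at_top"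
    by simp
  then have "((\<lambda>\<theta>. - (a \<theta> * (\<theta> ^ (m - 1) * h \<theta> / C - 1))) \<longlongrightarrow> 0) at_top"
  proof (rule Lim_transform_eventually)
    show "\<forall>\<^sub>F \<theta> in at_top. a \<theta> / sqrt \<theta> * (1 / sqrt \<theta>) * (\<theta> * (1 - \<theta> ^ (m - 1) / pochhammer (\<theta> + 1) (m - 1)))
      = - (a \<theta> * (\<theta> ^ (m - 1) * h \<theta> / C - 1))"
      using eventually_gt_at_top[of 0]
    proof eventually_elim
      case (elim \<theta>)
      have "a \<theta> / sqrt \<theta> * (1 / sqrt \<theta>) = a \<theta> / \<theta>" using elim by simp
      then show ?case using elim C_pos by (simp add: h_def algebra_simps)
    qed
  qed
  from tendsto_minus[OF this] have 1: "((\<lambda>\<theta>. a \<theta> * (\<theta> ^ (m - 1) * h \<theta> / C - 1)) \<longlongrightarrow> 0) at_top"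
    by simp
  have "((\<lambda>\<theta>. l * (a \<theta> * (\<theta> ^ (m - 1) * h \<theta> / C - 1)) + l\<^sup>2 / 2 * (\<theta> ^ (2 * m - 1) * v \<theta> / C\<^sup>2))
    \<longlongrightarrow> l * 0 + l\<^sup>2 / 2 * (C\<^sup>2 * sigma_sq \<alpha> m / C\<^sup>2)) at_top"
    using C_pos by (intro tendsto_add tendsto_mult[OF tendsto_const 1] tendsto_mult[OF tendsto_const] tendsto_divide tendsto_v tendsto_const) auto
  then show ?thesis using C_pos by simp
qed

end

theorem theorem4p3:
  fixes \<alpha> \<epsilon> :: real and m :: nat and a :: "real \<Rightarrow> real"
    and M :: "real \<Rightarrow> 'w measure"
    and U P :: "real \<Rightarrow> nat \<Rightarrow> 'w \<Rightarrow> real"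
  assumes alpha: "0 < \<alpha>" "\<alpha> < 1"
    and m: "2 \<le> m"
    and prob: "\<And>\<theta>. 0 < \<theta> \<Longrightarrow> prob_space (M \<theta>)"
    and indep: "\<And>\<theta>. 0 < \<theta> \<Longrightarrow> prob_space.indep_vars (M \<theta>) (\<lambda>_. borel) (U \<theta>) UNIV"
    and U_beta: "\<And>\<theta> k. 0 < \<theta> \<Longrightarrow>
      distributed (M \<theta>) lborel (U \<theta> k) (beta_density (1 - \<alpha>) (\<theta> + real (k + 1) * \<alpha>))"
    and P_meas: "\<And>\<theta> i. 0 < \<theta> \<Longrightarrow> P \<theta> i \<in> borel_measurable (M \<theta>)"
    and P_ranked: "\<And>\<theta>. 0 < \<theta> \<Longrightarrow> AE \<omega> in M \<theta>.
      descending_rearrangement (stick_breaking (\<lambda>k. U \<theta> k \<omega>)) (\<lambda>i. P \<theta> i \<omega>)"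
    and a_infty: "filterlim a at_top at_top"
    and a_sqrt: "((\<lambda>\<theta>. a \<theta> / sqrt \<theta>) \<longlongrightarrow> 0) at_top"
    and eps: "0 < \<epsilon>" "\<epsilon> < 1 / (2 * real m - 1)"
    and a_lower: "Liminf at_top
      (\<lambda>\<theta>. ereal (a \<theta> powr (1 - \<epsilon>) / \<theta> powr ((real m - 1) / (2 * real m - 1)))) > 0"
  shows "LDP
      (\<lambda>\<theta>. distr (M \<theta>) borel (\<lambda>\<omega>.
         a \<theta> * (\<theta> ^ (m - 1) * Gamma (1 - \<alpha>) / Gamma (real m - \<alpha>)
                  * homozygosity m (\<lambda>i. P \<theta> i \<omega>) - 1)))
      (\<lambda>\<theta>. (a \<theta>)\<^sup>2 / \<theta>)
      (\<lambda>z. ereal (z\<^sup>2 / (2 * sigma_sq \<alpha> m)))"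
proof -
  interpret PD_parameters \<alpha> m by unfold_locales (use alpha m in auto)
  have \<epsilon>: "0 < \<epsilon>" "\<epsilon> < 1"
  proof -
    have "1 / (2 * real m - 1) \<le> 1" using m by simp
    then show "0 < \<epsilon>" "\<epsilon> < 1" using eps by auto
  qed
  have GEM: "GEM \<alpha> m (M \<theta>) (U \<theta>) \<theta>" if "0 < \<theta>" for \<theta>
    using that prob indep U_beta PD_parameters_axioms
    by (intro GEM.intro GEM_axioms.intro) auto
  define b where "b \<theta> = \<theta> / (a \<theta>)\<^sup>2" for \<theta>
  define \<kappa> where "\<kappa> \<theta> = a \<theta> powr ((1 - \<epsilon>) / real (m - 1)) / \<theta>" for \<theta>
  define A where "A \<theta> = GEM.bounded_sticks (U \<theta>) (\<kappa> \<theta>)" for \<theta>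
  define Y where "Y \<theta> \<omega> = a \<theta> * (\<theta> ^ (m - 1) * Gamma (1 - \<alpha>) / Gamma (real m - \<alpha>)
                  * homozygosity m (\<lambda>i. P \<theta> i \<omega>) - 1)" for \<theta> \<omega>
  define H where "H \<theta> \<omega> = homozygosity m (stick_breaking (\<lambda>k. U \<theta> k \<omega>))" for \<theta> \<omega>
  define X where "X l \<theta> = l * (a \<theta> * (\<theta> ^ (m - 1) * h \<theta> / C - 1)) + l\<^sup>2 / 2 * (\<theta> ^ (2 * m - 1) * v \<theta> / C\<^sup>2)" for l \<theta>
  have a_ge: "\<forall>\<^sub>F \<theta> in at_top. K \<le> a \<theta>" for K using a_infty by (simp add: filterlim_at_top)
  \<comment> \<open>Replaces the ranked sequence by the sticks in order of breaking; the equality is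
    almost sure, as the ranking and the range of the \<open>U\<close> are.\<close>
  have Y_eq: "AE \<omega> in M \<theta>. Y \<theta> \<omega> = a \<theta> * (\<theta> ^ (m - 1) * H \<theta> \<omega> / C - 1)" and H_bounds: "AE \<omega> in M \<theta>. 0 \<le> H \<theta> \<omega> \<and> H \<theta> \<omega> \<le> 1"
    if "0 < \<theta>" for \<theta>
  proof -
    interpret G: GEM \<alpha> m "M \<theta>" "U \<theta>" \<theta> by (rule GEM) fact
    show "AE \<omega> in M \<theta>. 0 \<le> H \<theta> \<omega> \<and> H \<theta> \<omega> \<le> 1" unfolding H_def by (rule G.AE_H_bounds)
    show "AE \<omega> in M \<theta>. Y \<theta> \<omega> = a \<theta> * (\<theta> ^ (m - 1) * H \<theta> \<omega> / C - 1)"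
      using P_ranked[OF that] G.AE_U
    proof eventually_elim
      case (elim \<omega>)
      have x: "0 \<le> U \<theta> k \<omega> \<and> U \<theta> k \<omega> \<le> 1" for k using elim(2) by (auto simp: less_imp_le)
      have "homozygosity m (\<lambda>i. P \<theta> i \<omega>) = H \<theta> \<omega>"
        unfolding H_def using elim(1) m
        by (intro homozygosity_rearrangement stick_breaking_nonneg summable_stick_breaking_power x) auto
      moreover have "\<theta> ^ (m - 1) * Gamma (1 - \<alpha>) / Gamma (real m - \<alpha>) = \<theta> ^ (m - 1) / C"
        unfolding times_divide_eq_right[symmetric] Gamma_C by simp
      ultimately show ?case by (simp only: Y_def times_divide_eq_left)
    qed
  qed
  have Y_meas: "Y \<theta> \<in> borel_measurable (M \<theta>)" if "0 < \<theta>" for \<theta>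
  proof -
    note [measurable] = P_meas[OF that]
    show ?thesis unfolding Y_def[abs_def] homozygosity_def by measurable
  qed
  have A_meas: "Measurable.pred (M \<theta>) (A \<theta>)" if "0 < \<theta>" for \<theta>
    unfolding A_def using GEM.bounded_sticks_measurable[OF GEM[OF that]] .
  have int: "integrable (M \<theta>) (\<lambda>\<omega>. indicator {\<omega>. A \<theta> \<omega>} \<omega> * exp (l * b \<theta> * Y \<theta> \<omega>))" if \<theta>: "0 < \<theta>" for l \<theta>
  proof -
    interpret G: GEM \<alpha> m "M \<theta>" "U \<theta>" \<theta> by (rule GEM) fact
    note [measurable] = Y_meas[OF \<theta>] A_meas[OF \<theta>]
    show ?thesis
    proof (rule G.integrable_const_bound)
      show "AE \<omega> in M \<theta>. norm (indicator {\<omega>. A \<theta> \<omega>} \<omega> * exp (l * b \<theta> * Y \<theta> \<omega>)) \<le>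
          exp (\<bar>l * b \<theta>\<bar> * (\<bar>a \<theta>\<bar> * (\<theta> ^ (m - 1) / C + 1)))"
        using Y_eq[OF \<theta>] H_bounds[OF \<theta>]
      proof eventually_elim
        case (elim \<omega>)
        have "\<bar>\<theta> ^ (m - 1) * H \<theta> \<omega> / C - 1\<bar> \<le> \<theta> ^ (m - 1) * H \<theta> \<omega> / C + 1"
          using elim \<theta> C_pos by (intro abs_leI) auto
        also have "\<dots> \<le> \<theta> ^ (m - 1) * 1 / C + 1"
          using elim \<theta> C_pos by (intro add_mono divide_right_mono mult_left_mono) auto
        finally have "\<bar>l * b \<theta>\<bar> * \<bar>Y \<theta> \<omega>\<bar> \<le> \<bar>l * b \<theta>\<bar> * (\<bar>a \<theta>\<bar> * (\<theta> ^ (m - 1) / C + 1))"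
          unfolding elim(1) abs_mult[of "a \<theta>"] by (intro mult_left_mono) auto
        moreover have "l * b \<theta> * Y \<theta> \<omega> \<le> \<bar>l * b \<theta>\<bar> * \<bar>Y \<theta> \<omega>\<bar>" by (metis abs_ge_self abs_mult)
        ultimately have "exp (l * b \<theta> * Y \<theta> \<omega>) \<le> exp (\<bar>l * b \<theta>\<bar> * (\<bar>a \<theta>\<bar> * (\<theta> ^ (m - 1) / C + 1)))"
          by simp
        then show ?case by (simp add: indicator_def)
      qed
    qed measurable
  qed
  have mgf: "\<forall>\<^sub>F \<theta> in at_top.
      exp (b \<theta> * (l\<^sup>2 * sigma_sq \<alpha> m / 2 - e)) \<le> (\<integral>\<omega>. indicator {\<omega>. A \<theta> \<omega>} \<omega> * exp (l * b \<theta> * Y \<theta> \<omega>) \<partial>M \<theta>) \<and>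
      (\<integral>\<omega>. indicator {\<omega>. A \<theta> \<omega>} \<omega> * exp (l * b \<theta> * Y \<theta> \<omega>) \<partial>M \<theta>) \<le> exp (b \<theta> * (l\<^sup>2 * sigma_sq \<alpha> m / 2 + e))"
    if e: "0 < e" for l e
  proof -
    obtain c where c: "0 < c" and bounds: "\<forall>\<^sub>F \<theta> in at_top. \<forall>(M :: 'w measure) U. GEM \<alpha> m M U \<theta> \<longrightarrow>
      (let s = l * \<theta> ^ m / (a \<theta> * C); \<eta> = c * (1 + \<theta> / \<alpha>) / a \<theta> ^ 3; \<kappa> = a \<theta> powr ((1 - \<epsilon>) / (m - 1)) / \<theta>;
        E = (\<integral>\<omega>. indicator {\<omega>. GEM.bounded_sticks U \<kappa> \<omega>} \<omega> * exp (s * homozygosity m (stick_breaking (\<lambda>k. U k \<omega>))) \<partial>M)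
      in exp (s * h \<theta> + s\<^sup>2 / 2 * v \<theta> - 2 * \<eta>) \<le> E \<and> E \<le> exp (s * h \<theta> + s\<^sup>2 / 2 * v \<theta> + \<eta>))"
      using eventually_exp_moment_bounds[OF a_infty \<epsilon>, of l] by (elim exE conjE)
    have X: "(X l \<longlongrightarrow> l\<^sup>2 * sigma_sq \<alpha> m / 2) at_top"
      unfolding X_def by (rule exponent_tendsto[OF a_infty a_sqrt])
    \<comment> \<open>The accumulated error, of order \<theta> / a^3, divided by \<open>b\<close>;
      it is of order 1 / a.\<close>
    have R: "((\<lambda>\<theta>. c * (1 + \<theta> / \<alpha>) / (\<theta> * a \<theta>)) \<longlongrightarrow> 0) at_top"
    proof -
      have "((\<lambda>\<theta>. c * (1 + \<theta> / \<alpha>) / \<theta>) \<longlongrightarrow> c * inverse \<alpha>) at_top" using alpha c by real_asymp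
      moreover have "((\<lambda>\<theta>. 1 / a \<theta>) \<longlongrightarrow> 0) at_top"
        using tendsto_inverse_0_at_top[OF a_infty] by (simp add: inverse_eq_divide)
      ultimately have "((\<lambda>\<theta>. c * (1 + \<theta> / \<alpha>) / \<theta> * (1 / a \<theta>)) \<longlongrightarrow> c * inverse \<alpha> * 0) at_top" by (rule tendsto_mult)
      then show ?thesis by simp
    qed
    \<comment> \<open>The tolerance \<open>e\<close> is shared: one half for the limit of the
      exponent and one half for the error, which enters the lower bound twice and hence is kept
      below a quarter.\<close>
    have "\<forall>\<^sub>F \<theta> in at_top. \<bar>X l \<theta> - l\<^sup>2 * sigma_sq \<alpha> m / 2\<bar> < e / 2"
      using tendstoD[OF X, of "e / 2"] e by (simp add: dist_real_def)
    moreover have "\<forall>\<^sub>F \<theta> in at_top. c * (1 + \<theta> / \<alpha>) / (\<theta> * a \<theta>) < e / 4"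
      using order_tendstoD(2)[OF R, of "e / 4"] e by simp
    ultimately show ?thesis
      using bounds eventually_gt_at_top[of 0] a_ge[of 1]
    proof eventually_elim
      case (elim \<theta>)
      interpret G: GEM \<alpha> m "M \<theta>" "U \<theta>" \<theta> by (rule GEM) (rule elim)
      note [measurable] = Y_meas[OF elim(4)] A_meas[OF elim(4)]
      have [measurable]: "H \<theta> \<in> borel_measurable (M \<theta>)" unfolding H_def[abs_def] by (rule G.H_measurable)
      define s where "s = l * \<theta> ^ m / (a \<theta> * C)"
      define \<eta> where "\<eta> = c * (1 + \<theta> / \<alpha>) / a \<theta> ^ 3"
      define E where "E = (\<integral>\<omega>. indicator {\<omega>. A \<theta> \<omega>} \<omega> * exp (s * H \<theta> \<omega>) \<partial>M \<theta>)"
      have a0: "0 < a \<theta>" and \<theta>: "0 < \<theta>" using elim by auto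
      have \<theta>m: "\<theta> ^ m = \<theta> * \<theta> ^ (m - 1)" using m by (simp add: power_eq_if)
      have \<theta>2m: "\<theta> ^ m * \<theta> ^ m = \<theta> * \<theta> ^ (2 * m - 1)" using m
        by (simp add: power_add[symmetric] flip: power_Suc mult_2)
      have E: "exp (s * h \<theta> + s\<^sup>2 / 2 * v \<theta> - 2 * \<eta>) \<le> E" "E \<le> exp (s * h \<theta> + s\<^sup>2 / 2 * v \<theta> + \<eta>)"
        using elim(3)[rule_format, OF GEM[OF \<theta>]]
        unfolding Let_def s_def[symmetric] \<eta>_def[symmetric] \<kappa>_def[symmetric] A_def[symmetric] H_def[symmetric] E_def[symmetric]
        by auto
      \<comment> \<open>This identity fixes the value of \<open>s\<close>; the constant - l \<theta>
        / a stems from centring at 1 and is cancelled, up to a vanishing error on the scale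
        \<open>b\<close>, by \<open>s * h \<theta>\<close>.\<close>
      have lbY: "l * b \<theta> * (a \<theta> * (\<theta> ^ (m - 1) * x / C - 1)) = s * x + - (l * \<theta> / a \<theta>)" for x
        using a0 C_pos by (simp add: b_def s_def \<theta>m power2_eq_square field_simps)
      have "(\<integral>\<omega>. indicator {\<omega>. A \<theta> \<omega>} \<omega> * exp (l * b \<theta> * Y \<theta> \<omega>) \<partial>M \<theta>) =
          (\<integral>\<omega>. exp (- (l * \<theta> / a \<theta>)) * (indicator {\<omega>. A \<theta> \<omega>} \<omega> * exp (s * H \<theta> \<omega>)) \<partial>M \<theta>)"
      proof (rule integral_cong_AE)
        show "AE \<omega> in M \<theta>. indicator {\<omega>. A \<theta> \<omega>} \<omega> * exp (l * b \<theta> * Y \<theta> \<omega>) =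
          exp (- (l * \<theta> / a \<theta>)) * (indicator {\<omega>. A \<theta> \<omega>} \<omega> * exp (s * H \<theta> \<omega>))"
          using Y_eq[OF \<theta>]
        proof eventually_elim
          case (elim \<omega>)
          have "exp (l * b \<theta> * Y \<theta> \<omega>) = exp (s * H \<theta> \<omega>) * exp (- (l * \<theta> / a \<theta>))"
            unfolding elim lbY by (rule exp_add)
          then show ?case by simp
        qed
      qed measurable
      also have "\<dots> = exp (- (l * \<theta> / a \<theta>)) * E" by (simp add: E_def)
      finally have eq: "(\<integral>\<omega>. indicator {\<omega>. A \<theta> \<omega>} \<omega> * exp (l * b \<theta> * Y \<theta> \<omega>) \<partial>M \<theta>) = exp (- (l * \<theta> / a \<theta>)) * E" .
      have b0: "0 < b \<theta>" using a0 \<theta> by (simp add: b_def)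
      have exponent: "- (l * \<theta> / a \<theta>) + (s * h \<theta> + s\<^sup>2 / 2 * v \<theta>) = b \<theta> * X l \<theta>"
      proof -
        have "s\<^sup>2 / 2 * v \<theta> = l\<^sup>2 / 2 * (\<theta> ^ m * \<theta> ^ m) * v \<theta> / ((a \<theta>)\<^sup>2 * C\<^sup>2)"
          by (simp add: s_def power2_eq_square mult_ac)
        also have "\<dots> = b \<theta> * (l\<^sup>2 / 2 * (\<theta> ^ (2 * m - 1) * v \<theta> / C\<^sup>2))"
          unfolding \<theta>2m by (simp add: b_def mult_ac)
        finally show ?thesis using lbY[of "h \<theta>"] by (simp add: X_def algebra_simps)
      qed
      have \<eta>: "\<eta> = b \<theta> * (c * (1 + \<theta> / \<alpha>) / (\<theta> * a \<theta>))"
        using \<theta> by (simp add: \<eta>_def b_def power2_eq_square power3_eq_cube)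
      have close: "\<bar>b \<theta> * X l \<theta> - b \<theta> * (l\<^sup>2 * sigma_sq \<alpha> m / 2)\<bar> \<le> b \<theta> * (e / 2)" "\<eta> \<le> b \<theta> * (e / 4)"
      proof -
        have "\<bar>b \<theta> * X l \<theta> - b \<theta> * (l\<^sup>2 * sigma_sq \<alpha> m / 2)\<bar> = b \<theta> * \<bar>X l \<theta> - l\<^sup>2 * sigma_sq \<alpha> m / 2\<bar>"
          unfolding right_diff_distrib[symmetric] abs_mult using b0 by simp
        then show "\<bar>b \<theta> * X l \<theta> - b \<theta> * (l\<^sup>2 * sigma_sq \<alpha> m / 2)\<bar> \<le> b \<theta> * (e / 2)"
          using b0 elim(1) by (simp only: mult_le_cancel_left_pos)
        show "\<eta> \<le> b \<theta> * (e / 4)"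
          unfolding \<eta> using b0 elim(2) by (intro mult_left_mono) auto
      qed
      have be: "b \<theta> * (e / 2) = b \<theta> * e / 2" "b \<theta> * (e / 4) = b \<theta> * e / 4" "0 < b \<theta> * e" using b0 e by auto
      have "exp (b \<theta> * (l\<^sup>2 * sigma_sq \<alpha> m / 2 - e)) \<le> exp (- (l * \<theta> / a \<theta>) + (s * h \<theta> + s\<^sup>2 / 2 * v \<theta>) - 2 * \<eta>)"
        unfolding exponent exp_le_cancel_iff right_diff_distrib[of "b \<theta>"] using close be by linarith
      also have "\<dots> = exp (- (l * \<theta> / a \<theta>)) * exp (s * h \<theta> + s\<^sup>2 / 2 * v \<theta> - 2 * \<eta>)"
        unfolding exp_add[symmetric] by (simp only: add_diff_eq)
      also have "\<dots> \<le> exp (- (l * \<theta> / a \<theta>)) * E" using E by (intro mult_left_mono) auto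
      finally have lower: "exp (b \<theta> * (l\<^sup>2 * sigma_sq \<alpha> m / 2 - e)) \<le> exp (- (l * \<theta> / a \<theta>)) * E" .
      have "exp (- (l * \<theta> / a \<theta>)) * E \<le> exp (- (l * \<theta> / a \<theta>)) * exp (s * h \<theta> + s\<^sup>2 / 2 * v \<theta> + \<eta>)"
        using E by (intro mult_left_mono) auto
      also have "\<dots> = exp (- (l * \<theta> / a \<theta>) + (s * h \<theta> + s\<^sup>2 / 2 * v \<theta>) + \<eta>)"
        unfolding exp_add[symmetric] by (simp only: add.assoc)
      also have "\<dots> \<le> exp (b \<theta> * (l\<^sup>2 * sigma_sq \<alpha> m / 2 + e))"
        unfolding exponent exp_le_cancel_iff distrib_left[of "b \<theta>"] using close be by linarith
      finally show ?case using lower unfolding eq by blast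
    qed
  qed
  have b_at_top: "filterlim b at_top at_top"
  proof -
    have "((\<lambda>\<theta>. (a \<theta> / sqrt \<theta>)\<^sup>2) \<longlongrightarrow> 0) at_top" using tendsto_power[OF a_sqrt, of 2] by simp
    moreover have "\<forall>\<^sub>F \<theta> in at_top. 0 < (a \<theta> / sqrt \<theta>)\<^sup>2"
      using a_ge[of 1] eventually_gt_at_top[of 0] by eventually_elim auto
    ultimately have "filterlim (\<lambda>\<theta>. inverse ((a \<theta> / sqrt \<theta>)\<^sup>2)) at_top at_top"
      by (rule filterlim_inverse_at_top)
    moreover have "\<forall>\<^sub>F \<theta> in at_top. inverse ((a \<theta> / sqrt \<theta>)\<^sup>2) = b \<theta>"
      using eventually_gt_at_top[of 0] by eventually_elim (simp add: b_def power_divide)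
    ultimately show ?thesis by (simp cong: filterlim_cong)
  qed
  have long: "\<forall>\<^sub>F \<theta> in at_top. \<forall>(M :: 'w measure) U. GEM \<alpha> m M U \<theta> \<longrightarrow>
    measure M {\<omega> \<in> space M. \<not> GEM.bounded_sticks U (a \<theta> powr ((1 - \<epsilon>) / (m - 1)) / \<theta>) \<omega>} \<le> exp (- L * (\<theta> / (a \<theta>)\<^sup>2))" for L
    by (rule eventually_long_sticks_negligible[OF a_infty \<epsilon> a_lower])
  interpret Gaussian_exp_moments M Y A b "sigma_sq \<alpha> m"
  proof
    show "0 < sigma_sq \<alpha> m" by (rule sigma_sq_pos)
    show "filterlim b at_top at_top" by (rule b_at_top)
    show "\<forall>\<^sub>F \<theta> in at_top. prob_space (M \<theta>) \<and> Y \<theta> \<in> borel_measurable (M \<theta>) \<and> Measurable.pred (M \<theta>) (A \<theta>) \<and>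
      (\<forall>l. integrable (M \<theta>) (\<lambda>\<omega>. indicator {\<omega>. A \<theta> \<omega>} \<omega> * exp (l * b \<theta> * Y \<theta> \<omega>)))"
      using eventually_gt_at_top[of 0] by eventually_elim (intro conjI allI prob Y_meas A_meas int)
  next
    fix L :: real
    show "\<forall>\<^sub>F \<theta> in at_top. measure (M \<theta>) {\<omega> \<in> space (M \<theta>). \<not> A \<theta> \<omega>} \<le> exp (- L * b \<theta>)"
      using long[of L] eventually_gt_at_top[of 0]
    proof eventually_elim
      case (elim \<theta>)
      show ?case using elim(1)[rule_format, OF GEM[OF elim(2)]] unfolding A_def \<kappa>_def b_def .
    qed
  next
    fix l e :: real assume "0 < e"
    from mgf[OF this, of l]
    show "\<forall>\<^sub>F \<theta> in at_top. (\<integral>\<omega>. indicator {\<omega>. A \<theta> \<omega>} \<omega> * exp (l * b \<theta> * Y \<theta> \<omega>) \<partial>M \<theta>) \<le> exp (b \<theta> * (l\<^sup>2 * sigma_sq \<alpha> m / 2 + e))"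
      and "\<forall>\<^sub>F \<theta> in at_top. exp (b \<theta> * (l\<^sup>2 * sigma_sq \<alpha> m / 2 - e)) \<le> (\<integral>\<omega>. indicator {\<omega>. A \<theta> \<omega>} \<omega> * exp (l * b \<theta> * Y \<theta> \<omega>) \<partial>M \<theta>)"
      by (auto elim: eventually_mono)
  qed
  show ?thesis using LDP_Gaussian unfolding Y_def[abs_def] b_def by simp
qed

end
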